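(* Let $m\ge 0$ and $\alpha,\beta\in\mathbb{R}$. For every pair $(u_0,v_0)$ of complex-valued functions in $L^2(\mathbb{R})$, the Cauchy problem $$i(u_t+u_x)=-mv+N_1(u,v),\qquad i(v_t-v_x)=-mu+N_2(u,v),\qquad (u,v)|_{t=0}=(u_0,v_0),$$ admits a unique global strong solution $(u,v)\in C([0,\infty);L^2(\mathbb{R}))$. Moreover, $|u||v|\in L^2([0,T]\times\mathbb{R})$ for every $T>0$.
   Context: Here $(t,x)\in[0,\infty)\times\mathbb{R}$, $(u,v)=(u,v)(x,t)\in\mathbb{C}^2$, and the nonlinear terms are $$N_1=\partial_{\overline u}W(u,v),\qquad N_2=\partial_{\overline v}W(u,v),\qquad W(u,v)=\alpha|u|^2|v|^2+\beta(\overline u v+u\overline v)^2,$$ where $\partial_{\overline u},\partial_{\overline v}$ are the Wirtinger derivatives; explicitly $N_1=\alpha u|v|^2+2\beta(\overline u v+u\overline v)v$ and $N_2=\alpha |u|^2v+2\beta(\overline u v+u\overline v)u$. Definition (strong solution). A pair $(u,v)\in C([0,\infty);L^2(\mathbb{R}))$ is called a strong solution of the Cauchy problem on $\mathbb{R}\times[0,T]$ if there exists a sequence of classical solutions $(u^{(n)},v^{(n)})$ of the system of two equations on $\mathbb{R}\times[0,T]$ such that $(u^{(n)},v^{(n)})\to(u,v)$ strongly in $L^2(\mathbb{R}\times[0,T])$ and $(u^{(n)},v^{(n)})|_{t=0}\to(u_0,v_0)$ strongly in $L^2(\mathbb{R})$ as $n\to\infty$. A global strong solution is a pair that is a strong solution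 on $\mathbb{R}\times[0,T]$ for every $T>0$. *)

theory Defs
  imports "HOL-Analysis.Analysis"
begin

section \<open>Square-integrable functions\<close>

text \<open>Elements of \<open>L\<^sup>2(S)\<close> are represented by functions; only their values almost everywhere on \<open>S\<close>
  matter. The measure is the complete Lebesgue measure.\<close>

definition L2 :: "'a::euclidean_space set \<Rightarrow> ('a \<Rightarrow> 'b::euclidean_space) \<Rightarrow> bool" where
  "L2 S f \<longleftrightarrow> f \<in> borel_measurable (lebesgue_on S) \<and>
     integrable (lebesgue_on S) (\<lambda>x. (norm (f x))\<^sup>2)"

definition L2_norm :: "'a::euclidean_space set \<Rightarrow> ('a \<Rightarrow> 'b::euclidean_space) \<Rightarrow> real" where
  "L2_norm S f = sqrt (LINT x|lebesgue_on S. (norm (f x))\<^sup>2)"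

definition L2_converges ::
    "'a::euclidean_space set \<Rightarrow> (nat \<Rightarrow> 'a \<Rightarrow> 'b::euclidean_space) \<Rightarrow> ('a \<Rightarrow> 'b) \<Rightarrow> bool" where
  "L2_converges S f g \<longleftrightarrow> (\<forall>n. L2 S (f n)) \<and> L2 S g \<and>
     (\<lambda>n. L2_norm S (\<lambda>x. f n x - g x)) \<longlonglongrightarrow> 0"

text \<open>Functions of time and space are curried with time first: \<open>u t x\<close>. The following is membership
  in \<open>C([0,\<infinity>); L\<^sup>2(\<real>))\<close>; values at negative times are irrelevant.\<close>

definition continuous_L2_curve :: "(real \<Rightarrow> real \<Rightarrow> complex) \<Rightarrow> bool" where
  "continuous_L2_curve u \<longleftrightarrow> (\<forall>t\<ge>0. L2 UNIV (u t)) \<and>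
     (\<forall>t\<ge>0. ((\<lambda>s. L2_norm UNIV (\<lambda>x. u s x - u t x)) \<longlongrightarrow> 0) (at t within {0..}))"


section \<open>The nonlinearity\<close>

definition wirtinger_bar :: "(complex \<Rightarrow> complex) \<Rightarrow> complex \<Rightarrow> complex" where
  "wirtinger_bar F z =
     (vector_derivative (\<lambda>s. F (z + of_real s)) (at 0) +
      \<i> * vector_derivative (\<lambda>s. F (z + \<i> * of_real s)) (at 0)) / 2"

definition W :: "real \<Rightarrow> real \<Rightarrow> complex \<Rightarrow> complex \<Rightarrow> complex" where
  "W \<alpha> \<beta> u v = of_real \<alpha> * of_real ((cmod u)\<^sup>2 * (cmod v)\<^sup>2) +
     of_real \<beta> * (cnj u * v + u * cnj v)\<^sup>2"

definition N1 :: "real \<Rightarrow> real \<Rightarrow> complex \<Rightarrow> complex \<Rightarrow> complex" where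
  "N1 \<alpha> \<beta> u v = wirtinger_bar (\<lambda>z. W \<alpha> \<beta> z v) u"

definition N2 :: "real \<Rightarrow> real \<Rightarrow> complex \<Rightarrow> complex \<Rightarrow> complex" where
  "N2 \<alpha> \<beta> u v = wirtinger_bar (\<lambda>z. W \<alpha> \<beta> u z) v"

lemma W_commute: "W \<alpha> \<beta> u v = W \<alpha> \<beta> v u"
  by (simp add: W_def algebra_simps)

lemma wirtinger_bar_W:
  "wirtinger_bar (\<lambda>z. W \<alpha> \<beta> z v) u =
     of_real \<alpha> * u * of_real ((cmod v)\<^sup>2) + 2 * of_real \<beta> * (cnj u * v + u * cnj v) * v"
proof -
  have W: "W \<alpha> \<beta> z v =
      of_real \<alpha> * (z * cnj z * (v * cnj v)) + of_real \<beta> * (cnj z * v + z * cnj v)\<^sup>2" for z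
    by (simp add: W_def complex_norm_square del: of_real_power)
  have dir: "((\<lambda>s. W \<alpha> \<beta> (u + e * of_real s) v) has_vector_derivative
      (of_real \<alpha> * ((e * cnj u + u * cnj e) * (v * cnj v)) +
       of_real \<beta> * (2 * (cnj u * v + u * cnj v) * (cnj e * v + e * cnj v)))) (at 0)" for e
    unfolding W
    by (auto intro!: derivative_eq_intros has_vector_derivative_cnj
        simp: power2_eq_square algebra_simps)
  show ?thesis
    unfolding wirtinger_bar_def vector_derivative_at[OF dir[of \<i>]]
      vector_derivative_at[OF dir[of 1], simplified mult_1]
    by (simp add: complex_norm_square algebra_simps del: of_real_power)
qed

lemma N1_explicit:
  "N1 \<alpha> \<beta> u v =
     of_real \<alpha> * u * of_real ((cmod v)\<^sup>2) + 2 * of_real \<beta> * (cnj u * v + u * cnj v) * v"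
  by (simp add: N1_def wirtinger_bar_W del: of_real_power)

lemma N2_explicit:
  "N2 \<alpha> \<beta> u v =
     of_real \<alpha> * of_real ((cmod u)\<^sup>2) * v + 2 * of_real \<beta> * (cnj u * v + u * cnj v) * u"
  unfolding N2_def W_commute[of \<alpha> \<beta> u] wirtinger_bar_W
  by (simp add: algebra_simps)


section \<open>Solutions\<close>

text \<open>A classical solution on \<open>\<real> \<times> [0,T]\<close> is a \<open>C\<^sup>1\<close> pair, with one-sided time derivatives at
  \<open>t = 0\<close> and \<open>t = T\<close>, satisfying the equations pointwise.\<close>

definition classical_solution ::
    "real \<Rightarrow> real \<Rightarrow> real \<Rightarrow> real \<Rightarrow> (real \<Rightarrow> real \<Rightarrow> complex) \<Rightarrow> (real \<Rightarrow> real \<Rightarrow> complex) \<Rightarrow> bool"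
  where
  "classical_solution m \<alpha> \<beta> T u v \<longleftrightarrow>
     (\<exists>ut ux vt vx :: real \<Rightarrow> real \<Rightarrow> complex.
        continuous_on ({0..T} \<times> UNIV) (\<lambda>(t, x). u t x) \<and>
        continuous_on ({0..T} \<times> UNIV) (\<lambda>(t, x). v t x) \<and>
        continuous_on ({0..T} \<times> UNIV) (\<lambda>(t, x). ut t x) \<and>
        continuous_on ({0..T} \<times> UNIV) (\<lambda>(t, x). ux t x) \<and>
        continuous_on ({0..T} \<times> UNIV) (\<lambda>(t, x). vt t x) \<and>
        continuous_on ({0..T} \<times> UNIV) (\<lambda>(t, x). vx t x) \<and>
        (\<forall>t\<in>{0..T}. \<forall>x.
           ((\<lambda>s. u s x) has_vector_derivative ut t x) (at t within {0..T}) \<and>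
           ((\<lambda>y. u t y) has_vector_derivative ux t x) (at x) \<and>
           ((\<lambda>s. v s x) has_vector_derivative vt t x) (at t within {0..T}) \<and>
           ((\<lambda>y. v t y) has_vector_derivative vx t x) (at x) \<and>
           \<i> * (ut t x + ux t x) = - of_real m * v t x + N1 \<alpha> \<beta> (u t x) (v t x) \<and>
           \<i> * (vt t x - vx t x) = - of_real m * u t x + N2 \<alpha> \<beta> (u t x) (v t x)))"

text \<open>Convergence in \<open>L\<^sup>2([0,T] \<times> \<real>)\<close> makes the limit jointly measurable: an element of
  \<open>C([0,\<infinity>); L\<^sup>2(\<real>))\<close> is here given by a representative that is measurable on space-time. Such a
  representative always exists and is unique up to a null set.\<close>

definition strong_solution ::
    "real \<Rightarrow> real \<Rightarrow> real \<Rightarrow> (real \<Rightarrow> complex) \<Rightarrow> (real \<Rightarrow> complex) \<Rightarrow> real \<Rightarrow>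
     (real \<Rightarrow> real \<Rightarrow> complex) \<Rightarrow> (real \<Rightarrow> real \<Rightarrow> complex) \<Rightarrow> bool" where
  "strong_solution m \<alpha> \<beta> u0 v0 T u v \<longleftrightarrow>
     continuous_L2_curve u \<and> continuous_L2_curve v \<and>
     (\<exists>un vn :: nat \<Rightarrow> real \<Rightarrow> real \<Rightarrow> complex.
        (\<forall>n. classical_solution m \<alpha> \<beta> T (un n) (vn n)) \<and>
        L2_converges ({0..T} \<times> UNIV) (\<lambda>n (t, x). un n t x) (\<lambda>(t, x). u t x) \<and>
        L2_converges ({0..T} \<times> UNIV) (\<lambda>n (t, x). vn n t x) (\<lambda>(t, x). v t x) \<and>
        L2_converges UNIV (\<lambda>n. un n 0) u0 \<and>
        L2_converges UNIV (\<lambda>n. vn n 0) v0)"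

definition global_strong_solution ::
    "real \<Rightarrow> real \<Rightarrow> real \<Rightarrow> (real \<Rightarrow> complex) \<Rightarrow> (real \<Rightarrow> complex) \<Rightarrow>
     (real \<Rightarrow> real \<Rightarrow> complex) \<Rightarrow> (real \<Rightarrow> real \<Rightarrow> complex) \<Rightarrow> bool" where
  "global_strong_solution m \<alpha> \<beta> u0 v0 u v \<longleftrightarrow>
     (\<forall>T>0. strong_solution m \<alpha> \<beta> u0 v0 T u v)"

end

theory Submission
  imports Defs
begin

text \<open>
  All estimates are proved for classical solutions, with constants that depend on the initial data
  only through their \<open>L\<^sup>2\<close> norms.

  \<^emph>\<open>Pointwise bound.\<close> The total charge \<open>|u|\<^sup>2 + |v|\<^sup>2\<close> obeys a conservation law, so the charge
  that leaves a backward light cone through its sides is at most the charge in its base. Through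
  the left side, a right-moving characteristic, only \<open>v\<close> flows out: the integral of \<open>|v|\<^sup>2\<close> along
  a right-moving characteristic is at most half the initial charge. Along that characteristic
  \<open>|u|\<^sup>2\<close> changes at most at the rate \<open>m (|u|\<^sup>2 + |v|\<^sup>2) + 2 K |u|\<^sup>2 |v|\<^sup>2\<close>, because the cubic
  terms exchange charge between the components at a rate of at most \<open>K |u|\<^sup>2 |v|\<^sup>2\<close>. Gronwall's
  inequality therefore gives \<open>|u(t,x)|\<^sup>2 \<le> G (|u\<^sub>0(x - t)|\<^sup>2 + m M / 2)\<close> and, symmetrically, a
  bound of \<open>|v(t,x)|\<^sup>2\<close> by \<open>|v\<^sub>0(x + t)|\<^sup>2\<close> (\<open>pointwise_bound\<close>). Charge thus cannot concentrate.

  \<^emph>\<open>Stability.\<close> For two solutions put \<open>A = |u - u'|\<^sup>2\<close> and \<open>B = |v - v'|\<^sup>2\<close>. Both \<open>A\<^sub>t + A\<^sub>x\<close> and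
  \<open>B\<^sub>t - B\<^sub>x\<close> are at most \<open>m (A + B) + 4 K (A q + B p)\<close> with \<open>p = |u|\<^sup>2 + |u'|\<^sup>2\<close> and \<open>q = |v|\<^sup>2 +
  |v'|\<^sup>2\<close>. By the pointwise bound \<open>p \<le> P(x - t) + D\<close> and \<open>q \<le> Q(x + t) + D\<close> with \<open>P\<close> and \<open>Q\<close>
  integrable. The weight \<open>exp (- \<mu> t - \<kappa> S\<^sub>Q(x + t) + \<kappa> S\<^sub>P(x - t))\<close>, where \<open>S\<^sub>P\<close> and \<open>S\<^sub>Q\<close> are
  the antiderivatives of \<open>P\<close> and \<open>Q\<close> that vanish at 0, lies between two positive constants on
  \<open>[0,T] \<times> \<real>\<close>; its logarithmic derivative is \<open>- \<mu> - 2 \<kappa> Q(x + t)\<close> along right-moving and \<open>- \<mu> - 2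
  \<kappa> P(x - t)\<close> along left-moving characteristics. For large \<open>\<mu>\<close> and \<open>\<kappa>\<close> this absorbs the whole
  source, even with \<open>A |v|\<^sup>2\<close> to spare, so the weighted integral of \<open>A + B\<close> decreases
  (\<open>stability_on_cone\<close>). This yields Lipschitz dependence on the data in \<open>L\<^sup>2\<close>, and the spare
  term, with \<open>u' = v' = 0\<close>, bounds \<open>|u| |v|\<close> in \<open>L\<^sup>2([0,T] \<times> \<real>)\<close>.

  \<^emph>\<open>Classical solutions.\<close> For \<open>C\<^sup>1\<close> data with compact support, Picard iteration for the solution
  together with its space derivative solves the equation with the nonlinearity cut off at large
  amplitude (\<open>semilinear_transport_solution\<close>). The cut-off multiplies both nonlinear terms by the
  same real factor in \<open>[0,1]\<close>, so the pointwise bound holds for the truncated equation with the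
  same constants. A cut-off level above this bound is therefore never reached.

  \<^emph>\<open>Limits.\<close> Such data are dense in \<open>L\<^sup>2(\<real>)\<close>. If they approach \<open>(u\<^sub>0,v\<^sub>0)\<close> geometrically fast,
  then by stability the solutions converge almost everywhere in space at every time, and in \<open>L\<^sup>2\<close>
  uniformly on \<open>[0,T]\<close>; the limit is the strong solution, and Fatou's lemma transfers the bound of
  \<open>|u| |v|\<close>. Any other strong solution is a limit of classical solutions whose data approach the
  same \<open>(u\<^sub>0,v\<^sub>0)\<close>, so it agrees with this one almost everywhere on each strip, hence at almost
  every time and, by continuity in time, at every time.
\<close>


section \<open>Balance laws on light cones\<close>

text \<open>A \<open>C\<^sup>1\<close> function on \<open>[0,T] \<times> \<real>\<close> together with its partial derivatives, one-sided in time at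
  both ends as in the definition of a classical solution.\<close>

definition C1_strip :: "real \<Rightarrow> (real \<Rightarrow> real \<Rightarrow> 'a::real_normed_vector) \<Rightarrow> (real \<Rightarrow> real \<Rightarrow> 'a) \<Rightarrow>
    (real \<Rightarrow> real \<Rightarrow> 'a) \<Rightarrow> bool" where
  "C1_strip T f ft fx \<longleftrightarrow>
     continuous_on ({0..T} \<times> UNIV) (\<lambda>(t, x). f t x) \<and>
     continuous_on ({0..T} \<times> UNIV) (\<lambda>(t, x). ft t x) \<and>
     continuous_on ({0..T} \<times> UNIV) (\<lambda>(t, x). fx t x) \<and>
     (\<forall>t\<in>{0..T}. \<forall>x.
        ((\<lambda>s. f s x) has_vector_derivative ft t x) (at t within {0..T}) \<and>
        ((\<lambda>y. f t y) has_vector_derivative fx t x) (at x))"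

lemma strip_continuous_compose:
  assumes "continuous_on ({0..T} \<times> UNIV) (\<lambda>(t, x). f t x)"
    and "continuous_on S a" "continuous_on S b" "\<And>z. z \<in> S \<Longrightarrow> a z \<in> {0..T::real}"
  shows "continuous_on S (\<lambda>z. f (a z) (b z :: real))"
proof -
  have "continuous_on S (\<lambda>z. (\<lambda>(t, x). f t x) (a z, b z))"
    by (rule continuous_on_compose2[OF assms(1)]) (use assms in \<open>auto intro!: continuous_intros\<close>)
  then show ?thesis by simp
qed

lemma C1_stripD:
  assumes "C1_strip T f ft fx"
  shows "continuous_on ({0..T} \<times> UNIV) (\<lambda>(t, x). f t x)"
    and "continuous_on ({0..T} \<times> UNIV) (\<lambda>(t, x). ft t x)"
    and "continuous_on ({0..T} \<times> UNIV) (\<lambda>(t, x). fx t x)"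
    and "t \<in> {0..T} \<Longrightarrow> ((\<lambda>s. f s x) has_vector_derivative ft t x) (at t within {0..T})"
    and "t \<in> {0..T} \<Longrightarrow> ((\<lambda>y. f t y) has_vector_derivative fx t x) (at x)"
  using assms unfolding C1_strip_def by auto

lemmas C1_strip_continuous = C1_stripD(1-3)[THEN strip_continuous_compose]

lemma C1_strip_slice:
  assumes "C1_strip T f ft fx" "t \<in> {0..T}"
  shows "continuous_on S (f t)" "continuous_on S (ft t)" "continuous_on S (fx t)"
  using assms(2) by (auto intro!: C1_strip_continuous[OF assms(1)] continuous_intros)

lemma C1_strip_has_derivative:
  fixes f :: "real \<Rightarrow> real \<Rightarrow> 'a::real_normed_vector"
  assumes "C1_strip T f ft fx" "t \<in> {0..T}"
  shows "((\<lambda>(t, x). f t x) has_derivative (\<lambda>(a, b). a *\<^sub>R ft t x + b *\<^sub>R fx t x))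
           (at (t, x) within {0..T} \<times> UNIV)"
proof -
  have cont: "continuous_on ({0..T} \<times> UNIV) (\<lambda>(t, x). blinfun_scaleR_left (fx t x))"
    using bounded_linear.continuous_on[OF bounded_linear_blinfun_scaleR_left C1_stripD(3)[OF assms(1)]]
    by (simp add: case_prod_beta)
  have "((\<lambda>(t, x). f t x) has_derivative
      (\<lambda>(tx, ty). (tx *\<^sub>R ft t x) + blinfun_apply (blinfun_scaleR_left (fx t x)) ty))
           (at (t, x) within {0..T} \<times> UNIV)"
  proof (rule has_derivative_partialsI)
    show "((\<lambda>s. f s x) has_derivative (\<lambda>h. h *\<^sub>R ft t x)) (at t within {0..T})"
      using C1_stripD(4)[OF assms] by (simp add: has_vector_derivative_def)
    show "((\<lambda>y. f s y) has_derivative blinfun_apply (blinfun_scaleR_left (fx s y))) (at y within UNIV)"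
      if "s \<in> {0..T}" for s y
      using C1_stripD(5)[OF assms(1) that, of y] by (simp add: has_vector_derivative_def)
    show "continuous (at (t, x) within {0..T} \<times> UNIV) (\<lambda>(t, x). blinfun_scaleR_left (fx t x))"
      using cont assms(2) by (simp add: continuous_on_eq_continuous_within)
  qed auto
  then show ?thesis by (simp add: case_prod_beta)
qed

lemma C1_strip_curve:
  fixes f :: "real \<Rightarrow> real \<Rightarrow> 'a::real_normed_vector"
  assumes f: "C1_strip T f ft fx" and "t \<in> S" "S \<subseteq> {0..T}"
    and g: "(g has_real_derivative c) (at t within S)"
  shows "((\<lambda>s. f s (g s)) has_vector_derivative ft t (g t) + c *\<^sub>R fx t (g t)) (at t within S)"
proof -
  have "((\<lambda>s. (\<lambda>(t, x). f t x) (s, g s)) has_derivative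
      (\<lambda>h. (\<lambda>(t, x) (a, b). a *\<^sub>R ft t x + b *\<^sub>R fx t x) (t, g t) (h, c * h))) (at t within S)"
  proof (rule has_derivative_in_compose2[where t = "{0..T} \<times> UNIV"
        and g' = "\<lambda>(t, x) (a, b). a *\<^sub>R ft t x + b *\<^sub>R fx t x"])
    show "((\<lambda>(t, x). f t x) has_derivative
        (\<lambda>(t, x) (a, b). a *\<^sub>R ft t x + b *\<^sub>R fx t x) z) (at z within {0..T} \<times> UNIV)"
      if "z \<in> {0..T} \<times> UNIV" for z
      using C1_strip_has_derivative[OF f] that by auto
    show "((\<lambda>s. (s, g s)) has_derivative (\<lambda>h. (h, c * h))) (at t within S)"
      by (intro has_derivative_Pair has_derivative_ident g[unfolded has_field_derivative_def])
    show "(\<lambda>s. (s, g s)) ` S \<subseteq> {0..T} \<times> UNIV" using assms(3) by auto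
  qed fact
  then show ?thesis
    by (simp add: has_vector_derivative_def scaleR_add_right mult.commute)
qed

text \<open>Let \<open>r - s\<close> be the half-width at time \<open>s\<close> of a backward light cone around \<open>X\<close>. Parametrising
  the slice by \<open>x = X + (r - s) y\<close> with \<open>-1 \<le> y \<le> 1\<close> keeps the domain of integration fixed, so
  Leibniz' rule for a fixed interval applies. The \<open>s\<close>-derivative of the slice integral differs
  from the source integral by the exact \<open>y\<close>-derivative of \<open>y (A + B) + (A - B)\<close>, which produces
  the flux through the two sides.\<close>

lemma cone_identity:
  fixes A B :: "real \<Rightarrow> real \<Rightarrow> real"
  assumes A: "C1_strip T A At Ax" and B: "C1_strip T B Bt Bx" and t: "0 \<le> t" "t \<le> T"
  shows "integral {-1..1} (\<lambda>y. (r - t) * (A t (X + (r - t) * y) + B t (X + (r - t) * y))) +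
     integral {0..t} (\<lambda>s. 2 * A s (X + (r - s)) + 2 * B s (X - (r - s))) =
     integral {-1..1} (\<lambda>y. r * (A 0 (X + r * y) + B 0 (X + r * y))) +
     integral {0..t} (\<lambda>s. integral {-1..1} (\<lambda>y. (r - s) *
        (At s (X + (r - s) * y) + Ax s (X + (r - s) * y) + Bt s (X + (r - s) * y) - Bx s (X +
            (r - s) * y))))"
proof -
  define E where "E s = integral {-1..1} (\<lambda>y. (r - s) * (A s (X + (r - s) * y) + B s (X +
      (r - s) * y)))" for s
  define d where "d s y = (r - s) *
        (At s (X + (r - s) * y) + Ax s (X + (r - s) * y) + Bt s (X + (r - s) * y) - Bx s (X +
            (r - s) * y))" for s y
  define D where "D s = integral {-1..1} (d s)" for s
  define flux where "flux s = 2 * A s (X + (r - s)) + 2 * B s (X - (r - s))" for s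
  define g where "g s y = (A s (X + (r - s) * y) + B s (X + (r - s) * y)) +
      (r - s) * (y * Ax s (X + (r - s) * y) + y * Bx s (X + (r - s) * y)
         + Ax s (X + (r - s) * y) - Bx s (X + (r - s) * y))" for s y
  note cont = C1_strip_continuous[OF A] C1_strip_continuous[OF B]
  have cd: "continuous_on ({0..t} \<times> {-1..1}) (\<lambda>(s, y). d s y)"
    unfolding d_def case_prod_beta
    by (intro continuous_intros cont) (use t in auto)
  have cg: "continuous_on ({0..t} \<times> {-1..1}) (\<lambda>(s, y). g s y)"
    unfolding g_def case_prod_beta
    by (intro continuous_intros cont) (use t in auto)
  have gint: "(g s has_integral flux s) {-1..1}" if s: "s \<in> {0..t}" for s
  proof -
    have *: "((\<lambda>y. y * (A s (X + (r - s) * y) + B s (X + (r - s) * y)) + (A s (X + (r - s) * y) -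
        B s (X + (r - s) * y)))
        has_vector_derivative g s y) (at y within {-1..1})" for y
    proof -
      have sT: "s \<in> {0..T}" using s t by auto
      have aff: "((\<lambda>y. X + (r - s) * y) has_real_derivative r - s) (at y within {-1..1})"
        by (auto intro!: derivative_eq_intros)
      have 1: "((\<lambda>y. A s (X + (r - s) * y)) has_real_derivative (r - s) * Ax s (X + (r - s) * y))
          (at y within {-1..1})"
        using DERIV_chain2[OF C1_stripD(5)[OF A sT, folded
            has_real_derivative_iff_has_vector_derivative] aff]
        by (simp add: mult.commute)
      have 2: "((\<lambda>y. B s (X + (r - s) * y)) has_real_derivative (r - s) * Bx s (X + (r - s) * y))
          (at y within {-1..1})"
        using DERIV_chain2[OF C1_stripD(5)[OF B sT, folded
            has_real_derivative_iff_has_vector_derivative] aff]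
        by (simp add: mult.commute)
      show ?thesis
        unfolding has_real_derivative_iff_has_vector_derivative[symmetric] g_def
        by (rule derivative_eq_intros 1 2 refl)+ (simp add: algebra_simps)
    qed
    have "(g s has_integral (\<lambda>y. y * (A s (X + (r - s) * y) + B s (X + (r - s) * y)) +
        (A s (X + (r - s) * y) - B s (X + (r - s) * y))) 1
       - (\<lambda>y. y * (A s (X + (r - s) * y) + B s (X + (r - s) * y)) + (A s (X + (r - s) * y) -
           B s (X + (r - s) * y))) (-1)) {-1..1}"
      by (rule fundamental_theorem_of_calculus) (use * in auto)
    moreover have "X + (s - r) = X - (r - s)" by simp
    ultimately show ?thesis by (simp add: flux_def)
  qed
  have E': "(E has_vector_derivative D s - flux s) (at s within {0..t})" if s: "s \<in> {0..t}" for s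
  proof -
    have "((\<lambda>s. integral (cbox (-1) 1) (\<lambda>y. (r - s) * (A s (X + (r - s) * y) + B s (X + (r - s) * y))))
       has_vector_derivative integral (cbox (-1) 1) (\<lambda>y. d s y - g s y)) (at s within {0..t})"
    proof (rule leibniz_rule_vector_derivative)
      fix s y :: real assume sy: "s \<in> {0..t}" "y \<in> cbox (-1) 1"
      have 1: "((\<lambda>s. A s (X + (r - s) * y)) has_real_derivative At s (X + (r - s) * y) +
          (- y) *\<^sub>R Ax s (X + (r - s) * y)) (at s within {0..t})"
        unfolding has_real_derivative_iff_has_vector_derivative
        by (rule C1_strip_curve[OF A]) (use t sy in \<open>auto intro!: derivative_eq_intros\<close>)
      have 2: "((\<lambda>s. B s (X + (r - s) * y)) has_real_derivative Bt s (X + (r - s) * y) +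
          (- y) *\<^sub>R Bx s (X + (r - s) * y)) (at s within {0..t})"
        unfolding has_real_derivative_iff_has_vector_derivative
        by (rule C1_strip_curve[OF B]) (use t sy in \<open>auto intro!: derivative_eq_intros\<close>)
      show "((\<lambda>s. (r - s) * (A s (X + (r - s) * y) + B s (X + (r - s) * y))) has_vector_derivative d
          s y - g s y) (at s within {0..t})"
        unfolding has_real_derivative_iff_has_vector_derivative[symmetric] g_def d_def
        by (rule derivative_eq_intros 1 2 refl)+ (simp add: algebra_simps)
    next
      fix s assume "s \<in> {0..t}"
      then show "(\<lambda>y. (r - s) * (A s (X + (r - s) * y) + B s (X + (r - s) * y))) integrable_on cbox
          (-1) 1"
        by (intro integrable_continuous continuous_intros cont) (use t in auto)
    next
      show "continuous_on ({0..t} \<times> cbox (-1) 1) (\<lambda>(s, y). d s y - g s y)"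
        using cd cg by (auto simp: case_prod_beta intro!: continuous_intros)
    qed (use s in auto)
    moreover have "integral (cbox (-1) 1) (\<lambda>y. d s y - g s y) = D s - flux s"
    proof -
      have "d s integrable_on {-1..1}"
        unfolding d_def by (intro integrable_continuous_interval continuous_intros cont) (use s t
            in auto)
      then show ?thesis
        using gint[OF s] by (simp add: D_def integral_diff has_integral_integrable integral_unique)
    qed
    ultimately show ?thesis by (simp add: E_def[abs_def])
  qed
  have cD: "continuous_on {0..t} D"
    unfolding D_def using integral_continuous_on_param[of "{0..t}" "-1" 1 d] cd by simp
  have cf: "continuous_on {0..t} flux"
    unfolding flux_def by (intro continuous_intros cont) (use t in auto)
  have "((\<lambda>s. D s - flux s) has_integral E t - E 0) {0..t}"
    by (rule fundamental_theorem_of_calculus) (use t E' in auto)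
  then have "integral {0..t} D - integral {0..t} flux = E t - E 0"
    using integral_diff[OF integrable_continuous_interval[OF cD] integrable_continuous_interval[OF cf]]
    by (simp add: integral_unique)
  then show ?thesis
    unfolding E_def D_def flux_def d_def by simp
qed

lemma integral_centered_interval:
  fixes f :: "real \<Rightarrow> real"
  assumes "continuous_on UNIV f" "0 \<le> r"
  shows "integral {-1..1} (\<lambda>y. r * f (X + r * y)) = integral {X - r..X + r} f"
proof -
  have b: "X - r \<le> X + r * y \<and> X + r * y \<le> X + r" if "- 1 \<le> y" "y \<le> 1" for y
    using mult_left_mono[OF that(1) assms(2)] mult_left_mono[OF that(2) assms(2)] by simp
  have "((\<lambda>y. r *\<^sub>R f (X + r * y)) has_integral integral {X + r * (-1)..X + r * 1} f) {-1..1}"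
    by (rule has_integral_substitution[where c = "X - r" and d = "X + r"])
      (use assms b in \<open>auto intro!: derivative_eq_intros intro: continuous_on_subset[OF assms(1)]\<close>)
  then show ?thesis by (intro integral_unique) simp
qed

text \<open>The balance law in the original variables: \<open>A\<close> moves to the right and leaves the cone
  through its right side only, \<open>B\<close> moves to the left and leaves through the left side only.\<close>

corollary cone_balance:
  fixes A B :: "real \<Rightarrow> real \<Rightarrow> real"
  assumes A: "C1_strip T A At Ax" and B: "C1_strip T B Bt Bx" and t: "0 \<le> t" "t \<le> T" "t \<le> r"
  shows "integral {X - (r - t)..X + (r - t)} (\<lambda>x. A t x + B t x) +
     integral {0..t} (\<lambda>s. 2 * A s (X + (r - s)) + 2 * B s (X - (r - s))) =
     integral {X - r..X + r} (\<lambda>x. A 0 x + B 0 x) +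
     integral {0..t} (\<lambda>s. integral {X - (r - s)..X + (r - s)} (\<lambda>x. At s x + Ax s x + Bt s x - Bx s x))"
proof -
  note cont = C1_strip_slice[OF A] C1_strip_slice[OF B]
  have 1: "integral {X - (r - t)..X + (r - t)} (\<lambda>x. A t x + B t x) =
      integral {-1..1} (\<lambda>y. (r - t) * (A t (X + (r - t) * y) + B t (X + (r - t) * y)))"
    by (rule integral_centered_interval[symmetric]) (use t in \<open>auto intro!: continuous_intros cont\<close>)
  have 2: "integral {X - r..X + r} (\<lambda>x. A 0 x + B 0 x) =
      integral {-1..1} (\<lambda>y. r * (A 0 (X + r * y) + B 0 (X + r * y)))"
    by (rule integral_centered_interval[symmetric]) (use t in \<open>auto intro!: continuous_intros cont\<close>)
  have 3: "integral {X - (r - s)..X + (r - s)} (\<lambda>x. At s x + Ax s x + Bt s x - Bx s x) =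
      integral {-1..1} (\<lambda>y. (r - s) * (At s (X + (r - s) * y) + Ax s (X + (r - s) * y)
        + Bt s (X + (r - s) * y) - Bx s (X + (r - s) * y)))" if "s \<in> {0..t}" for s
    by (rule integral_centered_interval[symmetric]) (use t that in \<open>auto intro!: continuous_intros
        cont\<close>)
  have 4: "integral {0..t} (\<lambda>s. integral {X - (r - s)..X + (r - s)} (\<lambda>x. At s x + Ax s x +
      Bt s x - Bx s x)) =
      integral {0..t} (\<lambda>s. integral {-1..1} (\<lambda>y. (r - s) * (At s (X + (r - s) * y) + Ax s (X +
          (r - s) * y)
        + Bt s (X + (r - s) * y) - Bx s (X + (r - s) * y))))"
    by (rule integral_cong) (rule 3)
  show ?thesis
    unfolding 1 2 4 by (rule cone_identity[OF A B t(1,2)])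
qed

section \<open>A priori bounds from charge conservation\<close>

lemma has_real_derivative_cmod_square:
  assumes "(f has_vector_derivative d) (at s within S)"
  shows "((\<lambda>s. (cmod (f s))\<^sup>2) has_real_derivative 2 * Re (cnj (f s) * d)) (at s within S)"
proof -
  have 1: "((\<lambda>s. Re (f s)) has_real_derivative Re d) (at s within S)"
    using bounded_linear.has_vector_derivative[OF bounded_linear_Re assms]
    by (simp add: has_real_derivative_iff_has_vector_derivative)
  have 2: "((\<lambda>s. Im (f s)) has_real_derivative Im d) (at s within S)"
    using bounded_linear.has_vector_derivative[OF bounded_linear_Im assms]
    by (simp add: has_real_derivative_iff_has_vector_derivative)
  show ?thesis
    unfolding cmod_power2 by (rule derivative_eq_intros 1 2 refl)+ (simp add: algebra_simps)
qed

lemma C1_strip_cmod_square: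
  assumes "C1_strip T u ut ux"
  shows "C1_strip T (\<lambda>t x. (cmod (u t x))\<^sup>2) (\<lambda>t x. 2 * Re (cnj (u t x) * ut t x))
    (\<lambda>t x. 2 * Re (cnj (u t x) * ux t x))"
proof -
  note * = has_real_derivative_cmod_square[unfolded has_real_derivative_iff_has_vector_derivative]
  show ?thesis
    unfolding C1_strip_def case_prod_beta
    by (intro conjI ballI allI continuous_intros * C1_strip_continuous[OF assms]
         C1_stripD(4,5)[OF assms]) auto
qed

lemma C1_strip_mult:
  fixes f g :: "real \<Rightarrow> real \<Rightarrow> real"
  assumes f: "C1_strip T f ft fx" and g: "C1_strip T g gt gx"
  shows "C1_strip T (\<lambda>t x. f t x * g t x) (\<lambda>t x. ft t x * g t x + f t x * gt t x)
    (\<lambda>t x. fx t x * g t x + f t x * gx t x)"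
proof -
  have *: "((\<lambda>s. a s * b s) has_vector_derivative (a' * b s + a s * b')) (at s within S)"
    if "(a has_vector_derivative a') (at s within S)" "(b has_vector_derivative b') (at s within S)"
    for a b :: "real \<Rightarrow> real" and a' b' s S
    using DERIV_mult[OF that[folded has_real_derivative_iff_has_vector_derivative]]
    by (simp add: has_real_derivative_iff_has_vector_derivative mult.commute add.commute)
  show ?thesis
    unfolding C1_strip_def case_prod_beta
    by (intro conjI ballI allI continuous_intros * C1_strip_continuous[OF f] C1_strip_continuous[OF g]
         C1_stripD(4,5)[OF f] C1_stripD(4,5)[OF g]) auto
qed

lemma C1_strip_diff:
  fixes f g :: "real \<Rightarrow> real \<Rightarrow> 'a::real_normed_vector"
  assumes f: "C1_strip T f ft fx" and g: "C1_strip T g gt gx"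
  shows "C1_strip T (\<lambda>t x. f t x - g t x) (\<lambda>t x. ft t x - gt t x) (\<lambda>t x. fx t x - gx t x)"
  unfolding C1_strip_def case_prod_beta
  by (intro conjI ballI allI continuous_intros has_vector_derivative_diff
      C1_strip_continuous[OF f] C1_strip_continuous[OF g]
      C1_stripD(4,5)[OF f] C1_stripD(4,5)[OF g]) auto

text \<open>The weighted quantity \<open>exp (- m s - K \<integral>\<^sub>0\<^sup>s b) a(s) - m \<integral>\<^sub>0\<^sup>s b\<close> is nonincreasing in \<open>s\<close>.\<close>

lemma gronwall_bound:
  fixes a b a' :: "real \<Rightarrow> real"
  assumes "0 \<le> t" "0 \<le> m" "0 \<le> K"
    and b: "continuous_on {0..t} b" "\<And>s. s \<in> {0..t} \<Longrightarrow> 0 \<le> b s"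
    and a: "\<And>s. s \<in> {0..t} \<Longrightarrow> (a has_vector_derivative a' s) (at s within {0..t})"
    and le: "\<And>s. s \<in> {0..t} \<Longrightarrow> a' s \<le> (m + K * b s) * a s + m * b s"
  shows "a t \<le> exp (m * t + K * integral {0..t} b) * (a 0 + m * integral {0..t} b)"
proof -
  define \<beta> where "\<beta> s = integral {0..s} b" for s
  define w where "w s = exp (- (m * s + K * \<beta> s))" for s
  have \<beta>: "(\<beta> has_real_derivative b s) (at s within {0..t})" if "s \<in> {0..t}" for s
    unfolding \<beta>_def has_real_derivative_iff_has_vector_derivative
    by (rule integral_has_vector_derivative[OF b(1) that])
  have \<beta>0: "0 \<le> \<beta> s" if "s \<in> {0..t}" for s
    unfolding \<beta>_def using that b
    by (intro integral_nonneg integrable_continuous_interval) (auto intro: continuous_on_subset)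
  have "((\<lambda>s. w s * (a' s - (m + K * b s) * a s) - m * b s) has_integral
      (w t * a t - m * \<beta> t) - (w 0 * a 0 - m * \<beta> 0)) {0..t}"
  proof (rule fundamental_theorem_of_calculus)
    fix s assume s: "s \<in> {0..t}"
    note A = a[OF s, folded has_real_derivative_iff_has_vector_derivative]
    show "((\<lambda>s. w s * a s - m * \<beta> s) has_vector_derivative
        w s * (a' s - (m + K * b s) * a s) - m * b s) (at s within {0..t})"
      unfolding w_def has_real_derivative_iff_has_vector_derivative[symmetric]
      by (rule derivative_eq_intros A \<beta>[OF s] refl)+ (simp add: algebra_simps)
  qed fact
  moreover have "w s * (a' s - (m + K * b s) * a s) - m * b s \<le> 0" if s: "s \<in> {0..t}" for s
  proof -
    have "0 \<le> m * s + K * \<beta> s" using s \<beta>0[OF s] assms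
        by (intro add_nonneg_nonneg mult_nonneg_nonneg) auto
    then have w: "0 \<le> w s" "w s \<le> 1" unfolding w_def by auto
    have "w s * (a' s - (m + K * b s) * a s) \<le> w s * (m * b s)"
      using le[OF s] w by (intro mult_left_mono) auto
    also have "\<dots> \<le> 1 * (m * b s)"
      using w b(2)[OF s] assms by (intro mult_right_mono) auto
    finally show ?thesis by simp
  qed
  ultimately have "(w t * a t - m * \<beta> t) - (w 0 * a 0 - m * \<beta> 0) \<le> 0"
    by (rule has_integral_le[OF _ has_integral_0])
  then have "w t * a t \<le> a 0 + m * \<beta> t" by (simp add: w_def \<beta>_def)
  then have "exp (m * t + K * \<beta> t) * (w t * a t) \<le> exp (m * t + K * \<beta> t) * (a 0 + m * \<beta> t)"
    by (intro mult_left_mono) auto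
  moreover have "exp (m * t + K * \<beta> t) * w t = 1"
    by (simp add: w_def flip: exp_add)
  then have "exp (m * t + K * \<beta> t) * (w t * a t) = a t"
    by (metis mult.assoc mult_1)
  ultimately show ?thesis unfolding \<beta>_def by simp
qed

text \<open>The structure behind the a priori bounds, shared by the equation and its truncations: the
  right-hand sides of the two equations exchange charge between \<open>|u|\<^sup>2\<close> and \<open>|v|\<^sup>2\<close> without
  creating any, at a rate that is quadratic plus \<open>|u|\<^sup>2 |v|\<^sup>2\<close>.\<close>

locale charge_conserving_pair =
  fixes m K T :: real and u ut ux v vt vx :: "real \<Rightarrow> real \<Rightarrow> complex"
  assumes m: "0 \<le> m" and K: "0 \<le> K"
    and u: "C1_strip T u ut ux" and v: "C1_strip T v vt vx"
    and charge: "\<And>t x. t \<in> {0..T} \<Longrightarrow>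
      Re (cnj (u t x) * (ut t x + ux t x)) + Re (cnj (v t x) * (vt t x - vx t x)) = 0"
    and exchange: "\<And>t x. t \<in> {0..T} \<Longrightarrow> \<bar>Re (cnj (u t x) * (ut t x + ux t x))\<bar> \<le>
      m * (cmod (u t x) * cmod (v t x)) + K * ((cmod (u t x))\<^sup>2 * (cmod (v t x))\<^sup>2)"
begin

lemma charge_on_cone:
  assumes "0 \<le> t" "t \<le> T" "t \<le> r"
  shows "integral {X - (r - t)..X + (r - t)} (\<lambda>x. (cmod (u t x))\<^sup>2 + (cmod (v t x))\<^sup>2) +
     integral {0..t} (\<lambda>s. 2 * (cmod (u s (X + (r - s))))\<^sup>2 + 2 * (cmod (v s (X - (r - s))))\<^sup>2) =
     integral {X - r..X + r} (\<lambda>x. (cmod (u 0 x))\<^sup>2 + (cmod (v 0 x))\<^sup>2)"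
proof -
  have "integral {0..t} (\<lambda>s. integral {X - (r - s)..X + (r - s)}
      (\<lambda>x. 2 * Re (cnj (u s x) * ut s x) + 2 * Re (cnj (u s x) * ux s x) +
        2 * Re (cnj (v s x) * vt s x) - 2 * Re (cnj (v s x) * vx s x))) = integral {0..t} (\<lambda>s. 0)"
  proof (rule integral_cong)
    fix s assume "s \<in> {0..t}"
    then have "2 * Re (cnj (u s x) * ut s x) + 2 * Re (cnj (u s x) * ux s x) +
        2 * Re (cnj (v s x) * vt s x) - 2 * Re (cnj (v s x) * vx s x) = 0" for x
      using charge[of s x] assms by (simp add: algebra_simps)
    then show "integral {X - (r - s)..X + (r - s)}
      (\<lambda>x. 2 * Re (cnj (u s x) * ut s x) + 2 * Re (cnj (u s x) * ux s x) +
        2 * Re (cnj (v s x) * vt s x) - 2 * Re (cnj (v s x) * vx s x)) = 0" by simp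
  qed
  then show ?thesis
    using cone_balance[OF C1_strip_cmod_square[OF u] C1_strip_cmod_square[OF v] assms, of X] by simp
qed

text \<open>The cone whose tip is \<open>(t,x)\<close> has an empty slice at time \<open>t\<close>, so all charge of its base
  leaves through the sides. The factor 2 of the flux in the balance law gives the half.\<close>

lemma char_integral_bound:
  assumes t: "0 \<le> t" "t \<le> T"
    and C: "integral {x - t..x + t} (\<lambda>x. (cmod (u 0 x))\<^sup>2 + (cmod (v 0 x))\<^sup>2) \<le> C"
  shows "integral {0..t} (\<lambda>s. (cmod (v s (x - t + s)))\<^sup>2) \<le> C / 2"
    and "integral {0..t} (\<lambda>s. (cmod (u s (x + t - s)))\<^sup>2) \<le> C / 2"
proof -
  let ?V = "\<lambda>s. (cmod (v s (x - t + s)))\<^sup>2" and ?U = "\<lambda>s. (cmod (u s (x + t - s)))\<^sup>2"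
  have U: "?U integrable_on {0..t}" and V: "?V integrable_on {0..t}"
    by (intro integrable_continuous_interval continuous_intros C1_strip_continuous[OF u]
        C1_strip_continuous[OF v];
      use t in auto)+
  have "integral {0..t} (\<lambda>s. 2 * (cmod (u s (x + (t - s))))\<^sup>2 + 2 * (cmod (v s (x - (t - s))))\<^sup>2)
      = 2 * integral {0..t} ?U + 2 * integral {0..t} ?V"
    using U V by (simp add: algebra_simps integral_add)
  moreover have "0 \<le> integral {0..t} ?U" "0 \<le> integral {0..t} ?V"
    by (intro integral_nonneg U V; simp)+
  ultimately show "integral {0..t} ?V \<le> C / 2" "integral {0..t} ?U \<le> C / 2"
    using charge_on_cone[of t t x] C t by auto
qed

text \<open>Gronwall's inequality along the characteristic through \<open>(t,x)\<close>; the coefficient of the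
  growth is the density of the other component, whose integral along the characteristic is at most
  \<open>C / 2\<close>.\<close>

lemma pointwise_bound:
  assumes t: "0 \<le> t" "t \<le> T"
    and C: "integral {x - t..x + t} (\<lambda>x. (cmod (u 0 x))\<^sup>2 + (cmod (v 0 x))\<^sup>2) \<le> C"
  shows "(cmod (u t x))\<^sup>2 \<le> exp (m * T + K * C) * ((cmod (u 0 (x - t)))\<^sup>2 + m * C / 2)"
    and "(cmod (v t x))\<^sup>2 \<le> exp (m * T + K * C) * ((cmod (v 0 (x + t)))\<^sup>2 + m * C / 2)"
proof -
  have young: "2 * r \<le> (m + 2 * K * b\<^sup>2) * a\<^sup>2 + m * b\<^sup>2"
    if "\<bar>r\<bar> \<le> m * (a * b) + K * (a\<^sup>2 * b\<^sup>2)" for r a b :: real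
  proof -
    have "m * (2 * (a * b)) \<le> m * (a\<^sup>2 + b\<^sup>2)"
      using sum_squares_bound[of a b] m by (intro mult_left_mono) auto
    then show ?thesis using that by (simp add: algebra_simps)
  qed
  have exp: "exp (m * t + 2 * K * i) * (a + m * i) \<le> exp (m * T + K * C) * (a + m * C / 2)"
    if "i \<le> C / 2" "0 \<le> i" "0 \<le> a" for i a
  proof (intro mult_mono)
    have "m * t \<le> m * T" "K * (2 * i) \<le> K * C" "m * i \<le> m * (C / 2)"
      using t m K that mult_left_mono[OF that(1) m] by (auto intro!: mult_left_mono)
    then show "exp (m * t + 2 * K * i) \<le> exp (m * T + K * C)" "a + m * i \<le> a + m * C / 2" by auto
    show "0 \<le> a + m * i" using that m by auto
  qed auto
  have cU: "continuous_on {0..t} (\<lambda>s. (cmod (u s (x + t - s)))\<^sup>2)"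
    and cV: "continuous_on {0..t} (\<lambda>s. (cmod (v s (x - t + s)))\<^sup>2)"
    by (intro continuous_intros C1_strip_continuous[OF u] C1_strip_continuous[OF v]; use t in auto)+
  have "(cmod (u t (x - t + t)))\<^sup>2 \<le> exp (m * t + 2 * K * integral {0..t} (\<lambda>s. (cmod (v s (x - t +
      s)))\<^sup>2)) *
      ((cmod (u 0 (x - t + 0)))\<^sup>2 + m * integral {0..t} (\<lambda>s. (cmod (v s (x - t + s)))\<^sup>2))"
  proof (rule gronwall_bound[OF t(1) m _ cV])
    fix s assume s: "s \<in> {0..t}"
    show "((\<lambda>s. (cmod (u s (x - t + s)))\<^sup>2) has_vector_derivative
        2 * Re (cnj (u s (x - t + s)) * (ut s (x - t + s) + ux s (x - t + s)))) (at s within {0..t})"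
    proof -
      have "((\<lambda>s. x - t + s) has_real_derivative 1) (at s within {0..t})"
        by (auto intro!: derivative_eq_intros)
      from C1_strip_curve[OF C1_strip_cmod_square[OF u] s _ this] t
      show ?thesis by (simp add: algebra_simps)
    qed
    show "2 * Re (cnj (u s (x - t + s)) * (ut s (x - t + s) + ux s (x - t + s))) \<le>
      (m + 2 * K * (cmod (v s (x - t + s)))\<^sup>2) * (cmod (u s (x - t + s)))\<^sup>2 +
          m * (cmod (v s (x - t + s)))\<^sup>2"
      by (rule young[OF exchange]) (use s t in auto)
  qed (use K in auto)
  also have "\<dots> \<le> exp (m * T + K * C) * ((cmod (u 0 (x - t + 0)))\<^sup>2 + m * C / 2)"
    by (intro exp char_integral_bound[OF t C] integral_nonneg integrable_continuous_interval cV) auto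
  finally show "(cmod (u t x))\<^sup>2 \<le> exp (m * T + K * C) * ((cmod (u 0 (x - t)))\<^sup>2 + m * C / 2)" by simp
  have "(cmod (v t (x + t - t)))\<^sup>2 \<le> exp (m * t + 2 * K * integral {0..t} (\<lambda>s. (cmod (u s (x +
      t - s)))\<^sup>2)) *
      ((cmod (v 0 (x + t - 0)))\<^sup>2 + m * integral {0..t} (\<lambda>s. (cmod (u s (x + t - s)))\<^sup>2))"
  proof (rule gronwall_bound[OF t(1) m _ cU])
    fix s assume s: "s \<in> {0..t}"
    show "((\<lambda>s. (cmod (v s (x + t - s)))\<^sup>2) has_vector_derivative
        2 * Re (cnj (v s (x + t - s)) * (vt s (x + t - s) - vx s (x + t - s)))) (at s within {0..t})"
    proof -
      have "((\<lambda>s. x + t - s) has_real_derivative -1) (at s within {0..t})"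
        by (auto intro!: derivative_eq_intros)
      from C1_strip_curve[OF C1_strip_cmod_square[OF v] s _ this] t
      show ?thesis by (simp add: algebra_simps)
    qed
    show "2 * Re (cnj (v s (x + t - s)) * (vt s (x + t - s) - vx s (x + t - s))) \<le>
      (m + 2 * K * (cmod (u s (x + t - s)))\<^sup>2) * (cmod (v s (x + t - s)))\<^sup>2 +
          m * (cmod (u s (x + t - s)))\<^sup>2"
      by (rule young) (use s t exchange[of s "x + t - s"] charge[of s "x + t - s"]
          in \<open>auto simp: mult.commute\<close>)
  qed (use K in auto)
  also have "\<dots> \<le> exp (m * T + K * C) * ((cmod (v 0 (x + t - 0)))\<^sup>2 + m * C / 2)"
    by (intro exp char_integral_bound[OF t C] integral_nonneg integrable_continuous_interval cU) auto
  finally show "(cmod (v t x))\<^sup>2 \<le> exp (m * T + K * C) * ((cmod (v 0 (x + t)))\<^sup>2 + m * C / 2)" by simp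
qed

end

section \<open>The nonlinearity\<close>

text \<open>The right-hand side of the first equation solved for \<open>u\<^sub>t + u\<^sub>x\<close>, with the cubic term
  multiplied by a real factor \<open>h\<close>; the equation itself is the case \<open>h = 1\<close>. Since \<open>N\<^sub>2(u,v) =
  N\<^sub>1(v,u)\<close>, the second equation has the same right-hand side with \<open>u\<close> and \<open>v\<close> interchanged.\<close>

definition dirac_rhs :: "real \<Rightarrow> real \<Rightarrow> real \<Rightarrow> real \<Rightarrow> complex \<Rightarrow> complex \<Rightarrow> complex" where
  "dirac_rhs m \<alpha> \<beta> h u v = - \<i> * (- of_real m * v + of_real h * N1 \<alpha> \<beta> u v)"

lemma N1_monomials:
  "N1 \<alpha> \<beta> u v = of_real \<alpha> * (u * v * cnj v) + of_real (2 * \<beta>) * (cnj u * v * v)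
     + of_real (2 * \<beta>) * (u * cnj v * v)"
  unfolding N1_explicit complex_norm_square by (simp add: algebra_simps)

lemma N2_eq_N1: "N2 \<alpha> \<beta> u v = N1 \<alpha> \<beta> v u"
  by (simp add: N1_explicit N2_explicit algebra_simps)

lemma classical_solution_iff:
  "classical_solution m \<alpha> \<beta> T u v \<longleftrightarrow> (\<exists>ut ux vt vx. C1_strip T u ut ux \<and> C1_strip T v vt vx \<and>
     (\<forall>t\<in>{0..T}. \<forall>x. ut t x + ux t x = dirac_rhs m \<alpha> \<beta> 1 (u t x) (v t x) \<and>
        vt t x - vx t x = dirac_rhs m \<alpha> \<beta> 1 (v t x) (u t x)))"
proof -
  have *: "\<i> * a = b \<longleftrightarrow> a = - \<i> * b" for a b :: complex
    by (auto simp: complex_eq_iff)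
  show ?thesis
    unfolding classical_solution_def C1_strip_def dirac_rhs_def N2_eq_N1 * of_real_1 mult_1
    by (intro ex_cong1) auto
qed

lemma classical_solutionE:
  assumes "classical_solution m \<alpha> \<beta> T u v"
  obtains ut ux vt vx where "C1_strip T u ut ux" "C1_strip T v vt vx"
    "\<And>t x. t \<in> {0..T} \<Longrightarrow> ut t x + ux t x = dirac_rhs m \<alpha> \<beta> 1 (u t x) (v t x)"
    "\<And>t x. t \<in> {0..T} \<Longrightarrow> vt t x - vx t x = dirac_rhs m \<alpha> \<beta> 1 (v t x) (u t x)"
proof -
  obtain ut ux vt vx where *: "C1_strip T u ut ux \<and> C1_strip T v vt vx \<and>
     (\<forall>t\<in>{0..T}. \<forall>x. ut t x + ux t x = dirac_rhs m \<alpha> \<beta> 1 (u t x) (v t x) \<and>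
        vt t x - vx t x = dirac_rhs m \<alpha> \<beta> 1 (v t x) (u t x))"
    using assms unfolding classical_solution_iff by (elim exE)
  show ?thesis by (rule that[of ut ux vt vx]) (use * in auto)
qed

text \<open>Only the products \<open>cnj u * v\<close> contribute, and interchanging \<open>u\<close> and \<open>v\<close> conjugates this
  number. Both terms are odd under conjugation, hence charge is conserved.\<close>

lemma Re_cnj_dirac_rhs:
  "Re (cnj u * dirac_rhs m \<alpha> \<beta> h u v) = - m * Im (cnj u * v) + 2 * \<beta> * h * Im ((cnj u * v)\<^sup>2)"
  unfolding dirac_rhs_def N1_monomials
  by (simp add: power2_eq_square algebra_simps)

lemma dirac_rhs_charge:
  "Re (cnj u * dirac_rhs m \<alpha> \<beta> h u v) + Re (cnj v * dirac_rhs m \<alpha> \<beta> h v u) = 0"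
  unfolding Re_cnj_dirac_rhs by (simp add: power2_eq_square algebra_simps)

lemma dirac_rhs_exchange:
  assumes "0 \<le> m" "0 \<le> h" "h \<le> 1"
  shows "\<bar>Re (cnj u * dirac_rhs m \<alpha> \<beta> h u v)\<bar> \<le>
    m * (cmod u * cmod v) + (\<bar>\<alpha>\<bar> + 4 * \<bar>\<beta>\<bar>) * ((cmod u)\<^sup>2 * (cmod v)\<^sup>2)"
proof -
  have 1: "\<bar>- m * Im (cnj u * v)\<bar> \<le> m * (cmod u * cmod v)"
    using mult_left_mono[OF abs_Im_le_cmod[of "cnj u * v"] assms(1)] assms(1)
        by (simp add: abs_mult norm_mult)
  have "\<bar>2 * \<beta> * h * Im ((cnj u * v)\<^sup>2)\<bar> \<le> 2 * \<bar>\<beta>\<bar> * 1 * cmod ((cnj u * v)\<^sup>2)"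
    unfolding abs_mult using assms by (intro mult_mono) (auto simp: abs_Im_le_cmod)
  also have "\<dots> \<le> (\<bar>\<alpha>\<bar> + 4 * \<bar>\<beta>\<bar>) * ((cmod u)\<^sup>2 * (cmod v)\<^sup>2)"
    by (simp add: norm_mult norm_power power_mult_distrib mult_right_mono)
  finally show ?thesis using 1 unfolding Re_cnj_dirac_rhs by linarith
qed

text \<open>Telescoping. Keeping the first factor separate matters for \<open>N\<^sub>1\<close>: it makes the difference \<open>u
  - u'\<close> be multiplied by densities of \<open>v\<close> alone.\<close>

lemma norm_triple_product_diff:
  fixes a b c a' b' c' :: complex
  shows "cmod (a * b * c - a' * b' * c') \<le>
    cmod (a - a') * cmod b * cmod c + cmod a' * cmod (b - b') * cmod c + cmod a' * cmod b' *
        cmod (c - c')"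
proof -
  have "a * b * c - a' * b' * c' = (a - a') * b * c + a' * (b - b') * c + a' * b' * (c - c')"
    by (simp add: algebra_simps)
  then show ?thesis
    using norm_triangle_ineq[of "(a - a') * b * c + a' * (b - b') * c" "a' * b' * (c - c')"]
      norm_triangle_ineq[of "(a - a') * b * c" "a' * (b - b') * c"]
    by (simp add: norm_mult)
qed

lemma N1_diff_bound:
  "cmod (N1 \<alpha> \<beta> u v - N1 \<alpha> \<beta> u' v') \<le> (\<bar>\<alpha>\<bar> + 4 * \<bar>\<beta>\<bar>) *
     (cmod (u - u') * (cmod v)\<^sup>2 + cmod u' * cmod (v - v') * (cmod v + cmod v'))"
proof -
  let ?B = "cmod (u - u') * (cmod v)\<^sup>2 + cmod u' * cmod (v - v') * (cmod v + cmod v')"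
  have cnj: "cmod (cnj a - cnj b) = cmod (a - b)" for a b
    by (metis complex_cnj_diff complex_mod_cnj)
  have B: "cmod (u * v * cnj v - u' * v' * cnj v') \<le> ?B"
    "cmod (cnj u * v * v - cnj u' * v' * v') \<le> ?B"
    "cmod (u * cnj v * v - u' * cnj v' * v') \<le> ?B"
    using norm_triple_product_diff[of u v "cnj v" u' v' "cnj v'"]
      norm_triple_product_diff[of "cnj u" v v "cnj u'" v' v']
      norm_triple_product_diff[of u "cnj v" v u' "cnj v'" v']
    by (simp_all add: cnj power2_eq_square algebra_simps)
  have "N1 \<alpha> \<beta> u v - N1 \<alpha> \<beta> u' v' = of_real \<alpha> * (u * v * cnj v - u' * v' * cnj v')
      + of_real (2 * \<beta>) * (cnj u * v * v - cnj u' * v' * v')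
      + of_real (2 * \<beta>) * (u * cnj v * v - u' * cnj v' * v')"
    unfolding N1_monomials by (simp add: algebra_simps)
  also have "cmod \<dots> \<le> \<bar>\<alpha>\<bar> * ?B + 2 * \<bar>\<beta>\<bar> * ?B + 2 * \<bar>\<beta>\<bar> * ?B"
    using B by (intro norm_triangle_le add_mono) (auto simp: norm_mult abs_mult intro!: mult_left_mono)
  finally show ?thesis by (simp add: algebra_simps)
qed

text \<open>In the source of \<open>|u - u'|\<^sup>2\<close> every quartic term is split by Young's inequality so that \<open>|u
  - u'|\<^sup>2\<close> meets only densities of \<open>v\<close> and \<open>|v - v'|\<^sup>2\<close> only densities of \<open>u\<close>. These are the
  densities that the other family of characteristics transports, which is what the weight in the
  stability estimate can absorb.\<close>

lemma dirac_rhs_difference_source: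
  assumes "0 \<le> m"
  shows "2 * Re (cnj (u - u') * (dirac_rhs m \<alpha> \<beta> 1 u v - dirac_rhs m \<alpha> \<beta> 1 u' v')) \<le>
    m * ((cmod (u - u'))\<^sup>2 + (cmod (v - v'))\<^sup>2) + 4 * (\<bar>\<alpha>\<bar> + 4 * \<bar>\<beta>\<bar>) *
      ((cmod (u - u'))\<^sup>2 * ((cmod v)\<^sup>2 + (cmod v')\<^sup>2) + (cmod (v - v'))\<^sup>2 * ((cmod u)\<^sup>2 + (cmod u')\<^sup>2))"
proof -
  define K where "K = \<bar>\<alpha>\<bar> + 4 * \<bar>\<beta>\<bar>"
  define a b where "a = cmod (u - u')" and "b = cmod (v - v')"
  define x y where "x = cmod v" and "y = cmod v'"
  define z w where "z = cmod u" and "w = cmod u'"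
  have pos: "0 \<le> K" "0 \<le> a" "0 \<le> b" "0 \<le> x" "0 \<le> y" "0 \<le> z" "0 \<le> w"
    unfolding K_def a_def b_def x_def y_def z_def w_def by auto
  have "cnj (u - u') * (dirac_rhs m \<alpha> \<beta> 1 u v - dirac_rhs m \<alpha> \<beta> 1 u' v') =
      \<i> * of_real m * (cnj (u - u') * (v - v')) - \<i> * (cnj (u - u') * (N1 \<alpha> \<beta> u v - N1 \<alpha> \<beta> u' v'))"
    by (simp add: dirac_rhs_def algebra_simps)
  then have "Re (cnj (u - u') * (dirac_rhs m \<alpha> \<beta> 1 u v - dirac_rhs m \<alpha> \<beta> 1 u' v')) \<le>
      cmod (\<i> * of_real m * (cnj (u - u') * (v - v'))) + cmod (\<i> * (cnj (u - u') * (N1 \<alpha> \<beta> u v -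
          N1 \<alpha> \<beta> u' v')))"
    using complex_Re_le_cmod norm_triangle_ineq4 order_trans by metis
  also have "\<dots> = m * (a * b) + a * cmod (N1 \<alpha> \<beta> u v - N1 \<alpha> \<beta> u' v')"
    using assms by (simp add: norm_mult a_def b_def del: complex_cnj_diff)
  also have "\<dots> \<le> m * (a * b) + a * (K * (a * x\<^sup>2 + w * b * (x + y)))"
    using N1_diff_bound[of \<alpha> \<beta> u v u' v'] pos
    unfolding a_def b_def K_def x_def y_def w_def by (intro add_left_mono mult_left_mono) auto
  finally have "2 * Re (cnj (u - u') * (dirac_rhs m \<alpha> \<beta> 1 u v - dirac_rhs m \<alpha> \<beta> 1 u' v')) \<le>
      m * (2 * a * b) + K * (2 * a\<^sup>2 * x\<^sup>2 + 2 * (a * (x + y)) * (w * b))"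
    by (simp add: algebra_simps power2_eq_square)
  also have "\<dots> \<le> m * (a\<^sup>2 + b\<^sup>2) + K * (2 * a\<^sup>2 * x\<^sup>2 + ((a * (x + y))\<^sup>2 + (w * b)\<^sup>2))"
    using assms pos sum_squares_bound[of a b] sum_squares_bound[of "a * (x + y)" "w * b"]
    by (intro add_mono mult_left_mono) auto
  also have "\<dots> \<le> m * (a\<^sup>2 + b\<^sup>2) + K * (4 * (a\<^sup>2 * (x\<^sup>2 + y\<^sup>2) + b\<^sup>2 * (z\<^sup>2 + w\<^sup>2)))"
  proof (intro add_left_mono mult_left_mono)
    have "(x + y)\<^sup>2 \<le> 2 * (x\<^sup>2 + y\<^sup>2)"
      using sum_squares_bound[of x y] by (simp add: power2_eq_square algebra_simps)
    then have "a\<^sup>2 * (x + y)\<^sup>2 \<le> a\<^sup>2 * (2 * (x\<^sup>2 + y\<^sup>2))" by (intro mult_left_mono) auto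
    then have 1: "a\<^sup>2 * (x + y)\<^sup>2 \<le> 2 * (a\<^sup>2 * x\<^sup>2) + 2 * (a\<^sup>2 * y\<^sup>2)" by (simp add: distrib_left)
    have 2: "0 \<le> a\<^sup>2 * y\<^sup>2" "0 \<le> b\<^sup>2 * z\<^sup>2" "0 \<le> b\<^sup>2 * w\<^sup>2" by auto
    have 3: "2 * a\<^sup>2 * x\<^sup>2 + ((a * (x + y))\<^sup>2 + (w * b)\<^sup>2) = 2 * (a\<^sup>2 * x\<^sup>2) + a\<^sup>2 * (x + y)\<^sup>2 +
        b\<^sup>2 * w\<^sup>2"
      unfolding power_mult_distrib by simp
    have 4: "4 * (a\<^sup>2 * (x\<^sup>2 + y\<^sup>2) + b\<^sup>2 * (z\<^sup>2 + w\<^sup>2)) =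
        4 * (a\<^sup>2 * x\<^sup>2) + 4 * (a\<^sup>2 * y\<^sup>2) + 4 * (b\<^sup>2 * z\<^sup>2) + 4 * (b\<^sup>2 * w\<^sup>2)"
      by (simp add: distrib_left)
    show "2 * a\<^sup>2 * x\<^sup>2 + ((a * (x + y))\<^sup>2 + (w * b)\<^sup>2) \<le> 4 * (a\<^sup>2 * (x\<^sup>2 + y\<^sup>2) + b\<^sup>2 * (z\<^sup>2 + w\<^sup>2))"
      unfolding 3 4 using 1 2 by linarith
  qed (use pos in auto)
  also have "\<dots> = m * (a\<^sup>2 + b\<^sup>2) + 4 * K * (a\<^sup>2 * (x\<^sup>2 + y\<^sup>2) + b\<^sup>2 * (z\<^sup>2 + w\<^sup>2))" by simp
  finally show ?thesis
    unfolding K_def a_def b_def x_def y_def z_def w_def .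
qed

text \<open>Bounds on the total charge are stated with intervals around 0; every interval lies in one of
  them.\<close>

lemma integral_le_of_centered:
  fixes f :: "real \<Rightarrow> real"
  assumes f: "continuous_on UNIV f" "\<And>z. 0 \<le> f z"
    and M: "\<And>R. 0 \<le> R \<Longrightarrow> integral {-R..R} f \<le> M"
  shows "integral {a..b} f \<le> M"
proof -
  have "integral {a..b} f \<le> integral {- max \<bar>a\<bar> \<bar>b\<bar>..max \<bar>a\<bar> \<bar>b\<bar>} f"
    using f(2) by (intro integral_subset_le integrable_continuous_interval) (auto intro:
        continuous_on_subset[OF f(1)])
  also have "\<dots> \<le> M" by (rule M) auto
  finally show ?thesis .
qed

lemma bounded_antiderivative:
  fixes f :: "real \<Rightarrow> real"
  assumes f: "continuous_on UNIV f" and "\<And>z. 0 \<le> f z"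
    and M: "\<And>R. 0 \<le> R \<Longrightarrow> integral {-R..R} f \<le> M"
  obtains S where "\<And>z. (S has_real_derivative f z) (at z)" "\<And>z. \<bar>S z\<bar> \<le> M"
proof -
  obtain F where "\<forall>x. -\<infinity> < ereal x \<longrightarrow> ereal x < \<infinity> \<longrightarrow> (F has_vector_derivative f x) (at x)"
    using einterval_antiderivative[of "-\<infinity>" "\<infinity>" f] f by (auto simp: continuous_on_eq_continuous_at)
  then have F: "(F has_vector_derivative f x) (at x)" for x by simp
  define S where "S z = F z - F 0" for z
  have S: "(S has_real_derivative f z) (at z)" for z
    unfolding S_def has_real_derivative_iff_has_vector_derivative
    using has_vector_derivative_diff[OF F[of z] has_vector_derivative_const[of "F 0"]] by simp
  have ftc: "(f has_integral S b - S a) {a..b}" if "a \<le> b" for a b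
    by (rule fundamental_theorem_of_calculus[OF that])
      (use S in \<open>auto simp: has_real_derivative_iff_has_vector_derivative intro:
          has_vector_derivative_at_within\<close>)
  have sub: "integral {a..b} f \<le> M" for a b
    by (rule integral_le_of_centered[OF assms])
  have pos: "0 \<le> integral {a..b} f" for a b
    using assms(2) by (intro integral_nonneg integrable_continuous_interval) (auto intro:
        continuous_on_subset[OF f])
  have "\<bar>S z\<bar> \<le> M" for z
  proof (cases "0 \<le> z")
    case True
    then show ?thesis using integral_unique[OF ftc[OF True]] sub[of 0 z] pos[of 0 z]
        by (simp add: S_def)
  next
    case False
    then have "z \<le> 0" by simp
    then show ?thesis using integral_unique[OF ftc[of z 0]] sub[of z 0] pos[of z 0] by (simp add: S_def)
  qed
  with S show ?thesis by (rule that)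
qed

lemma classical_solution_charge_conserving:
  assumes "0 \<le> m" "C1_strip T u ut ux" "C1_strip T v vt vx"
    "\<And>t x. t \<in> {0..T} \<Longrightarrow> 0 \<le> h t x \<and> h t x \<le> 1"
    "\<And>t x. t \<in> {0..T} \<Longrightarrow> ut t x + ux t x = dirac_rhs m \<alpha> \<beta> (h t x) (u t x) (v t x)"
    "\<And>t x. t \<in> {0..T} \<Longrightarrow> vt t x - vx t x = dirac_rhs m \<alpha> \<beta> (h t x) (v t x) (u t x)"
  shows "charge_conserving_pair m (\<bar>\<alpha>\<bar> + 4 * \<bar>\<beta>\<bar>) T u ut ux v vt vx"
proof
  fix t x assume t: "t \<in> {0..T}"
  show "Re (cnj (u t x) * (ut t x + ux t x)) + Re (cnj (v t x) * (vt t x - vx t x)) = 0"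
    unfolding assms(5,6)[OF t] by (rule dirac_rhs_charge)
  show "\<bar>Re (cnj (u t x) * (ut t x + ux t x))\<bar> \<le>
      m * (cmod (u t x) * cmod (v t x)) + (\<bar>\<alpha>\<bar> + 4 * \<bar>\<beta>\<bar>) * ((cmod (u t x))\<^sup>2 * (cmod (v t x))\<^sup>2)"
    unfolding assms(5)[OF t] using assms(1,4) t by (intro dirac_rhs_exchange) auto
qed (use assms in auto)

section \<open>Stability of classical solutions on cones\<close>

lemma cone_slice_integral_continuous:
  fixes g :: "real \<Rightarrow> real \<Rightarrow> real"
  assumes g: "continuous_on ({0..T} \<times> UNIV) (\<lambda>(s, x). g s x)" and "t \<le> T" "t \<le> r"
  shows "continuous_on {0..t} (\<lambda>s. integral {X - (r - s)..X + (r - s)} (g s))"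
proof -
  have "continuous_on {0..t} (\<lambda>s. integral (cbox (-1) 1) (\<lambda>y. (r - s) * g s (X + (r - s) * y)))"
    by (rule integral_continuous_on_param, unfold case_prod_beta,
        intro continuous_intros strip_continuous_compose[OF g]) (use assms in auto)
  then show ?thesis
  proof (rule continuous_on_eq)
    fix s assume s: "s \<in> {0..t}"
    show "integral (cbox (-1) 1) (\<lambda>y. (r - s) * g s (X + (r - s) * y)) = integral {X - (r - s)..X +
        (r - s)} (g s)"
      unfolding box_real
      by (rule integral_centered_interval)
        (use s assms in \<open>auto intro!: strip_continuous_compose[OF g] continuous_intros\<close>)
  qed
qed

text \<open>The weighted energy estimate described at the beginning. The constant \<open>G\<close> comes from the
  pointwise bound, \<open>D\<close> is twice its constant part, and \<open>2 G M\<close> bounds the integrals of \<open>P\<close> and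
  \<open>Q\<close>; the exponent of \<open>C\<close> is the logarithm of the ratio of the bounds of the weight.\<close>

lemma stability_on_cone:
  assumes m: "0 \<le> m" and T: "0 \<le> T"
    and sol: "classical_solution m \<alpha> \<beta> T u v" "classical_solution m \<alpha> \<beta> T u' v'"
    and M: "\<And>R. 0 \<le> R \<Longrightarrow> integral {-R..R} (\<lambda>x. (cmod (u 0 x))\<^sup>2 + (cmod (v 0 x))\<^sup>2) \<le> M"
    and M': "\<And>R. 0 \<le> R \<Longrightarrow> integral {-R..R} (\<lambda>x. (cmod (u' 0 x))\<^sup>2 + (cmod (v' 0 x))\<^sup>2) \<le> M"
    and K_def: "K = \<bar>\<alpha>\<bar> + 4 * \<bar>\<beta>\<bar>" and G_def: "G = exp (m * T + K * M)" and D_def: "D = G * m * M"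
    and C_def: "C = exp ((2 * m + 8 * K * D + D) * T + 4 * (4 * K + 1) * (2 * G * M))"
    and t: "0 \<le> t" "t \<le> T" "t \<le> r"
  shows "integral {X - (r - t)..X + (r - t)} (\<lambda>x. (cmod (u t x - u' t x))\<^sup>2 + (cmod (v t x - v' t x))\<^sup>2)
      + integral {0..t} (\<lambda>s. integral {X - (r - s)..X + (r - s)} (\<lambda>x. (cmod (u s x - u' s x))\<^sup>2 *
          (cmod (v s x))\<^sup>2))
      \<le> C * integral {X - r..X + r} (\<lambda>x. (cmod (u 0 x - u' 0 x))\<^sup>2 + (cmod (v 0 x - v' 0 x))\<^sup>2)"
proof -
  obtain ut ux vt vx where u: "C1_strip T u ut ux" and v: "C1_strip T v vt vx"
    and eq: "\<And>t x. t \<in> {0..T} \<Longrightarrow> ut t x + ux t x = dirac_rhs m \<alpha> \<beta> 1 (u t x) (v t x)"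
      "\<And>t x. t \<in> {0..T} \<Longrightarrow> vt t x - vx t x = dirac_rhs m \<alpha> \<beta> 1 (v t x) (u t x)"
    by (rule classical_solutionE[OF sol(1)]) (rule that)
  obtain ut' ux' vt' vx' where u': "C1_strip T u' ut' ux'" and v': "C1_strip T v' vt' vx'"
    and eq': "\<And>t x. t \<in> {0..T} \<Longrightarrow> ut' t x + ux' t x = dirac_rhs m \<alpha> \<beta> 1 (u' t x) (v' t x)"
      "\<And>t x. t \<in> {0..T} \<Longrightarrow> vt' t x - vx' t x = dirac_rhs m \<alpha> \<beta> 1 (v' t x) (u' t x)"
    by (rule classical_solutionE[OF sol(2)]) (rule that)
  interpret P: charge_conserving_pair m K T u ut ux v vt vx
    unfolding K_def by (rule classical_solution_charge_conserving[OF m u v, where h =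
        "\<lambda>_ _. 1"]) (use eq in auto)
  interpret P': charge_conserving_pair m K T u' ut' ux' v' vt' vx'
    unfolding K_def by (rule classical_solution_charge_conserving[OF m u' v', where h =
        "\<lambda>_ _. 1"]) (use eq' in auto)
  have K0: "0 \<le> K" by (simp add: K_def)
  have M0: "0 \<le> M" using M[of 0] by simp
  have G0: "0 \<le> G" by (simp add: G_def)
  have D0: "0 \<le> D" using G0 m M0 by (simp add: D_def)
  have z: "0 \<in> {0..T}" using T by simp
  note cont = C1_strip_continuous[OF u] C1_strip_continuous[OF v] C1_strip_continuous[OF u']
      C1_strip_continuous[OF v']
  note slice = C1_strip_slice[OF u] C1_strip_slice[OF v] C1_strip_slice[OF u'] C1_strip_slice[OF v']
  have MM: "integral {a..b} (\<lambda>x. (cmod (u 0 x))\<^sup>2 + (cmod (v 0 x))\<^sup>2) \<le> M"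
    "integral {a..b} (\<lambda>x. (cmod (u' 0 x))\<^sup>2 + (cmod (v' 0 x))\<^sup>2) \<le> M" for a b
    by (rule integral_le_of_centered[OF _ _ M] integral_le_of_centered[OF _ _ M'];
        use T in \<open>auto intro!: continuous_intros slice\<close>)+
  \<comment> \<open>Integrable profiles that are merely transported: they dominate \<open>|u|\<^sup>2 + |u'|\<^sup>2\<close> and \<open>|v|\<^sup>2 +
      |v'|\<^sup>2\<close> up to the constant \<open>D\<close>.\<close>
  define P0 Q0 where "P0 z = G * ((cmod (u 0 z))\<^sup>2 + (cmod (u' 0 z))\<^sup>2)"
    and "Q0 z = G * ((cmod (v 0 z))\<^sup>2 + (cmod (v' 0 z))\<^sup>2)" for z
  have P0: "(cmod (u s x))\<^sup>2 + (cmod (u' s x))\<^sup>2 \<le> P0 (x - s) + D" if "s \<in> {0..T}" for s x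
    using P.pointwise_bound(1)[of s x M, OF _ _ MM(1)] P'.pointwise_bound(1)[of s x M, OF _ _ MM(2)]
        that
    unfolding P0_def D_def G_def by (simp add: algebra_simps)
  have Q0: "(cmod (v s x))\<^sup>2 + (cmod (v' s x))\<^sup>2 \<le> Q0 (x + s) + D" if "s \<in> {0..T}" for s x
    using P.pointwise_bound(2)[of s x M, OF _ _ MM(1)] P'.pointwise_bound(2)[of s x M, OF _ _ MM(2)]
        that
    unfolding Q0_def D_def G_def by (simp add: algebra_simps)
  have cP0: "continuous_on S P0" and cQ0: "continuous_on S Q0" for S
    unfolding P0_def Q0_def by (intro continuous_intros slice z)+
  have pos0: "0 \<le> P0 z" "0 \<le> Q0 z" for z unfolding P0_def Q0_def using G0 by auto
  have tot: "integral {-R..R} P0 \<le> 2 * G * M" "integral {-R..R} Q0 \<le> 2 * G * M" for R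
  proof -
    have i: "(\<lambda>x. (cmod (u 0 x))\<^sup>2 + (cmod (v 0 x))\<^sup>2) integrable_on {-R..R}"
      "(\<lambda>x. (cmod (u' 0 x))\<^sup>2 + (cmod (v' 0 x))\<^sup>2) integrable_on {-R..R}"
      by (intro integrable_continuous_interval continuous_intros slice z)+
    have "integral {-R..R} (\<lambda>x. ((cmod (u 0 x))\<^sup>2 + (cmod (v 0 x))\<^sup>2) + ((cmod (u' 0 x))\<^sup>2 +
        (cmod (v' 0 x))\<^sup>2)) \<le> 2 * M"
      using MM[of "-R" R] unfolding integral_add[OF i] by simp
    then have "G * integral {-R..R} (\<lambda>x. ((cmod (u 0 x))\<^sup>2 + (cmod (v 0 x))\<^sup>2) +
        ((cmod (u' 0 x))\<^sup>2 + (cmod (v' 0 x))\<^sup>2)) \<le> G * (2 * M)"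
      by (rule mult_left_mono) (rule G0)
    then have *: "integral {-R..R} (\<lambda>x. G * (((cmod (u 0 x))\<^sup>2 + (cmod (v 0 x))\<^sup>2) +
        ((cmod (u' 0 x))\<^sup>2 + (cmod (v' 0 x))\<^sup>2))) \<le> 2 * G * M"
      by simp
    have ci: "(\<lambda>x. G * (((cmod (u 0 x))\<^sup>2 + (cmod (v 0 x))\<^sup>2) + ((cmod (u' 0 x))\<^sup>2 +
        (cmod (v' 0 x))\<^sup>2))) integrable_on {-R..R}"
      by (intro integrable_continuous_interval continuous_intros slice z)
    show "integral {-R..R} P0 \<le> 2 * G * M"
      by (rule order_trans[OF integral_le[OF integrable_continuous_interval[OF cP0] ci] *])
        (auto simp: P0_def intro!: mult_left_mono G0)
    show "integral {-R..R} Q0 \<le> 2 * G * M"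
      by (rule order_trans[OF integral_le[OF integrable_continuous_interval[OF cQ0] ci] *])
        (auto simp: Q0_def intro!: mult_left_mono G0)
  qed
  obtain SP where SP: "\<And>z. (SP has_real_derivative P0 z) (at z)" "\<And>z. \<bar>SP z\<bar> \<le> 2 * G * M"
    using bounded_antiderivative[OF cP0 pos0(1) tot(1)] by blast
  obtain SQ where SQ: "\<And>z. (SQ has_real_derivative Q0 z) (at z)" "\<And>z. \<bar>SQ z\<bar> \<le> 2 * G * M"
    using bounded_antiderivative[OF cQ0 pos0(2) tot(2)] by blast
  \<comment> \<open>\<open>\<kappa>\<close> has to absorb \<open>8 K (A q + B p)\<close> at the rate \<open>2 \<kappa>\<close>; the excess 1 and the last \<open>D\<close> in \<open>\<mu>\<close>
      leave the dissipation \<open>A |v|\<^sup>2\<close>.\<close>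
  define \<kappa> \<mu> where "\<kappa> = 4 * K + 1" and "\<mu> = 2 * m + 8 * K * D + D"
  have kl: "0 \<le> \<kappa>" "0 \<le> \<mu>" using K0 m D0 unfolding \<kappa>_def \<mu>_def by auto
  define \<phi> where "\<phi> s x = exp (- \<mu> * s - \<kappa> * SQ (x + s) + \<kappa> * SP (x - s))" for s x
  define \<phi>t where "\<phi>t s x = \<phi> s x * (- \<mu> - \<kappa> * Q0 (x + s) - \<kappa> * P0 (x - s))" for s x
  define \<phi>x where "\<phi>x s x = \<phi> s x * (- \<kappa> * Q0 (x + s) + \<kappa> * P0 (x - s))" for s x
  have "isCont SP z" "isCont SQ z" for z
    by (rule DERIV_isCont[OF SP(1)], rule DERIV_isCont[OF SQ(1)])
  then have cSP: "continuous_on UNIV SP" and cSQ: "continuous_on UNIV SQ"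
    by (simp_all add: continuous_at_imp_continuous_on)
  note cphi = continuous_on_compose2[OF cSP] continuous_on_compose2[OF cSQ]
     continuous_on_compose2[OF cP0[of UNIV]] continuous_on_compose2[OF cQ0[of UNIV]]
  have \<phi>: "C1_strip T \<phi> \<phi>t \<phi>x"
    unfolding C1_strip_def
  proof (intro conjI ballI allI)
    fix s x
    have p: "((\<lambda>s. SP (x - s)) has_real_derivative P0 (x - s) * (-1)) (at s within {0..T})"
      "((\<lambda>s. SQ (x + s)) has_real_derivative Q0 (x + s) * 1) (at s within {0..T})"
      by (rule DERIV_chain2[OF SP(1)] DERIV_chain2[OF SQ(1)]; auto intro!: derivative_eq_intros)+
    show "((\<lambda>s. \<phi> s x) has_vector_derivative \<phi>t s x) (at s within {0..T})"
      unfolding \<phi>_def \<phi>t_def has_real_derivative_iff_has_vector_derivative[symmetric]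
      by (rule derivative_eq_intros p refl)+ (simp add: algebra_simps)
    have q: "((\<lambda>x. SP (x - s)) has_real_derivative P0 (x - s) * 1) (at x)"
      "((\<lambda>x. SQ (x + s)) has_real_derivative Q0 (x + s) * 1) (at x)"
      by (rule DERIV_chain2[OF SP(1)] DERIV_chain2[OF SQ(1)]; auto intro!: derivative_eq_intros)+
    show "((\<lambda>x. \<phi> s x) has_vector_derivative \<phi>x s x) (at x)"
      unfolding \<phi>_def \<phi>x_def has_real_derivative_iff_has_vector_derivative[symmetric]
      by (rule derivative_eq_intros q refl)+ (simp add: algebra_simps)
  qed (unfold \<phi>_def \<phi>t_def \<phi>x_def case_prod_beta, (intro continuous_intros cphi; auto)+)
  define lo hi where "lo = exp (- \<mu> * T - 2 * \<kappa> * (2 * G * M))" and "hi = exp (2 * \<kappa> * (2 * G * M))"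
  have kS: "\<bar>\<kappa> * SP a\<bar> \<le> \<kappa> * (2 * G * M)" "\<bar>\<kappa> * SQ a\<bar> \<le> \<kappa> * (2 * G * M)" for a
    unfolding abs_mult using SP(2)[of a] SQ(2)[of a] kl by (auto intro!: mult_left_mono)
  have lo: "lo \<le> \<phi> s x" if "s \<in> {0..T}" for s x
  proof -
    have "\<mu> * s \<le> \<mu> * T" using that kl by (intro mult_left_mono) auto
    then show ?thesis
      unfolding lo_def \<phi>_def using kS(1)[of "x - s"] kS(2)[of "x + s"] by auto
  qed
  have hi: "\<phi> 0 x \<le> hi" for x
    unfolding hi_def \<phi>_def using kS(1)[of x] kS(2)[of x] by auto
  define A where "A s x = (cmod (u s x - u' s x))\<^sup>2" for s x
  define B where "B s x = (cmod (v s x - v' s x))\<^sup>2" for s x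
  define At where "At s x = 2 * Re (cnj (u s x - u' s x) * (ut s x - ut' s x))" for s x
  define Ax where "Ax s x = 2 * Re (cnj (u s x - u' s x) * (ux s x - ux' s x))" for s x
  define Bt where "Bt s x = 2 * Re (cnj (v s x - v' s x) * (vt s x - vt' s x))" for s x
  define Bx where "Bx s x = 2 * Re (cnj (v s x - v' s x) * (vx s x - vx' s x))" for s x
  have A: "C1_strip T A At Ax" and B: "C1_strip T B Bt Bx"
    using C1_strip_cmod_square[OF C1_strip_diff[OF u u']] C1_strip_cmod_square[OF C1_strip_diff[OF v
        v']]
    unfolding A_def[abs_def] B_def[abs_def] At_def[abs_def] Ax_def[abs_def] Bt_def[abs_def]
        Bx_def[abs_def] .
  have AB0: "0 \<le> A s x" "0 \<le> B s x" for s x unfolding A_def B_def by auto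
  define src where "src s x = (At s x * \<phi> s x + A s x * \<phi>t s x) + (Ax s x * \<phi> s x + A s x * \<phi>x s x)
      + (Bt s x * \<phi> s x + B s x * \<phi>t s x) - (Bx s x * \<phi> s x + B s x * \<phi>x s x)" for s x
  have src: "src s x \<le> - (lo * (A s x * (cmod (v s x))\<^sup>2))" if s: "s \<in> {0..T}" for s x
  proof -
    define q p where "q = Q0 (x + s)" and "p = P0 (x - s)"
    have q: "(cmod (v s x))\<^sup>2 + (cmod (v' s x))\<^sup>2 \<le> q + D" and p: "(cmod (u s x))\<^sup>2 +
        (cmod (u' s x))\<^sup>2 \<le> p + D"
      using Q0[OF s] P0[OF s] by (auto simp: q_def p_def)
    have qp0: "0 \<le> q" "0 \<le> p" using pos0 by (auto simp: q_def p_def)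
    have eqA: "At s x + Ax s x = 2 * Re (cnj (u s x - u' s x) *
        (dirac_rhs m \<alpha> \<beta> 1 (u s x) (v s x) - dirac_rhs m \<alpha> \<beta> 1 (u' s x) (v' s x)))"
      unfolding eq(1)[OF s, symmetric] eq'(1)[OF s, symmetric] At_def Ax_def
          by (simp add: algebra_simps)
    have eqB: "Bt s x - Bx s x = 2 * Re (cnj (v s x - v' s x) *
        (dirac_rhs m \<alpha> \<beta> 1 (v s x) (u s x) - dirac_rhs m \<alpha> \<beta> 1 (v' s x) (u' s x)))"
      unfolding eq(2)[OF s, symmetric] eq'(2)[OF s, symmetric] Bt_def Bx_def
          by (simp add: algebra_simps)
    have "A s x * ((cmod (v s x))\<^sup>2 + (cmod (v' s x))\<^sup>2) + B s x * ((cmod (u s x))\<^sup>2 +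
        (cmod (u' s x))\<^sup>2) \<le>
        A s x * (q + D) + B s x * (p + D)"
      by (rule add_mono[OF mult_left_mono[OF q AB0(1)] mult_left_mono[OF p AB0(2)]])
    then have *: "4 * K * (A s x * ((cmod (v s x))\<^sup>2 + (cmod (v' s x))\<^sup>2) +
        B s x * ((cmod (u s x))\<^sup>2 + (cmod (u' s x))\<^sup>2)) \<le>
        4 * K * (A s x * (q + D) + B s x * (p + D))"
      using K0 by (intro mult_left_mono) auto
    have a: "At s x + Ax s x \<le> m * (A s x + B s x) + 4 * K * (A s x * (q + D) + B s x * (p + D))"
      using dirac_rhs_difference_source[OF m, of "u s x" "u' s x" \<alpha> \<beta> "v s x" "v' s x"] *
      unfolding eqA A_def B_def K_def by linarith
    have "Bt s x - Bx s x \<le> m * (B s x + A s x) + 4 * K *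
        (B s x * ((cmod (u s x))\<^sup>2 + (cmod (u' s x))\<^sup>2) + A s x * ((cmod (v s x))\<^sup>2 +
            (cmod (v' s x))\<^sup>2))"
      using dirac_rhs_difference_source[OF m, of "v s x" "v' s x" \<alpha> \<beta> "u s x" "u' s x"]
      unfolding eqB A_def B_def K_def .
    then have b: "Bt s x - Bx s x \<le> m * (A s x + B s x) + 4 * K * (A s x * (q + D) + B s x * (p + D))"
      unfolding add.commute[of "B s x" "A s x"] add.commute[of "B s x * ((cmod (u s x))\<^sup>2 +
          (cmod (u' s x))\<^sup>2)"]
      using * by linarith
    have "(At s x + Ax s x) + (Bt s x - Bx s x) - A s x * (\<mu> + 2 * \<kappa> * q) - B s x * (\<mu> + 2 * \<kappa> * p)
        \<le> - (A s x * (q + D))"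
    proof -
      have "0 \<le> A s x * q" "0 \<le> B s x * p" "0 \<le> B s x * D" using AB0 qp0 D0 by auto
      then show ?thesis using a b unfolding \<mu>_def \<kappa>_def by (simp add: algebra_simps)
    qed
    also have "\<dots> \<le> - (A s x * (cmod (v s x))\<^sup>2)"
    proof -
      have "(cmod (v s x))\<^sup>2 \<le> q + D" using q zero_le_power2[of "cmod (v' s x)"] by linarith
      then show ?thesis using mult_left_mono[OF _ AB0(1)] by (simp only: neg_le_iff_le)
    qed
    finally have le: "(At s x + Ax s x) + (Bt s x - Bx s x) - A s x * (\<mu> + 2 * \<kappa> * q) - B s x * (\<mu> +
        2 * \<kappa> * p)
        \<le> - (A s x * (cmod (v s x))\<^sup>2)" .
    have "src s x = \<phi> s x * ((At s x + Ax s x) + (Bt s x - Bx s x) - A s x * (\<mu> + 2 * \<kappa> * q) -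
        B s x * (\<mu> + 2 * \<kappa> * p))"
      unfolding src_def \<phi>t_def \<phi>x_def q_def p_def by (simp add: algebra_simps)
    also have "\<dots> \<le> \<phi> s x * (- (A s x * (cmod (v s x))\<^sup>2))"
      using le by (intro mult_left_mono) (auto simp: \<phi>_def)
    also have "\<dots> \<le> - (lo * (A s x * (cmod (v s x))\<^sup>2))"
      using mult_right_mono[OF lo[OF s], of "A s x * (cmod (v s x))\<^sup>2" x] AB0 by simp
    finally show ?thesis .
  qed
  note sl = C1_strip_slice[OF A] C1_strip_slice[OF B] C1_strip_slice[OF \<phi>]
  note cc = C1_strip_continuous[OF A] C1_strip_continuous[OF B] C1_strip_continuous[OF \<phi>]
  have tT: "t \<in> {0..T}" using t by simp
  let ?I = "\<lambda>s. {X - (r - s)..X + (r - s)}"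
  define J where "J = integral {0..t} (\<lambda>s. integral (?I s) (\<lambda>x. A s x * (cmod (v s x))\<^sup>2))"
  have bal: "integral (?I t) (\<lambda>x. A t x * \<phi> t x + B t x * \<phi> t x) +
     integral {0..t} (\<lambda>s. 2 * (A s (X + (r - s)) * \<phi> s (X + (r - s))) + 2 * (B s (X - (r - s)) *
         \<phi> s (X - (r - s)))) =
     integral {X - r..X + r} (\<lambda>x. A 0 x * \<phi> 0 x + B 0 x * \<phi> 0 x) + integral {0..t} (\<lambda>s. integral
         (?I s) (src s))"
    unfolding src_def[abs_def] by (rule cone_balance[OF C1_strip_mult[OF A \<phi>] C1_strip_mult[OF B \<phi>] t])
  have phi0: "0 \<le> \<phi> s x" for s x by (simp add: \<phi>_def)
  have flux: "0 \<le> integral {0..t} (\<lambda>s. 2 * (A s (X + (r - s)) * \<phi> s (X + (r - s))) +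
      2 * (B s (X - (r - s)) * \<phi> s (X - (r - s))))"
    by (intro integral_nonneg integrable_continuous_interval continuous_intros cc)
      (use t AB0 phi0 in auto)
  have c1: "continuous_on ({0..T} \<times> UNIV) (\<lambda>(s, x). src s x)"
    unfolding src_def case_prod_beta by (intro continuous_intros cc) auto
  have c2: "continuous_on ({0..T} \<times> UNIV) (\<lambda>(s, x). A s x * (cmod (v s x))\<^sup>2)"
    unfolding case_prod_beta by (intro continuous_intros cc cont) auto
  have "integral {0..t} (\<lambda>s. integral (?I s) (src s)) \<le>
      integral {0..t} (\<lambda>s. - (lo * integral (?I s) (\<lambda>x. A s x * (cmod (v s x))\<^sup>2)))"
  proof (rule integral_le)
    show "(\<lambda>s. integral (?I s) (src s)) integrable_on {0..t}"
      by (rule integrable_continuous_interval cone_slice_integral_continuous[OF c1 t(2,3)])+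
    show "(\<lambda>s. - (lo * integral (?I s) (\<lambda>x. A s x * (cmod (v s x))\<^sup>2))) integrable_on {0..t}"
      by (intro integrable_continuous_interval continuous_intros cone_slice_integral_continuous[OF
          c2 t(2,3)])
    fix s assume "s \<in> {0..t}"
    then have s: "s \<in> {0..T}" using t by auto
    have "integral (?I s) (src s) \<le> integral (?I s) (\<lambda>x. - (lo * (A s x * (cmod (v s x))\<^sup>2)))"
      by (intro integral_le integrable_continuous_interval src s)
        (use s in \<open>auto simp: src_def intro!: continuous_intros sl slice\<close>)
    then show "integral (?I s) (src s) \<le> - (lo * integral (?I s) (\<lambda>x. A s x * (cmod (v s x))\<^sup>2))"
        by simp
  qed
  also have "\<dots> = - (lo * J)" unfolding J_def by simp
  finally have S: "integral {0..t} (\<lambda>s. integral (?I s) (src s)) \<le> - (lo * J)" .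
  have lower: "lo * integral (?I t) (\<lambda>x. A t x + B t x) \<le> integral (?I t) (\<lambda>x. A t x * \<phi> t x +
      B t x * \<phi> t x)"
  proof -
    have "integral (?I t) (\<lambda>x. lo * (A t x + B t x)) \<le> integral (?I t) (\<lambda>x. A t x * \<phi> t x +
        B t x * \<phi> t x)"
    proof (intro integral_le integrable_continuous_interval continuous_intros sl tT)
      fix x
      show "lo * (A t x + B t x) \<le> A t x * \<phi> t x + B t x * \<phi> t x"
        using mult_right_mono[OF lo[OF tT], of "A t x + B t x" x] AB0 by (simp add: algebra_simps)
    qed
    then show ?thesis by simp
  qed
  have upper: "integral {X - r..X + r} (\<lambda>x. A 0 x * \<phi> 0 x + B 0 x * \<phi> 0 x) \<le>
      hi * integral {X - r..X + r} (\<lambda>x. A 0 x + B 0 x)"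
  proof -
    have "integral {X - r..X + r} (\<lambda>x. A 0 x * \<phi> 0 x + B 0 x * \<phi> 0 x) \<le>
        integral {X - r..X + r} (\<lambda>x. hi * (A 0 x + B 0 x))"
    proof (intro integral_le integrable_continuous_interval continuous_intros sl z)
      fix x
      show "A 0 x * \<phi> 0 x + B 0 x * \<phi> 0 x \<le> hi * (A 0 x + B 0 x)"
        using mult_right_mono[OF hi, of "A 0 x + B 0 x" x] AB0 by (simp add: algebra_simps)
    qed
    then show ?thesis by simp
  qed
  have "lo * (integral (?I t) (\<lambda>x. A t x + B t x) + J) \<le> hi * integral {X - r..X + r} (\<lambda>x. A 0 x +
      B 0 x)"
    using bal flux S lower upper by (simp add: distrib_left)
  moreover have "hi = lo * C"
    unfolding hi_def lo_def C_def \<mu>_def[symmetric] \<kappa>_def[symmetric] by (simp flip: exp_add)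
  ultimately have "lo * (integral (?I t) (\<lambda>x. A t x + B t x) + J) \<le>
      lo * (C * integral {X - r..X + r} (\<lambda>x. A 0 x + B 0 x))"
    by (simp add: mult.assoc)
  then have "integral (?I t) (\<lambda>x. A t x + B t x) + J \<le> C * integral {X - r..X + r} (\<lambda>x. A 0 x + B 0 x)"
    by (rule mult_left_le_imp_le) (simp add: lo_def)
  then show ?thesis unfolding J_def A_def B_def .
qed

section \<open>Transport along characteristics\<close>

text \<open>Rescaling time by \<open>s = t \<sigma>\<close> turns this into a parameter integral over a fixed interval.\<close>

lemma integral_along_characteristics_continuous:
  fixes f :: "real \<Rightarrow> real \<Rightarrow> complex"
  assumes f: "continuous_on ({0..T} \<times> UNIV) (\<lambda>(t, x). f t x)"
  shows "continuous_on ({0..T} \<times> UNIV) (\<lambda>(t, y). integral {0..t} (\<lambda>s. f s (y + c * s)))"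
proof -
  have small: "t * \<sigma> \<le> T" if "0 \<le> t" "t \<le> T" "\<sigma> \<le> 1" for t \<sigma>
    using mult_left_le[OF that(3,1)] that(2) by linarith
  have "continuous_on ({0..T} \<times> UNIV) (\<lambda>z. integral (cbox 0 1) (\<lambda>\<sigma>. fst z *\<^sub>R f (fst z * \<sigma>) (snd z +
      c * (fst z * \<sigma>))))"
    by (rule integral_continuous_on_param, unfold case_prod_beta,
        intro continuous_intros strip_continuous_compose[OF f]) (auto intro: small)
  then show ?thesis
  proof (rule continuous_on_eq, unfold case_prod_beta)
    fix z :: "real \<times> real" assume z: "z \<in> {0..T} \<times> UNIV"
    define t y where "t = fst z" and "y = snd z"
    have t: "0 \<le> t" "t \<le> T" using z by (auto simp: t_def)
    have "((\<lambda>\<sigma>. t *\<^sub>R f (t * \<sigma>) (y + c * (t * \<sigma>))) has_integral integral {t * 0..t * 1} (\<lambda>s. f s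
        (y + c * s))) {0..1}"
    proof (rule has_integral_substitution[where c = 0 and d = t and g = "\<lambda>\<sigma>. t * \<sigma>" and f =
        "\<lambda>s. f s (y + c * s)"])
      show "continuous_on {0..t} (\<lambda>s. f s (y + c * s))"
        by (intro strip_continuous_compose[OF f] continuous_intros) (use t in auto)
    qed (use t in \<open>auto intro!: derivative_eq_intros simp: mult_left_le\<close>)
    then show "integral (cbox 0 1) (\<lambda>\<sigma>. fst z *\<^sub>R f (fst z * \<sigma>) (snd z + c * (fst z * \<sigma>))) =
        integral {0..fst z} (\<lambda>s. f s (snd z + c * s))"
      unfolding t_def y_def box_real by (intro integral_unique) simp
  qed
qed

text \<open>The solution of \<open>w\<^sub>t + c w\<^sub>x = f\<close> with \<open>w(0) = f0\<close>, by Duhamel's formula.\<close>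

definition transport :: "real \<Rightarrow> (real \<Rightarrow> complex) \<Rightarrow> (real \<Rightarrow> real \<Rightarrow> complex) \<Rightarrow> real \<Rightarrow> real \<Rightarrow> complex"
    where
  "transport c f0 f t x = f0 (x - c * t) + integral {0..t} (\<lambda>s. f s (x - c * t + c * s))"

lemma transport_0: "transport c f0 f 0 x = f0 x"
  by (simp add: transport_def)

lemma transport_continuous:
  assumes f: "continuous_on ({0..T} \<times> UNIV) (\<lambda>(t, x). f t x)" and f0: "continuous_on UNIV f0"
  shows "continuous_on ({0..T} \<times> UNIV) (\<lambda>(t, x). transport c f0 f t x)"
  unfolding transport_def case_prod_beta
  by (intro continuous_intros strip_continuous_compose[OF
      integral_along_characteristics_continuous[OF f]]
      continuous_on_compose2[OF f0]) auto

text \<open>In coordinates moving with the characteristics the time derivative of the Duhamel integral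
  is \<open>f\<close> itself, so the time derivative of the solution comes from the equation. This is why the
  Picard iteration below carries along space derivatives only.\<close>

lemma transport_C1:
  assumes f: "continuous_on ({0..T} \<times> UNIV) (\<lambda>(t, x). f t x)"
    and fx: "continuous_on ({0..T} \<times> UNIV) (\<lambda>(t, x). fx t x)"
    and df: "\<And>t x. t \<in> {0..T} \<Longrightarrow> ((\<lambda>y. f t y) has_vector_derivative fx t x) (at x)"
    and f0': "continuous_on UNIV f0'" and f0: "\<And>x. (f0 has_vector_derivative f0' x) (at x)"
  shows "C1_strip T (transport c f0 f) (\<lambda>t x. f t x - c *\<^sub>R transport c f0' fx t x) (transport c f0'
      fx)"
proof -
  define g where "g t y = integral {0..t} (\<lambda>s. f s (y + c * s))" for t y
  define gy where "gy t y = integral {0..t} (\<lambda>s. fx s (y + c * s))" for t y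
  have cf0: "continuous_on UNIV f0"
    using f0 by (intro continuous_at_imp_continuous_on) (auto intro: has_vector_derivative_continuous)
  have g: "C1_strip T g (\<lambda>t y. f t (y + c * t)) gy"
    unfolding C1_strip_def
  proof (intro conjI ballI allI)
    show "continuous_on ({0..T} \<times> UNIV) (\<lambda>(t, x). g t x)" "continuous_on ({0..T} \<times> UNIV) (\<lambda>(t, x).
        gy t x)"
      unfolding g_def gy_def by (rule integral_along_characteristics_continuous f fx)+
    show "continuous_on ({0..T} \<times> UNIV) (\<lambda>(t, x). f t (x + c * t))"
      unfolding case_prod_beta by (intro strip_continuous_compose[OF f] continuous_intros) auto
    fix t x assume t: "t \<in> {0..T}"
    show "((\<lambda>s. g s x) has_vector_derivative f t (x + c * t)) (at t within {0..T})"
      unfolding g_def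
      by (rule integral_has_vector_derivative[OF _ t])
        (intro strip_continuous_compose[OF f] continuous_intros; auto)
    have "((\<lambda>y. integral (cbox 0 t) (\<lambda>s. f s (y + c * s))) has_vector_derivative
        integral (cbox 0 t) (\<lambda>s. fx s (x + c * s))) (at x within UNIV)"
    proof (rule leibniz_rule_vector_derivative)
      fix y s :: real assume s: "s \<in> cbox 0 t"
      have "((\<lambda>y. f s y) \<circ> (\<lambda>y. y + c * s) has_vector_derivative 1 *\<^sub>R fx s (y + c * s)) (at y)"
        by (rule vector_diff_chain_at) (use s t in \<open>auto intro!: derivative_eq_intros df\<close>)
      then show "((\<lambda>y. f s (y + c * s)) has_vector_derivative fx s (y + c * s)) (at y within UNIV)"
        by (simp add: o_def)
    next
      fix y
      show "(\<lambda>s. f s (y + c * s)) integrable_on cbox 0 t"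
        by (intro integrable_continuous strip_continuous_compose[OF f] continuous_intros) (use t
            in auto)
      show "continuous_on (UNIV \<times> cbox 0 t) (\<lambda>(y, s). fx s (y + c * s))"
        unfolding case_prod_beta
        by (intro strip_continuous_compose[OF fx] continuous_intros) (use t in auto)
    qed auto
    then show "((\<lambda>y. g t y) has_vector_derivative gy t x) (at x)"
      by (simp add: g_def gy_def)
  qed
  show ?thesis
    unfolding C1_strip_def
  proof (intro conjI ballI allI)
    show "continuous_on ({0..T} \<times> UNIV) (\<lambda>(t, x). transport c f0 f t x)"
      "continuous_on ({0..T} \<times> UNIV) (\<lambda>(t, x). transport c f0' fx t x)"
      by (intro transport_continuous f fx f0' cf0)+
    then show "continuous_on ({0..T} \<times> UNIV) (\<lambda>(t, x). f t x - c *\<^sub>R transport c f0' fx t x)"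
      using f unfolding case_prod_beta by (intro continuous_intros)
    fix t x assume t: "t \<in> {0..T}"
    have lin: "((\<lambda>s. x - c * s) has_real_derivative (- c)) (at t within {0..T})"
      by (auto intro!: derivative_eq_intros)
    have 1: "(f0 \<circ> (\<lambda>s. x - c * s) has_vector_derivative (- c) *\<^sub>R f0' (x - c * t)) (at t within
        {0..T})"
      by (rule vector_diff_chain_within)
        (use lin in \<open>auto simp: has_real_derivative_iff_has_vector_derivative intro:
            has_vector_derivative_at_within f0\<close>)
    have 2: "((\<lambda>s. g s (x - c * s)) has_vector_derivative
        (f t (x - c * t + c * t) + (- c) *\<^sub>R gy t (x - c * t))) (at t within {0..T})"
      by (rule C1_strip_curve[OF g t _ lin]) auto
    show "((\<lambda>s. transport c f0 f s x) has_vector_derivative f t x - c *\<^sub>R transport c f0' fx t x)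
        (at t within {0..T})"
      using has_vector_derivative_add[OF 1 2]
      by (simp add: transport_def g_def gy_def o_def algebra_simps)
    have 3: "(f0 \<circ> (\<lambda>y. y - c * t) has_vector_derivative 1 *\<^sub>R f0' (x - c * t)) (at x)"
      by (rule vector_diff_chain_at) (auto intro!: derivative_eq_intros f0)
    have 4: "((\<lambda>y. g t y) \<circ> (\<lambda>y. y - c * t) has_vector_derivative 1 *\<^sub>R gy t (x - c * t)) (at x)"
      by (rule vector_diff_chain_at) (auto intro!: derivative_eq_intros C1_stripD(5)[OF g t])
    show "((\<lambda>y. transport c f0 f t y) has_vector_derivative transport c f0' fx t x) (at x)"
      using has_vector_derivative_add[OF 3 4]
      by (simp add: transport_def g_def gy_def o_def)
  qed
qed

text \<open>The majorant enters through an antiderivative \<open>G\<close> because it is always an exponential or a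
  power of time in the applications.\<close>

lemma transport_bound:
  assumes f: "continuous_on ({0..T} \<times> UNIV) (\<lambda>(t, x). f t x)" and t: "t \<in> {0..T}"
    and a: "\<And>x. cmod (f0 x) \<le> a"
    and G: "\<And>s. s \<in> {0..t} \<Longrightarrow> (G has_real_derivative g s) (at s within {0..t})"
    and b: "\<And>s x. s \<in> {0..t} \<Longrightarrow> cmod (f s x) \<le> g s"
  shows "cmod (transport c f0 f t x) \<le> a + (G t - G 0)"
proof -
  have "(g has_integral G t - G 0) {0..t}"
    by (rule fundamental_theorem_of_calculus)
      (use t G in \<open>auto simp: has_real_derivative_iff_has_vector_derivative\<close>)
  moreover have "(\<lambda>s. f s (x - c * t + c * s)) integrable_on {0..t}"
    by (intro integrable_continuous_interval strip_continuous_compose[OF f] continuous_intros)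
        (use t in auto)
  ultimately have "cmod (integral {0..t} (\<lambda>s. f s (x - c * t + c * s))) \<le> G t - G 0"
    using b by (metis (no_types, lifting) has_integral_integrable_integral integral_norm_bound_integral)
  then show ?thesis
    unfolding transport_def using a[of "x - c * t"] norm_triangle_mono by blast
qed

lemma transport_diff:
  assumes f: "continuous_on ({0..T} \<times> UNIV) (\<lambda>(t, x). f t x)" and g: "continuous_on ({0..T} \<times> UNIV)
      (\<lambda>(t, x). g t x)"
    and t: "t \<in> {0..T}"
  shows "transport c f0 f t x - transport c f0 g t x = transport c (\<lambda>_. 0) (\<lambda>t x. f t x - g t x) t x"
proof -
  have "(\<lambda>s. f s (x - c * t + c * s)) integrable_on {0..t}" "(\<lambda>s. g s (x - c * t +
      c * s)) integrable_on {0..t}"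
    by (intro integrable_continuous_interval strip_continuous_compose[OF f]
        strip_continuous_compose[OF g]
        continuous_intros; use t in auto)+
  then show ?thesis by (simp add: transport_def integral_diff)
qed

section \<open>Local Lipschitz continuity\<close>

text \<open>Lipschitz on bounded sets. This class is closed under products and composition, so it can be
  checked for the truncated right-hand side and its derivative by following their syntax.\<close>

definition locally_lipschitz :: "('a::real_normed_vector \<Rightarrow> 'b::real_normed_vector) \<Rightarrow> bool" where
  "locally_lipschitz f \<longleftrightarrow> (\<forall>B. \<exists>L\<ge>0. \<forall>x y. norm x \<le> B \<longrightarrow> norm y \<le> B \<longrightarrow> norm (f x - f y) \<le>
      L * norm (x - y))"

lemma locally_lipschitzE:
  assumes "locally_lipschitz f"
  obtains L where "0 \<le> L" "\<And>x y. norm x \<le> B \<Longrightarrow> norm y \<le> B \<Longrightarrow> norm (f x - f y) \<le> L * norm (x - y)"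
  using assms unfolding locally_lipschitz_def by meson

lemma locally_lipschitz_bounded:
  assumes "locally_lipschitz f"
  obtains M where "0 \<le> M" "\<And>x. norm x \<le> B \<Longrightarrow> norm (f x) \<le> M"
proof -
  obtain L where L: "0 \<le> L" "\<And>x y. norm x \<le> max 0 B \<Longrightarrow> norm y \<le> max 0 B \<Longrightarrow> norm (f x - f y) \<le>
      L * norm (x - y)"
    using locally_lipschitzE[OF assms, of "max 0 B"] by blast
  have "norm (f x) \<le> norm (f 0) + L * max 0 B" if "norm x \<le> B" for x
  proof -
    have "norm (f x - f 0) \<le> L * norm x" using L(2)[of x 0] that by auto
    also have "\<dots> \<le> L * max 0 B" using that L by (intro mult_left_mono) auto
    finally show ?thesis using norm_triangle_sub[of "f x" "f 0"] by linarith
  qed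
  then show ?thesis using L(1) by (intro that[of "norm (f 0) + L * max 0 B"]) auto
qed

lemma locally_lipschitz_const: "locally_lipschitz (\<lambda>_. c)"
  unfolding locally_lipschitz_def by (auto intro!: exI[of _ 0])

lemma locally_lipschitz_add:
  assumes "locally_lipschitz f" "locally_lipschitz g"
  shows "locally_lipschitz (\<lambda>x. f x + g x)"
  unfolding locally_lipschitz_def
proof
  fix B
  obtain L where L: "0 \<le> L" "\<And>x y. norm x \<le> B \<Longrightarrow> norm y \<le> B \<Longrightarrow> norm (f x - f y) \<le> L * norm (x - y)"
    using locally_lipschitzE[OF assms(1), of B] by blast
  obtain L' where L': "0 \<le> L'" "\<And>x y. norm x \<le> B \<Longrightarrow> norm y \<le> B \<Longrightarrow> norm (g x - g y) \<le> L' * norm (x - y)"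
    using locally_lipschitzE[OF assms(2), of B] by blast
  have "norm (f x + g x - (f y + g y)) \<le> (L + L') * norm (x - y)" if "norm x \<le> B" "norm y \<le> B" for x y
    using L(2)[OF that] L'(2)[OF that] norm_diff_triangle_ineq[of "f x" "g x" "f y" "g y"]
    by (simp add: distrib_right)
  then show "\<exists>L\<ge>0. \<forall>x y. norm x \<le> B \<longrightarrow> norm y \<le> B \<longrightarrow> norm (f x + g x - (f y + g y)) \<le> L * norm (x - y)"
    using L(1) L'(1) by (intro exI[of _ "L + L'"]) auto
qed

lemma locally_lipschitz_mult:
  fixes f g :: "'a::real_normed_vector \<Rightarrow> 'b::real_normed_algebra"
  assumes "locally_lipschitz f" "locally_lipschitz g"
  shows "locally_lipschitz (\<lambda>x. f x * g x)"
  unfolding locally_lipschitz_def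
proof
  fix B
  obtain L where L: "0 \<le> L" "\<And>x y. norm x \<le> B \<Longrightarrow> norm y \<le> B \<Longrightarrow> norm (f x - f y) \<le> L * norm (x - y)"
    using locally_lipschitzE[OF assms(1), of B] by blast
  obtain L' where L': "0 \<le> L'" "\<And>x y. norm x \<le> B \<Longrightarrow> norm y \<le> B \<Longrightarrow> norm (g x - g y) \<le> L' * norm (x - y)"
    using locally_lipschitzE[OF assms(2), of B] by blast
  obtain M where M: "0 \<le> M" "\<And>x. norm x \<le> B \<Longrightarrow> norm (f x) \<le> M"
    using locally_lipschitz_bounded[OF assms(1), of B] by blast
  obtain M' where M': "0 \<le> M'" "\<And>x. norm x \<le> B \<Longrightarrow> norm (g x) \<le> M'"
    using locally_lipschitz_bounded[OF assms(2), of B] by blast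
  have "norm (f x * g x - f y * g y) \<le> (L * M' + M * L') * norm (x - y)" if B: "norm x \<le>
      B" "norm y \<le> B" for x y
  proof -
    have e: "f x * g x - f y * g y = (f x - f y) * g x + f y * (g x - g y)" by (simp add: algebra_simps)
    have "norm (f x * g x - f y * g y) \<le> norm (f x - f y) * norm (g x) + norm (f y) * norm (g x - g y)"
      unfolding e using norm_triangle_ineq[of "(f x - f y) * g x" "f y * (g x - g y)"]
        norm_mult_ineq[of "f x - f y" "g x"] norm_mult_ineq[of "f y" "g x - g y"] by linarith
    also have "\<dots> \<le> (L * norm (x - y)) * M' + M * (L' * norm (x - y))"
      using L(2)[OF B] L'(2)[OF B] M(2)[OF B(2)] M'(2)[OF B(1)] L L' M M'
      by (intro add_mono mult_mono) auto
    finally show ?thesis by (simp add: algebra_simps)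
  qed
  then show "\<exists>L\<ge>0. \<forall>x y. norm x \<le> B \<longrightarrow> norm y \<le> B \<longrightarrow> norm (f x * g x - f y * g y) \<le> L * norm (x - y)"
    using L(1) L'(1) M(1) M'(1) by (intro exI[of _ "L * M' + M * L'"]) auto
qed

lemma locally_lipschitz_compose:
  assumes "locally_lipschitz g" "locally_lipschitz f"
  shows "locally_lipschitz (\<lambda>x. g (f x))"
  unfolding locally_lipschitz_def
proof
  fix B
  obtain L where L: "0 \<le> L" "\<And>x y. norm x \<le> B \<Longrightarrow> norm y \<le> B \<Longrightarrow> norm (f x - f y) \<le> L * norm (x - y)"
    using locally_lipschitzE[OF assms(2), of B] by blast
  obtain M where M: "0 \<le> M" "\<And>x. norm x \<le> B \<Longrightarrow> norm (f x) \<le> M"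
    using locally_lipschitz_bounded[OF assms(2), of B] by blast
  obtain L' where L': "0 \<le> L'" "\<And>x y. norm x \<le> M \<Longrightarrow> norm y \<le> M \<Longrightarrow> norm (g x - g y) \<le> L' * norm (x - y)"
    using locally_lipschitzE[OF assms(1), of M] by blast
  have "norm (g (f x) - g (f y)) \<le> (L' * L) * norm (x - y)" if B: "norm x \<le> B" "norm y \<le> B" for x y
  proof -
    have "norm (g (f x) - g (f y)) \<le> L' * norm (f x - f y)" by (rule L'(2)[OF M(2)[OF B(1)] M(2)[OF
        B(2)]])
    also have "\<dots> \<le> L' * (L * norm (x - y))" by (rule mult_left_mono[OF L(2)[OF B] L'(1)])
    finally show ?thesis by (simp add: mult.assoc)
  qed
  then show "\<exists>L\<ge>0. \<forall>x y. norm x \<le> B \<longrightarrow> norm y \<le> B \<longrightarrow> norm (g (f x) - g (f y)) \<le> L * norm (x - y)"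
    using L(1) L'(1) by (intro exI[of _ "L' * L"]) auto
qed

lemma locally_lipschitz_bounded_linear:
  assumes "bounded_linear f" shows "locally_lipschitz f"
proof -
  obtain K where K: "K > 0" "\<And>x. norm (f x) \<le> norm x * K"
    using bounded_linear.pos_bounded[OF assms] by auto
  show ?thesis
    unfolding locally_lipschitz_def
    using K(1) K(2)[of "_ - _"] bounded_linear.linear[OF assms]
    by (auto intro!: exI[of _ K] simp: linear_diff mult.commute)
qed

lemma locally_lipschitz_max0: "locally_lipschitz (\<lambda>y::real. max 0 y)"
  unfolding locally_lipschitz_def by (auto intro!: exI[of _ 1])

lemmas locally_lipschitz_linear_compose =
  locally_lipschitz_compose[OF locally_lipschitz_bounded_linear]

lemmas locally_lipschitz_basic =
  locally_lipschitz_const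
  locally_lipschitz_linear_compose[OF bounded_linear_cnj] locally_lipschitz_linear_compose[OF
      bounded_linear_Re]
  locally_lipschitz_linear_compose[OF bounded_linear_of_real] locally_lipschitz_compose[OF
      locally_lipschitz_max0]
  locally_lipschitz_add locally_lipschitz_mult

lemma locally_lipschitz_minus: "locally_lipschitz f \<Longrightarrow> locally_lipschitz (\<lambda>x. - f x)"
  by (rule locally_lipschitz_linear_compose[OF bounded_linear_minus[OF bounded_linear_ident]])

lemma locally_lipschitz_diff:
  assumes "locally_lipschitz f" "locally_lipschitz g" shows "locally_lipschitz (\<lambda>x. f x - g x)"
  using locally_lipschitz_add[OF assms(1) locally_lipschitz_minus[OF assms(2)]] by simp

lemma locally_lipschitz_fst: "locally_lipschitz f \<Longrightarrow> locally_lipschitz (\<lambda>x. fst (f x))"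
  and locally_lipschitz_snd: "locally_lipschitz f \<Longrightarrow> locally_lipschitz (\<lambda>x. snd (f x))"
  by (rule locally_lipschitz_linear_compose[OF bounded_linear_fst]
      locally_lipschitz_linear_compose[OF bounded_linear_snd]; assumption)+

lemma locally_lipschitz_id: "locally_lipschitz (\<lambda>x. x)"
  by (rule locally_lipschitz_bounded_linear) (rule bounded_linear_ident)

text \<open>For functions of two and of four complex variables, bounds on the single variables are more
  convenient than bounds on the tuple.\<close>

lemma locally_lipschitz2E:
  assumes "locally_lipschitz (\<lambda>z. f (fst z) (snd z) :: complex)"
  obtains L where "0 \<le> L" "\<And>a b a' b' :: complex. cmod a \<le> B \<Longrightarrow> cmod b \<le> B \<Longrightarrow> cmod a' \<le> B \<Longrightarrow> cmod b' \<le> B \<Longrightarrow>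
      cmod (f a b - f a' b') \<le> L * (cmod (a - a') + cmod (b - b'))"
proof -
  obtain L where L: "0 \<le> L" "\<And>x y. norm x \<le> 2 * B \<Longrightarrow> norm y \<le> 2 * B \<Longrightarrow>
      norm ((\<lambda>z. f (fst z) (snd z)) x - (\<lambda>z. f (fst z) (snd z)) y) \<le> L * norm (x - y)"
    by (rule locally_lipschitzE[OF assms, of "2 * B"]) (rule that)
  show ?thesis
  proof (rule that[OF L(1)])
    fix a b a' b' :: complex
    assume "cmod a \<le> B" "cmod b \<le> B" "cmod a' \<le> B" "cmod b' \<le> B"
    then have "norm (a, b) \<le> 2 * B" "norm (a', b') \<le> 2 * B"
      using norm_Pair_le[of a b] norm_Pair_le[of a' b'] by linarith+
    from L(2)[OF this] have "cmod (f a b - f a' b') \<le> L * norm (a - a', b - b')" by simp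
    also have "\<dots> \<le> L * (cmod (a - a') + cmod (b - b'))" by (rule mult_left_mono[OF norm_Pair_le L(1)])
    finally show "cmod (f a b - f a' b') \<le> L * (cmod (a - a') + cmod (b - b'))" .
  qed
qed

lemma locally_lipschitz4E:
  assumes "locally_lipschitz (\<lambda>z. f (fst z) (fst (snd z)) (fst (snd (snd z))) (snd (snd (snd z))) ::
      complex)"
  obtains L where "0 \<le> L" "\<And>a b p q a' b' p' q' :: complex. cmod a \<le> B \<Longrightarrow> cmod b \<le> B \<Longrightarrow> cmod p \<le> B \<Longrightarrow>
      cmod q \<le> B \<Longrightarrow>
      cmod a' \<le> B \<Longrightarrow> cmod b' \<le> B \<Longrightarrow> cmod p' \<le> B \<Longrightarrow> cmod q' \<le> B \<Longrightarrow>
      cmod (f a b p q - f a' b' p' q') \<le> L * (cmod (a - a') + cmod (b - b') + cmod (p - p') +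
          cmod (q - q'))"
proof -
  have n: "norm (a, b, p, q) \<le> cmod a + cmod b + cmod p + cmod q" for a b p q :: complex
    using norm_Pair_le[of a "(b, p, q)"] norm_Pair_le[of b "(p, q)"] norm_Pair_le[of p q] by linarith
  obtain L where L: "0 \<le> L" "\<And>x y. norm x \<le> 4 * B \<Longrightarrow> norm y \<le> 4 * B \<Longrightarrow>
      norm ((\<lambda>z. f (fst z) (fst (snd z)) (fst (snd (snd z))) (snd (snd (snd z)))) x -
        (\<lambda>z. f (fst z) (fst (snd z)) (fst (snd (snd z))) (snd (snd (snd z)))) y) \<le> L * norm (x - y)"
    by (rule locally_lipschitzE[OF assms, of "4 * B"]) (rule that)
  show ?thesis
  proof (rule that[OF L(1)])
    fix a b p q a' b' p' q' :: complex
    assume "cmod a \<le> B" "cmod b \<le> B" "cmod p \<le> B" "cmod q \<le> B" "cmod a' \<le> B" "cmod b' \<le>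
        B" "cmod p' \<le> B" "cmod q' \<le> B"
    then have "norm (a, b, p, q) \<le> 4 * B" "norm (a', b', p', q') \<le> 4 * B"
      using n[of a b p q] n[of a' b' p' q'] by linarith+
    from L(2)[OF this]
    have "cmod (f a b p q - f a' b' p' q') \<le> L * norm (a - a', b - b', p - p', q - q')" by simp
    also have "\<dots> \<le> L * (cmod (a - a') + cmod (b - b') + cmod (p - p') + cmod (q - q'))"
      by (rule mult_left_mono[OF n L(1)])
    finally show "cmod (f a b p q - f a' b' p' q') \<le> L * (cmod (a - a') + cmod (b - b') +
        cmod (p - p') + cmod (q - q'))" .
  qed
qed

section \<open>Picard iteration for semilinear transport systems\<close>

lemma transport_limit:
  assumes f: "\<And>n. continuous_on ({0..T} \<times> UNIV) (\<lambda>(t, x). f n t x)"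
    and lim: "uniform_limit ({0..T} \<times> UNIV) (\<lambda>n (t, x). f n t x) (\<lambda>(t, x). g t x) sequentially"
    and t: "t \<in> {0..T}"
  shows "(\<lambda>n. transport c f0 (f n) t x) \<longlonglongrightarrow> transport c f0 g t x"
proof -
  have A: "uniform_limit (cbox 0 t) (\<lambda>n s. f n s (x - c * t + c * s)) (\<lambda>s. g s (x - c * t +
      c * s)) sequentially"
  proof (rule uniform_limitI)
    fix e :: real assume "e > 0"
    from uniform_limitD[OF lim this]
    show "\<forall>\<^sub>F n in sequentially. \<forall>s\<in>cbox 0 t. dist (f n s (x - c * t + c * s)) (g s (x - c * t +
        c * s)) < e"
      by eventually_elim (use t in auto)
  qed
  have B: "continuous_on (cbox 0 t) (\<lambda>s. f n s (x - c * t + c * s))" for n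
    by (intro strip_continuous_compose[OF f] continuous_intros) (use t in auto)
  obtain I J where I: "\<And>n. ((\<lambda>s. f n s (x - c * t + c * s)) has_integral I n) (cbox 0 t)"
    and J: "((\<lambda>s. g s (x - c * t + c * s)) has_integral J) (cbox 0 t)" and IJ: "I \<longlonglongrightarrow> J"
    by (rule uniform_limit_integral_cbox[OF A B sequentially_bot]) (rule that)
  have "integral {0..t} (\<lambda>s. f n s (x - c * t + c * s)) = I n" for n
    using integral_unique[OF I[of n]] by simp
  moreover have "integral {0..t} (\<lambda>s. g s (x - c * t + c * s)) = J"
    using integral_unique[OF J] by simp
  ultimately show ?thesis unfolding transport_def using IJ by (auto intro!: tendsto_intros)
qed

lemma telescoping_uniform_limit:
  fixes f :: "nat \<Rightarrow> 'b \<Rightarrow> 'c::banach"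
  assumes "\<And>n z. z \<in> A \<Longrightarrow> norm (f (Suc n) z - f n z) \<le> M n" and "summable M" and "\<And>z. f 0 z = 0"
  shows "\<exists>l. uniform_limit A f l sequentially"
proof -
  have "uniform_limit A (\<lambda>n z. \<Sum>i<n. f (Suc i) z - f i z) (\<lambda>z. \<Sum>i. f (Suc i) z - f i z) sequentially"
    by (rule Weierstrass_m_test) (use assms in auto)
  moreover have "(\<Sum>i<n. f (Suc i) z - f i z) = f n z" for n z
    using sum_lessThan_telescope[of "\<lambda>i. f i z" n] assms(3) by simp
  ultimately show ?thesis by auto
qed

text \<open>The system \<open>u\<^sub>t + u\<^sub>x = F(u,v)\<close>, \<open>v\<^sub>t - v\<^sub>x = F(v,u)\<close>. Here \<open>D a b p q\<close> stands for the
  derivative of \<open>F\<close> at \<open>(a,b)\<close> in the direction \<open>(p,q)\<close>. Linear growth of \<open>F\<close> keeps the iterates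
  bounded on \<open>[0,T]\<close>, so Lipschitz constants on bounded sets suffice.\<close>

locale semilinear_transport =
  fixes F :: "complex \<Rightarrow> complex \<Rightarrow> complex"
    and D :: "complex \<Rightarrow> complex \<Rightarrow> complex \<Rightarrow> complex \<Rightarrow> complex"
    and u0 v0 u0' v0' :: "real \<Rightarrow> complex" and T L B0 :: real
  assumes T: "0 \<le> T" and L: "0 \<le> L"
    and growth: "\<And>a b. cmod (F a b) \<le> L * (cmod a + cmod b)"
    and lip: "locally_lipschitz (\<lambda>z. F (fst z) (snd z))"
    and Dlip: "locally_lipschitz (\<lambda>z. D (fst z) (fst (snd z)) (fst (snd (snd z))) (snd (snd (snd z))))"
    and Dlin: "\<And>B. \<exists>L'\<ge>0. \<forall>a b p q. cmod a \<le> B \<longrightarrow> cmod b \<le> B \<longrightarrow> cmod (D a b p q) \<le> L' * (cmod p + cmod q)"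
    and chain: "\<And>a b p q x. (a has_vector_derivative p) (at x) \<Longrightarrow> (b has_vector_derivative q) (at x) \<Longrightarrow>
      ((\<lambda>y. F (a y) (b y)) has_vector_derivative D (a x) (b x) p q) (at x)"
    and contF: "\<And>(S :: (real \<times> real) set) a b. continuous_on S a \<Longrightarrow> continuous_on S b \<Longrightarrow>
        continuous_on S (\<lambda>z. F (a z) (b z))"
    and contD: "\<And>(S :: (real \<times> real) set) a b p q. continuous_on S a \<Longrightarrow> continuous_on S b \<Longrightarrow>
        continuous_on S p \<Longrightarrow>
      continuous_on S q \<Longrightarrow> continuous_on S (\<lambda>z. D (a z) (b z) (p z) (q z))"
    and u0: "\<And>x. (u0 has_vector_derivative u0' x) (at x)" "continuous_on UNIV u0'"
    and v0: "\<And>x. (v0 has_vector_derivative v0' x) (at x)" "continuous_on UNIV v0'"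
    and B0: "\<And>x. cmod (u0 x) \<le> B0" "\<And>x. cmod (v0 x) \<le> B0" "\<And>x. cmod (u0' x) \<le>
        B0" "\<And>x. cmod (v0' x) \<le> B0"
begin

text \<open>The components are approximations of \<open>u\<close>, \<open>v\<close>, \<open>u\<^sub>x\<close> and \<open>v\<^sub>x\<close>; starting from zero, the last
  two remain the exact space derivatives of the first two.\<close>

primrec iterate :: "nat \<Rightarrow> (real \<Rightarrow> real \<Rightarrow> complex) \<times> (real \<Rightarrow> real \<Rightarrow> complex) \<times>
    (real \<Rightarrow> real \<Rightarrow> complex) \<times> (real \<Rightarrow> real \<Rightarrow> complex)" where
  "iterate 0 = (\<lambda>_ _. 0, \<lambda>_ _. 0, \<lambda>_ _. 0, \<lambda>_ _. 0)"
| "iterate (Suc n) = (case iterate n of (U, V, P, Q) \<Rightarrow>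
     (transport 1 u0 (\<lambda>t x. F (U t x) (V t x)),
      transport (-1) v0 (\<lambda>t x. F (V t x) (U t x)),
      transport 1 u0' (\<lambda>t x. D (U t x) (V t x) (P t x) (Q t x)),
      transport (-1) v0' (\<lambda>t x. D (V t x) (U t x) (Q t x) (P t x))))"

definition "U n = fst (iterate n)"
definition "V n = fst (snd (iterate n))"
definition "P n = fst (snd (snd (iterate n)))"
definition "Q n = snd (snd (snd (iterate n)))"

lemma iterates_0: "U 0 t x = 0" "V 0 t x = 0" "P 0 t x = 0" "Q 0 t x = 0"
  by (simp_all add: U_def V_def P_def Q_def)

lemma iterates_Suc:
  "U (Suc n) = transport 1 u0 (\<lambda>t x. F (U n t x) (V n t x))"
  "V (Suc n) = transport (-1) v0 (\<lambda>t x. F (V n t x) (U n t x))"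
  "P (Suc n) = transport 1 u0' (\<lambda>t x. D (U n t x) (V n t x) (P n t x) (Q n t x))"
  "Q (Suc n) = transport (-1) v0' (\<lambda>t x. D (V n t x) (U n t x) (Q n t x) (P n t x))"
  by (simp_all add: U_def V_def P_def Q_def case_prod_beta)

abbreviation "strip \<equiv> {0..T} \<times> (UNIV :: real set)"

lemma data_continuous: "continuous_on UNIV u0" "continuous_on UNIV v0"
  using u0(1) v0(1) by (auto intro!: continuous_at_imp_continuous_on has_vector_derivative_continuous)

lemma contF': "continuous_on strip (\<lambda>(t, x). F (a t x) (b t x))"
  if "continuous_on strip (\<lambda>(t, x). a t x)" "continuous_on strip (\<lambda>(t, x). b t x)" for a b
  using contF[OF that] by (simp add: case_prod_beta)

lemma contD': "continuous_on strip (\<lambda>(t, x). D (a t x) (b t x) (p t x) (q t x))"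
  if "continuous_on strip (\<lambda>(t, x). a t x)" "continuous_on strip (\<lambda>(t, x). b t x)"
    "continuous_on strip (\<lambda>(t, x). p t x)" "continuous_on strip (\<lambda>(t, x). q t x)" for a b p q
  using contD[OF that] by (simp add: case_prod_beta)

lemma iterates_continuous:
  "continuous_on strip (\<lambda>(t, x). U n t x) \<and> continuous_on strip (\<lambda>(t, x). V n t x) \<and>
   continuous_on strip (\<lambda>(t, x). P n t x) \<and> continuous_on strip (\<lambda>(t, x). Q n t x)"
proof (induction n)
  case 0 then show ?case by (simp add: iterates_0)
next
  case (Suc n) then show ?case
    unfolding iterates_Suc
    by (intro conjI transport_continuous contF' contD' data_continuous u0(2) v0(2)) auto
qed

lemmas itc = iterates_continuous[THEN conjunct1] iterates_continuous[THEN conjunct2, THEN conjunct1]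
  iterates_continuous[THEN conjunct2, THEN conjunct2, THEN conjunct1]
  iterates_continuous[THEN conjunct2, THEN conjunct2, THEN conjunct2]

lemma iterates_derivative:
  assumes t: "t \<in> {0..T}"
  shows "(U n t has_vector_derivative P n t x) (at x) \<and> (V n t has_vector_derivative Q n t x) (at x)"
  using t
proof (induction n arbitrary: t x)
  case 0
  have "U 0 t = (\<lambda>_. 0)" "V 0 t = (\<lambda>_. 0)" for t by (auto simp: iterates_0)
  then show ?case by (simp add: iterates_0)
next
  case (Suc n)
  have "C1_strip T (U (Suc n)) (\<lambda>t x. F (U n t x) (V n t x) - 1 *\<^sub>R P (Suc n) t x) (P (Suc n))"
    unfolding iterates_Suc by (rule transport_C1) (intro contF' contD' itc chain u0; use Suc.IH
        in auto)+
  moreover have "C1_strip T (V (Suc n)) (\<lambda>t x. F (V n t x) (U n t x) - (-1) *\<^sub>R Q (Suc n) t x)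
      (Q (Suc n))"
    unfolding iterates_Suc by (rule transport_C1) (intro contF' contD' itc chain v0; use Suc.IH
        in auto)+
  ultimately show ?case using C1_stripD(5) Suc.prems by blast
qed

lemma B0_nonneg: "0 \<le> B0"
  using B0(1)[of 0] norm_ge_zero order_trans by blast

lemma iterates_bound:
  assumes "t \<in> {0..T}"
  shows "cmod (U n t x) \<le> B0 * exp (2 * L * t) \<and> cmod (V n t x) \<le> B0 * exp (2 * L * t)"
  using assms
proof (induction n arbitrary: t x)
  case 0 then show ?case using B0_nonneg by (simp add: iterates_0)
next
  case (Suc n)
  let ?G = "\<lambda>s. B0 * exp (2 * L * s)" and ?g = "\<lambda>s. L * (B0 * exp (2 * L * s) + B0 * exp (2 * L * s))"
  have G: "(?G has_real_derivative ?g s) (at s within {0..t})" for s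
    by (auto intro!: derivative_eq_intros)
  have FU: "cmod (F (U n s x) (V n s x)) \<le> ?g s" "cmod (F (V n s x) (U n s x)) \<le>
      ?g s" if "s \<in> {0..t}" for s x
    using Suc.IH[of s x] that Suc.prems L
    by (auto intro!: order_trans[OF growth] mult_left_mono add_mono)
  have "cmod (U (Suc n) t x) \<le> B0 + (?G t - ?G 0)"
    unfolding iterates_Suc
    by (rule transport_bound[OF contF'[OF itc(1,2)] Suc.prems B0(1) G FU(1)])
  moreover have "cmod (V (Suc n) t x) \<le> B0 + (?G t - ?G 0)"
    unfolding iterates_Suc
    by (rule transport_bound[OF contF'[OF itc(2,1)] Suc.prems B0(2) G FU(2)])
  ultimately show ?case by simp
qed

text \<open>\<open>F\<close> grows linearly, and on the resulting bounded range of \<open>(U,V)\<close> the map \<open>D\<close> is bounded as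
  a linear map of the derivatives; so both pairs obey an exponential bound that is reproduced by
  the iteration.\<close>

lemma iterates_bounded: "\<exists>B\<ge>0. \<forall>n. \<forall>t\<in>{0..T}. \<forall>x. cmod (U n t x) \<le> B \<and> cmod (V n t x) \<le> B \<and>
    cmod (P n t x) \<le> B \<and> cmod (Q n t x) \<le> B"
proof -
  define Bw where "Bw = B0 * exp (2 * L * T)"
  have UV: "cmod (U n t x) \<le> Bw" "cmod (V n t x) \<le> Bw" if t: "t \<in> {0..T}" for n t x
  proof -
    have "B0 * exp (2 * L * t) \<le> Bw"
      unfolding Bw_def using t L B0_nonneg by (auto intro!: mult_left_mono)
    then show "cmod (U n t x) \<le> Bw" "cmod (V n t x) \<le> Bw" using iterates_bound[OF t, of n x] by auto
  qed
  obtain L1 where L1: "0 \<le> L1" "\<And>a b p q. cmod a \<le> Bw \<Longrightarrow> cmod b \<le> Bw \<Longrightarrow> cmod (D a b p q) \<le>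
      L1 * (cmod p + cmod q)"
    using Dlin[of Bw] by auto
  have PQ: "cmod (P n t x) \<le> B0 * exp (2 * L1 * t) \<and> cmod (Q n t x) \<le> B0 * exp (2 * L1 * t)"
    if t: "t \<in> {0..T}" for n t x
    using t
  proof (induction n arbitrary: t x)
    case 0 then show ?case using B0_nonneg by (simp add: iterates_0)
  next
    case (Suc n)
    let ?G = "\<lambda>s. B0 * exp (2 * L1 * s)" and ?g = "\<lambda>s. L1 * (B0 * exp (2 * L1 * s) +
        B0 * exp (2 * L1 * s))"
    have G: "(?G has_real_derivative ?g s) (at s within {0..t})" for s
      by (auto intro!: derivative_eq_intros)
    have FU: "cmod (D (U n s x) (V n s x) (P n s x) (Q n s x)) \<le> ?g s"
      "cmod (D (V n s x) (U n s x) (Q n s x) (P n s x)) \<le> ?g s" if "s \<in> {0..t}" for s x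
      using Suc.IH[of s x] that Suc.prems L1(1) UV[of s n x]
      by (auto intro!: order_trans[OF L1(2)] mult_left_mono add_mono)
    have "cmod (P (Suc n) t x) \<le> B0 + (?G t - ?G 0)"
      unfolding iterates_Suc
      by (rule transport_bound[OF contD'[OF itc(1,2,3,4)] Suc.prems B0(3) G FU(1)])
    moreover have "cmod (Q (Suc n) t x) \<le> B0 + (?G t - ?G 0)"
      unfolding iterates_Suc
      by (rule transport_bound[OF contD'[OF itc(2,1,4,3)] Suc.prems B0(4) G FU(2)])
    ultimately show ?case by simp
  qed
  define B where "B = max Bw (B0 * exp (2 * L1 * T))"
  have "cmod (U n t x) \<le> B \<and> cmod (V n t x) \<le> B \<and> cmod (P n t x) \<le> B \<and> cmod (Q n t x) \<le> B"
    if t: "t \<in> {0..T}" for n t x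
  proof -
    have "B0 * exp (2 * L1 * t) \<le> B0 * exp (2 * L1 * T)"
      using t L1 B0_nonneg by (auto intro!: mult_left_mono)
    then show ?thesis unfolding B_def using UV[OF t, of n x] PQ[OF t, of n x] by auto
  qed
  moreover have "0 \<le> B" unfolding B_def Bw_def using B0_nonneg by (auto simp: le_max_iff_disj)
  ultimately show ?thesis by blast
qed

text \<open>On the bounded range of the iterates the map from one step to the next is an integral in
  time of a Lipschitz expression, and the usual factorial bound of Picard iteration follows.\<close>

lemma iterates_increment_bound:
  "\<exists>C \<Lambda>. 0 \<le> C \<and> 0 \<le> \<Lambda> \<and> (\<forall>n. \<forall>t\<in>{0..T}. \<forall>x.
     cmod (U (Suc n) t x - U n t x) \<le> C * ((\<Lambda> * t) ^ n / fact n) \<and>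
     cmod (V (Suc n) t x - V n t x) \<le> C * ((\<Lambda> * t) ^ n / fact n) \<and>
     cmod (P (Suc n) t x - P n t x) \<le> C * ((\<Lambda> * t) ^ n / fact n) \<and>
     cmod (Q (Suc n) t x - Q n t x) \<le> C * ((\<Lambda> * t) ^ n / fact n))"
proof -
  obtain B where B: "0 \<le> B" "\<And>n t x. t \<in> {0..T} \<Longrightarrow> cmod (U n t x) \<le> B"
    "\<And>n t x. t \<in> {0..T} \<Longrightarrow> cmod (V n t x) \<le> B" "\<And>n t x. t \<in> {0..T} \<Longrightarrow> cmod (P n t x) \<le> B"
    "\<And>n t x. t \<in> {0..T} \<Longrightarrow> cmod (Q n t x) \<le> B"
    using iterates_bounded by auto
  obtain L2 where L2: "0 \<le> L2" "\<And>a b a' b'. cmod a \<le> B \<Longrightarrow> cmod b \<le> B \<Longrightarrow> cmod a' \<le> B \<Longrightarrow> cmod b' \<le> B \<Longrightarrow>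
      cmod (F a b - F a' b') \<le> L2 * (cmod (a - a') + cmod (b - b'))"
    by (rule locally_lipschitz2E[OF lip, of B]) (rule that)
  obtain L3 where L3: "0 \<le> L3" "\<And>a b p q a' b' p' q'. cmod a \<le> B \<Longrightarrow> cmod b \<le> B \<Longrightarrow> cmod p \<le> B \<Longrightarrow>
      cmod q \<le> B \<Longrightarrow>
      cmod a' \<le> B \<Longrightarrow> cmod b' \<le> B \<Longrightarrow> cmod p' \<le> B \<Longrightarrow> cmod q' \<le> B \<Longrightarrow>
      cmod (D a b p q - D a' b' p' q') \<le> L3 * (cmod (a - a') + cmod (b - b') + cmod (p - p') +
          cmod (q - q'))"
    by (rule locally_lipschitz4E[OF Dlip, of B]) (rule that)
  define \<Lambda> where "\<Lambda> = 4 * (L2 + L3)"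
  have \<Lambda>: "0 \<le> \<Lambda>" using L2 L3 by (simp add: \<Lambda>_def)
  have "\<forall>t\<in>{0..T}. \<forall>x.
     cmod (U (Suc n) t x - U n t x) \<le> B * ((\<Lambda> * t) ^ n / fact n) \<and>
     cmod (V (Suc n) t x - V n t x) \<le> B * ((\<Lambda> * t) ^ n / fact n) \<and>
     cmod (P (Suc n) t x - P n t x) \<le> B * ((\<Lambda> * t) ^ n / fact n) \<and>
     cmod (Q (Suc n) t x - Q n t x) \<le> B * ((\<Lambda> * t) ^ n / fact n)" for n
  proof (induction n)
    case 0 then show ?case using B by (simp add: iterates_0)
  next
    case (Suc n)
    define d where "d s = B * ((\<Lambda> * s) ^ n / fact n)" for s
    define G where "G s = B * ((\<Lambda> * s) ^ Suc n / fact (Suc n))" for s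
    have d0: "0 \<le> d s" if "0 \<le> s" for s unfolding d_def using B(1) \<Lambda> that by simp
    have IH: "cmod (U (Suc n) s x - U n s x) \<le> d s" "cmod (V (Suc n) s x - V n s x) \<le> d s"
      "cmod (P (Suc n) s x - P n s x) \<le> d s" "cmod (Q (Suc n) s x - Q n s x) \<le> d s" if "s \<in> {0..T}"
          for s x
      using Suc that unfolding d_def by blast+
    have G: "(G has_real_derivative \<Lambda> * d s) (at s within S)" for s S
    proof -
      have "(G has_real_derivative B * (real (Suc n) * ((\<Lambda> * s) ^ n * \<Lambda>) / fact (Suc n)))
          (at s within S)"
        unfolding G_def by (rule derivative_eq_intros refl | simp)+
      moreover have "real (Suc n) * ((\<Lambda> * s) ^ n * \<Lambda>) / fact (Suc n) = (\<Lambda> * s) ^ n * \<Lambda> / fact n"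
        unfolding fact_Suc by (simp del: of_nat_Suc)
      ultimately show ?thesis by (simp add: d_def mult_ac)
    qed
    have F1: "L2 * (a + b) \<le> \<Lambda> * d s" if "a \<le> d s" "b \<le> d s" "0 \<le> s" for a b s
    proof -
      have "L2 * (a + b) \<le> L2 * (2 * d s)" using that L2 by (intro mult_left_mono) auto
      also have "\<dots> \<le> \<Lambda> * d s" using L2 L3 d0[OF that(3)] by (simp add: \<Lambda>_def algebra_simps)
      finally show ?thesis .
    qed
    have F2: "L3 * (a + b + p + q) \<le> \<Lambda> * d s" if "a \<le> d s" "b \<le> d s" "p \<le> d s" "q \<le> d s" "0 \<le>
        s" for a b p q s
    proof -
      have "L3 * (a + b + p + q) \<le> L3 * (4 * d s)" using that L3 by (intro mult_left_mono) auto
      also have "\<dots> \<le> \<Lambda> * d s" using L2 L3 d0[OF that(5)] by (simp add: \<Lambda>_def algebra_simps)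
      finally show ?thesis .
    qed
    have diff: "cmod (transport c f0 f t x - transport c f0 g t x) \<le> G t"
      if "continuous_on strip (\<lambda>(t, x). f t x)" "continuous_on strip (\<lambda>(t, x). g t x)" "t \<in> {0..T}"
        and "\<And>s x. s \<in> {0..T} \<Longrightarrow> cmod (f s x - g s x) \<le> \<Lambda> * d s" for c f0 f g t x
    proof -
      have "cmod (transport c (\<lambda>_. 0) (\<lambda>t x. f t x - g t x) t x) \<le> 0 + (G t - G 0)"
        by (rule transport_bound[OF _ that(3) _ G])
          (use that in \<open>auto simp: case_prod_beta intro!: continuous_intros\<close>)
      then show ?thesis unfolding transport_diff[OF that(1-3)] by (simp add: G_def)
    qed
    show ?case
    proof (intro ballI allI conjI)
      fix t x assume t: "t \<in> {0..T}"
      have "cmod (transport 1 u0 (\<lambda>t x. F (U (Suc n) t x) (V (Suc n) t x)) t x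
          - transport 1 u0 (\<lambda>t x. F (U n t x) (V n t x)) t x) \<le> G t"
        by (intro diff contF' itc t order_trans[OF L2(2)] F1 IH B) auto
      then show "cmod (U (Suc (Suc n)) t x - U (Suc n) t x) \<le> B * ((\<Lambda> * t) ^ Suc n / fact (Suc n))"
        by (simp only: iterates_Suc G_def)
      have "cmod (transport (-1) v0 (\<lambda>t x. F (V (Suc n) t x) (U (Suc n) t x)) t x
          - transport (-1) v0 (\<lambda>t x. F (V n t x) (U n t x)) t x) \<le> G t"
        by (intro diff contF' itc t order_trans[OF L2(2)] F1 IH B) auto
      then show "cmod (V (Suc (Suc n)) t x - V (Suc n) t x) \<le> B * ((\<Lambda> * t) ^ Suc n / fact (Suc n))"
        by (simp only: iterates_Suc G_def)
      have "cmod (transport 1 u0' (\<lambda>t x. D (U (Suc n) t x) (V (Suc n) t x) (P (Suc n) t x)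
          (Q (Suc n) t x)) t x
          - transport 1 u0' (\<lambda>t x. D (U n t x) (V n t x) (P n t x) (Q n t x)) t x) \<le> G t"
        by (intro diff contD' itc t order_trans[OF L3(2)] F2 IH B) auto
      then show "cmod (P (Suc (Suc n)) t x - P (Suc n) t x) \<le> B * ((\<Lambda> * t) ^ Suc n / fact (Suc n))"
        by (simp only: iterates_Suc G_def)
      have "cmod (transport (-1) v0' (\<lambda>t x. D (V (Suc n) t x) (U (Suc n) t x) (Q (Suc n) t x)
          (P (Suc n) t x)) t x
          - transport (-1) v0' (\<lambda>t x. D (V n t x) (U n t x) (Q n t x) (P n t x)) t x) \<le> G t"
        by (intro diff contD' itc t order_trans[OF L3(2)] F2 IH B) auto
      then show "cmod (Q (Suc (Suc n)) t x - Q (Suc n) t x) \<le> B * ((\<Lambda> * t) ^ Suc n / fact (Suc n))"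
        by (simp only: iterates_Suc G_def)
    qed
  qed
  then show ?thesis using B(1) \<Lambda> by blast
qed

lemma iterates_converge:
  obtains u v p q where
    "uniform_limit strip (\<lambda>n (t, x). U n t x) (\<lambda>(t, x). u t x) sequentially"
    "uniform_limit strip (\<lambda>n (t, x). V n t x) (\<lambda>(t, x). v t x) sequentially"
    "uniform_limit strip (\<lambda>n (t, x). P n t x) (\<lambda>(t, x). p t x) sequentially"
    "uniform_limit strip (\<lambda>n (t, x). Q n t x) (\<lambda>(t, x). q t x) sequentially"
proof -
  obtain C \<Lambda> where C: "0 \<le> C" "0 \<le> \<Lambda>" and inc: "\<And>n t x. t \<in> {0..T} \<Longrightarrow>
     cmod (U (Suc n) t x - U n t x) \<le> C * ((\<Lambda> * t) ^ n / fact n) \<and>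
     cmod (V (Suc n) t x - V n t x) \<le> C * ((\<Lambda> * t) ^ n / fact n) \<and>
     cmod (P (Suc n) t x - P n t x) \<le> C * ((\<Lambda> * t) ^ n / fact n) \<and>
     cmod (Q (Suc n) t x - Q n t x) \<le> C * ((\<Lambda> * t) ^ n / fact n)"
    using iterates_increment_bound by blast
  have s: "summable (\<lambda>n. C * ((\<Lambda> * T) ^ n / fact n))"
    using summable_exp[of "\<Lambda> * T"] by (intro summable_mult) (simp add: field_simps)
  have mono: "C * ((\<Lambda> * t) ^ n / fact n) \<le> C * ((\<Lambda> * T) ^ n / fact n)" if "t \<in> {0..T}" for t n
    using that C by (intro mult_left_mono divide_right_mono power_mono) auto
  have "\<exists>l. uniform_limit strip (\<lambda>n (t, x). f n t x) (\<lambda>(t, x). l t x) sequentially"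
    if "\<And>n t x. t \<in> {0..T} \<Longrightarrow> cmod (f (Suc n) t x - f n t x) \<le> C * ((\<Lambda> * t) ^ n / fact n)"
      "\<And>t x. f 0 t x = 0" for f :: "nat \<Rightarrow> real \<Rightarrow> real \<Rightarrow> complex"
  proof -
    have "\<exists>l. uniform_limit strip (\<lambda>n (t, x). f n t x) l sequentially"
      by (rule telescoping_uniform_limit[OF _ s]) (use that order_trans[OF that(1) mono] in auto)
    then obtain l where "uniform_limit strip (\<lambda>n (t, x). f n t x) l sequentially" by blast
    then have "uniform_limit strip (\<lambda>n (t, x). f n t x) (\<lambda>(t, x). (\<lambda>t x. l (t, x)) t x)
        sequentially" by simp
    then show ?thesis by blast
  qed
  note ex = this
  obtain u where u: "uniform_limit strip (\<lambda>n (t, x). U n t x) (\<lambda>(t, x). u t x) sequentially"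
    using ex[of U] inc iterates_0 by auto
  obtain v where v: "uniform_limit strip (\<lambda>n (t, x). V n t x) (\<lambda>(t, x). v t x) sequentially"
    using ex[of V] inc iterates_0 by auto
  obtain p where p: "uniform_limit strip (\<lambda>n (t, x). P n t x) (\<lambda>(t, x). p t x) sequentially"
    using ex[of P] inc iterates_0 by auto
  obtain q where q: "uniform_limit strip (\<lambda>n (t, x). Q n t x) (\<lambda>(t, x). q t x) sequentially"
    using ex[of Q] inc iterates_0 by auto
  show ?thesis by (rule that[OF u v p q])
qed

lemma limit_derivative:
  assumes f: "\<And>n x. (f n t has_vector_derivative f' n t x) (at x)"
    and u: "uniform_limit strip (\<lambda>n (t, x). f n t x) (\<lambda>(t, x). u t x) sequentially"
    and p: "uniform_limit strip (\<lambda>n (t, x). f' n t x) (\<lambda>(t, x). p t x) sequentially"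
    and t: "t \<in> {0..T}"
  shows "((u t :: real \<Rightarrow> complex) has_vector_derivative p t x) (at x)"
proof -
  have lim: "(\<lambda>n. f n t x) \<longlonglongrightarrow> u t x" for x
    using tendsto_uniform_limitI[OF u, of "(t, x)"] t by simp
  have "\<exists>g. \<forall>x\<in>UNIV. (\<lambda>n. f n t x) \<longlonglongrightarrow> g x \<and> (g has_derivative (\<lambda>h. h *\<^sub>R p t x)) (at x within UNIV)"
  proof (rule has_derivative_sequence)
    show "(f n t has_derivative (\<lambda>h. h *\<^sub>R f' n t x)) (at x within UNIV)" for n x
      using f[of n x] by (simp add: has_vector_derivative_def)
    fix e :: real assume "e > 0"
    from uniform_limitD[OF p this]
    show "\<forall>\<^sub>F n in sequentially. \<forall>x\<in>UNIV. \<forall>h. norm (h *\<^sub>R f' n t x - h *\<^sub>R p t x) \<le> e * norm h"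
    proof eventually_elim
      case (elim n)
      have "norm (h *\<^sub>R f' n t x - h *\<^sub>R p t x) \<le> e * norm h" for x h
      proof -
        have "norm (f' n t x - p t x) \<le> e" using bspec[OF elim, of "(t, x)"] t by (simp add: dist_norm)
        then have "\<bar>h\<bar> * norm (f' n t x - p t x) \<le> \<bar>h\<bar> * e" by (intro mult_left_mono) auto
        then show ?thesis by (simp add: mult.commute flip: scaleR_diff_right)
      qed
      then show ?case by blast
    qed
  qed (use lim[of 0] in auto)
  then obtain g where g: "\<And>x. (\<lambda>n. f n t x) \<longlonglongrightarrow> g x" "(g has_derivative (\<lambda>h. h *\<^sub>R p t x)) (at x)" for x
    by auto
  have "g = u t" using LIMSEQ_unique[OF g(1) lim] by auto
  then show ?thesis using g(2) by (simp add: has_vector_derivative_def)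
qed

text \<open>The uniform limits \<open>p\<close> and \<open>q\<close> are the space derivatives of \<open>u\<close> and \<open>v\<close>, so \<open>F(u,v)\<close> has a
  continuous space derivative, and the fixed point equation for \<open>u\<close> yields a \<open>C\<^sup>1\<close> solution.\<close>

lemma semilinear_transport_solution:
  "\<exists>u ut ux v vt vx. C1_strip T u ut ux \<and> C1_strip T v vt vx \<and> u 0 = u0 \<and> v 0 = v0 \<and>
     (\<forall>t\<in>{0..T}. \<forall>x. ut t x + ux t x = F (u t x) (v t x) \<and> vt t x - vx t x = F (v t x) (u t x))"
proof -
  obtain B where B: "0 \<le> B" "\<And>n t x. t \<in> {0..T} \<Longrightarrow> cmod (U n t x) \<le> B" "\<And>n t x. t \<in> {0..T} \<Longrightarrow>
      cmod (V n t x) \<le> B"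
    using iterates_bounded by auto
  obtain L2 where L2: "0 \<le> L2" "\<And>a b a' b'. cmod a \<le> B \<Longrightarrow> cmod b \<le> B \<Longrightarrow> cmod a' \<le> B \<Longrightarrow> cmod b' \<le> B \<Longrightarrow>
      cmod (F a b - F a' b') \<le> L2 * (cmod (a - a') + cmod (b - b'))"
    by (rule locally_lipschitz2E[OF lip, of B]) (rule that)
  obtain u v p q where
    u: "uniform_limit strip (\<lambda>n (t, x). U n t x) (\<lambda>(t, x). u t x) sequentially" and
    v: "uniform_limit strip (\<lambda>n (t, x). V n t x) (\<lambda>(t, x). v t x) sequentially" and
    p: "uniform_limit strip (\<lambda>n (t, x). P n t x) (\<lambda>(t, x). p t x) sequentially" and
    q: "uniform_limit strip (\<lambda>n (t, x). Q n t x) (\<lambda>(t, x). q t x) sequentially"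
    by (rule iterates_converge)
  have cont: "continuous_on strip (\<lambda>(t, x). u t x)" "continuous_on strip (\<lambda>(t, x). v t x)"
    "continuous_on strip (\<lambda>(t, x). p t x)" "continuous_on strip (\<lambda>(t, x). q t x)"
    by (rule uniform_limit_theorem[OF _ u] uniform_limit_theorem[OF _ v] uniform_limit_theorem[OF _ p]
        uniform_limit_theorem[OF _ q]; simp add: itc)+
  have pt: "(\<lambda>n. U n t x) \<longlonglongrightarrow> u t x" "(\<lambda>n. V n t x) \<longlonglongrightarrow> v t x" if "t \<in> {0..T}" for t x
    using tendsto_uniform_limitI[OF u, of "(t, x)"] tendsto_uniform_limitI[OF v, of "(t, x)"] that
        by auto
  have Buv: "cmod (u t x) \<le> B" "cmod (v t x) \<le> B" if t: "t \<in> {0..T}" for t x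
    by (rule Lim_norm_ubound[OF _ pt(1)[OF t]] Lim_norm_ubound[OF _ pt(2)[OF t]]; use B t in auto)+
  have du: "(u t has_vector_derivative p t x) (at x)" and dv: "(v t has_vector_derivative q t x) (at x)"
    if t: "t \<in> {0..T}" for t x
    using limit_derivative[OF _ u p t] limit_derivative[OF _ v q t] iterates_derivative[OF t] by auto
  have F_limit: "uniform_limit strip (\<lambda>n (t, x). F (a n t x) (b n t x)) (\<lambda>(t, x). F (a' t x)
      (b' t x)) sequentially"
    if a: "uniform_limit strip (\<lambda>n (t, x). a n t x) (\<lambda>(t, x). a' t x) sequentially"
      and b: "uniform_limit strip (\<lambda>n (t, x). b n t x) (\<lambda>(t, x). b' t x) sequentially"
      and bd: "\<And>n t x. t \<in> {0..T} \<Longrightarrow> cmod (a n t x) \<le> B" "\<And>n t x. t \<in> {0..T} \<Longrightarrow> cmod (b n t x) \<le> B"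
        "\<And>t x. t \<in> {0..T} \<Longrightarrow> cmod (a' t x) \<le> B" "\<And>t x. t \<in> {0..T} \<Longrightarrow> cmod (b' t x) \<le> B"
    for a b a' b'
  proof (rule uniform_limitI)
    fix e :: real assume e: "e > 0"
    define e' where "e' = e / (2 * L2 + 1)"
    have e': "e' > 0" unfolding e'_def using e L2 by simp
    have small: "L2 * (2 * e') < e" using e L2 unfolding e'_def by (simp add: field_simps)
    from uniform_limitD[OF a e'] uniform_limitD[OF b e']
    show "\<forall>\<^sub>F n in sequentially. \<forall>z\<in>strip. dist (case z of (t, x) \<Rightarrow> F (a n t x) (b n t x))
        (case z of (t, x) \<Rightarrow> F (a' t x) (b' t x)) < e"
    proof eventually_elim
      case (elim n)
      have "cmod (F (a n t x) (b n t x) - F (a' t x) (b' t x)) < e" if t: "t \<in> {0..T}" for t x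
      proof -
        have "cmod (a n t x - a' t x) \<le> e'" "cmod (b n t x - b' t x) \<le> e'"
          using bspec[OF elim(1), of "(t, x)"] bspec[OF elim(2), of "(t, x)"] t
              by (auto simp: dist_norm)
        then have "L2 * (cmod (a n t x - a' t x) + cmod (b n t x - b' t x)) \<le> L2 * (2 * e')"
          using L2 by (intro mult_left_mono) auto
        then show ?thesis using L2(2)[OF bd(1)[OF t, of n x] bd(2)[OF t, of n x] bd(3,4)[OF t,
            of x]] small by linarith
      qed
      then show ?case by (auto simp: dist_norm)
    qed
  qed
  define u' where "u' = transport 1 u0 (\<lambda>t x. F (u t x) (v t x))"
  define v' where "v' = transport (-1) v0 (\<lambda>t x. F (v t x) (u t x))"
  have u'_eq: "u' t x = u t x" if t: "t \<in> {0..T}" for t x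
  proof -
    have "(\<lambda>n. U (Suc n) t x) \<longlonglongrightarrow> u' t x"
      unfolding iterates_Suc u'_def
      by (rule transport_limit[OF contF'[OF itc(1,2)] F_limit[OF u v B(2,3) Buv] t])
    from LIMSEQ_unique[OF this LIMSEQ_Suc[OF pt(1)[OF t]]] show ?thesis .
  qed
  have v'_eq: "v' t x = v t x" if t: "t \<in> {0..T}" for t x
  proof -
    have "(\<lambda>n. V (Suc n) t x) \<longlonglongrightarrow> v' t x"
      unfolding iterates_Suc v'_def
      by (rule transport_limit[OF contF'[OF itc(2,1)] F_limit[OF v u B(3,2) Buv(2,1)] t])
    from LIMSEQ_unique[OF this LIMSEQ_Suc[OF pt(2)[OF t]]] show ?thesis .
  qed
  define ux where "ux = transport 1 u0' (\<lambda>t x. D (u t x) (v t x) (p t x) (q t x))"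
  define vx where "vx = transport (-1) v0' (\<lambda>t x. D (v t x) (u t x) (q t x) (p t x))"
  have "C1_strip T u' (\<lambda>t x. F (u t x) (v t x) - 1 *\<^sub>R ux t x) ux"
    unfolding u'_def ux_def by (rule transport_C1) (intro contF' contD' cont chain u0 du dv;
        assumption)+
  moreover have "C1_strip T v' (\<lambda>t x. F (v t x) (u t x) - (-1) *\<^sub>R vx t x) vx"
    unfolding v'_def vx_def by (rule transport_C1) (intro contF' contD' cont chain v0 du dv;
        assumption)+
  moreover have "u' 0 = u0" "v' 0 = v0"
    unfolding u'_def v'_def by (auto simp: transport_0)
  moreover have "\<forall>t\<in>{0..T}. \<forall>x. (F (u t x) (v t x) - 1 *\<^sub>R ux t x) + ux t x = F (u' t x) (v' t x) \<and>
      (F (v t x) (u t x) - (-1) *\<^sub>R vx t x) - vx t x = F (v' t x) (u' t x)"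
    using u'_eq v'_eq by simp
  ultimately show ?thesis by blast
qed

end

section \<open>Truncation of the nonlinearity\<close>

text \<open>Squaring makes the ramp continuously differentiable with a Lipschitz derivative, the
  smoothness that the Picard iteration requires.\<close>

definition ramp :: "real \<Rightarrow> real" where "ramp y = (max 0 y)\<^sup>2"

lemma DERIV_ramp: "(ramp has_real_derivative 2 * max 0 y) (at y)"
proof (cases y "0 :: real" rule: linorder_cases)
  case less
  have "((\<lambda>y. 0 :: real) has_real_derivative 0) (at y)" by simp
  then have "(ramp has_real_derivative 0) (at y)"
    by (rule has_field_derivative_transform_within_open[of _ _ _ "{..<0}"]) (use less
        in \<open>auto simp: ramp_def\<close>)
  then show ?thesis using less by simp
next
  case greater
  have "((\<lambda>y :: real. y\<^sup>2) has_real_derivative 2 * y) (at y)" by (auto intro!: derivative_eq_intros)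
  then have "(ramp has_real_derivative 2 * y) (at y)"
    by (rule has_field_derivative_transform_within_open[of _ _ _ "{0<..}"]) (use greater
        in \<open>auto simp: ramp_def\<close>)
  then show ?thesis using greater by simp
next
  case equal
  have "((\<lambda>h. (ramp (0 + h) - ramp 0) / h) \<longlongrightarrow> 0) (at 0)"
  proof (rule Lim_null_comparison)
    show "\<forall>\<^sub>F h in at 0. norm ((ramp (0 + h) - ramp 0) / h) \<le> \<bar>h\<bar>"
      by (intro always_eventually allI) (auto simp: ramp_def max_def power2_eq_square divide_simps)
    show "((\<lambda>h. \<bar>h\<bar>) \<longlongrightarrow> 0) (at (0 :: real))"
      by (auto intro!: tendsto_eq_intros)
  qed
  then show ?thesis using equal by (simp add: DERIV_def)
qed

text \<open>Equal to 1 on \<open>(-\<infinity>, R]\<close> and to 0 on \<open>[R + 1, \<infinity>)\<close>.\<close>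

definition cutoff :: "real \<Rightarrow> real \<Rightarrow> real" where "cutoff R s = ramp (1 - ramp (s - R))"

definition cutoff' :: "real \<Rightarrow> real \<Rightarrow> real" where
  "cutoff' R s = - (2 * max 0 (1 - ramp (s - R))) * (2 * max 0 (s - R))"

lemma DERIV_cutoff: "(cutoff R has_real_derivative cutoff' R s) (at s)"
proof -
  have "((\<lambda>s. s - R) has_real_derivative 1) (at s)" by (auto intro!: derivative_eq_intros)
  from DERIV_chain2[OF DERIV_ramp this]
  have 1: "((\<lambda>s. ramp (s - R)) has_real_derivative 2 * max 0 (s - R)) (at s)" by simp
  have 2: "((\<lambda>s. 1 - ramp (s - R)) has_real_derivative - (2 * max 0 (s - R))) (at s)"
    by (rule derivative_eq_intros 1 refl)+ simp
  show ?thesis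
    using DERIV_chain2[OF DERIV_ramp 2] unfolding cutoff_def[abs_def] cutoff'_def by simp
qed

lemma cutoff_range: "0 \<le> cutoff R s" "cutoff R s \<le> 1"
proof -
  have "max 0 (1 - ramp (s - R)) \<le> 1" "0 \<le> max 0 (1 - ramp (s - R))" by (auto simp: ramp_def)
  then show "0 \<le> cutoff R s" "cutoff R s \<le> 1"
    unfolding cutoff_def ramp_def[of "1 - _"] by (auto intro: power_le_one)
qed

lemma cutoff_eq_1: "s \<le> R \<Longrightarrow> cutoff R s = 1"
  by (simp add: cutoff_def ramp_def)

lemma cutoff_eq_0:
  assumes "R + 1 \<le> s" shows "cutoff R s = 0"
proof -
  have "1 \<le> (s - R)\<^sup>2" using assms by (intro one_le_power) auto
  moreover have "ramp (s - R) = (s - R)\<^sup>2" using assms by (simp add: ramp_def)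
  ultimately show ?thesis by (simp add: cutoff_def ramp_def[of "1 - _"])
qed

text \<open>Rewrites the squared modulus into operations that the closure rules for local Lipschitz
  continuity cover.\<close>

lemma cmod_square_Re: "(cmod z)\<^sup>2 = Re (cnj z * z)"
  unfolding cmod_power2 by (simp add: power2_eq_square)

lemma locally_lipschitz_cutoff:
  assumes "locally_lipschitz f"
  shows "locally_lipschitz (\<lambda>x. cutoff R (f x))" "locally_lipschitz (\<lambda>x. cutoff' R (f x))"
  unfolding cutoff_def cutoff'_def ramp_def power2_eq_square
  by (intro locally_lipschitz_basic locally_lipschitz_diff locally_lipschitz_minus assms)+

definition N1_derivative :: "real \<Rightarrow> real \<Rightarrow> complex \<Rightarrow> complex \<Rightarrow> complex \<Rightarrow> complex \<Rightarrow> complex" where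
  "N1_derivative \<alpha> \<beta> a b p q =
     of_real \<alpha> * (p * b * cnj b + a * q * cnj b + a * b * cnj q) +
     of_real (2 * \<beta>) * (cnj p * b * b + cnj a * q * b + cnj a * b * q) +
     of_real (2 * \<beta>) * (p * cnj b * b + a * cnj q * b + a * cnj b * q)"

definition truncated_rhs :: "real \<Rightarrow> real \<Rightarrow> real \<Rightarrow> real \<Rightarrow> complex \<Rightarrow> complex \<Rightarrow> complex" where
  "truncated_rhs m \<alpha> \<beta> R a b = dirac_rhs m \<alpha> \<beta> (cutoff R ((cmod a)\<^sup>2 + (cmod b)\<^sup>2)) a b"

definition truncated_rhs_derivative ::
    "real \<Rightarrow> real \<Rightarrow> real \<Rightarrow> real \<Rightarrow> complex \<Rightarrow> complex \<Rightarrow> complex \<Rightarrow> complex \<Rightarrow> complex" where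
  "truncated_rhs_derivative m \<alpha> \<beta> R a b p q = - \<i> * (- of_real m * q +
     (of_real (cutoff R ((cmod a)\<^sup>2 + (cmod b)\<^sup>2)) * N1_derivative \<alpha> \<beta> a b p q +
      of_real (cutoff' R ((cmod a)\<^sup>2 + (cmod b)\<^sup>2) * (2 * Re (cnj a * p) + 2 * Re (cnj b * q))) *
          N1 \<alpha> \<beta> a b))"

lemma has_vector_derivative_N1:
  assumes "(a has_vector_derivative p) (at x)" "(b has_vector_derivative q) (at x)"
  shows "((\<lambda>y. N1 \<alpha> \<beta> (a y) (b y)) has_vector_derivative N1_derivative \<alpha> \<beta> (a x) (b x) p q) (at x)"
proof -
  note d = assms assms[THEN has_vector_derivative_cnj]
  have t: "((\<lambda>y. f y * g y * h y) has_vector_derivative (f' * g x * h x + f x * g' * h x +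
      f x * g x * h')) (at x)"
    if "(f has_vector_derivative f') (at x)" "(g has_vector_derivative g') (at x)"
        "(h has_vector_derivative h') (at x)"
    for f g h :: "real \<Rightarrow> complex" and f' g' h'
    using has_vector_derivative_mult[OF has_vector_derivative_mult[OF that(1,2)] that(3)]
    by (simp add: algebra_simps)
  have c: "((\<lambda>y. c * f y) has_vector_derivative c * f') (at x)" if "(f has_vector_derivative f') (at x)"
    for f :: "real \<Rightarrow> complex" and c f'
    using has_vector_derivative_mult_right[OF that] .
  show ?thesis
    unfolding N1_monomials N1_derivative_def
    by (intro has_vector_derivative_add c t d)
qed

lemma has_vector_derivative_truncated_rhs:
  assumes a: "(a has_vector_derivative p) (at x)" and b: "(b has_vector_derivative q) (at x)"
  shows "((\<lambda>y. truncated_rhs m \<alpha> \<beta> R (a y) (b y)) has_vector_derivative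
     truncated_rhs_derivative m \<alpha> \<beta> R (a x) (b x) p q) (at x)"
proof -
  have "((\<lambda>y. cutoff R ((cmod (a y))\<^sup>2 + (cmod (b y))\<^sup>2)) has_real_derivative
      cutoff' R ((cmod (a x))\<^sup>2 + (cmod (b x))\<^sup>2) * (2 * Re (cnj (a x) * p) +
          2 * Re (cnj (b x) * q))) (at x)"
    by (rule DERIV_chain2[OF DERIV_cutoff DERIV_add[OF has_real_derivative_cmod_square[OF a]
        has_real_derivative_cmod_square[OF b]]])
  then have h: "((\<lambda>y. complex_of_real (cutoff R ((cmod (a y))\<^sup>2 + (cmod (b y))\<^sup>2)))
      has_vector_derivative
      complex_of_real (cutoff' R ((cmod (a x))\<^sup>2 + (cmod (b x))\<^sup>2) * (2 * Re (cnj (a x) * p) +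
          2 * Re (cnj (b x) * q)))) (at x)"
    unfolding has_real_derivative_iff_has_vector_derivative
    by (rule bounded_linear.has_vector_derivative[OF bounded_linear_of_real])
  show ?thesis
    unfolding truncated_rhs_def truncated_rhs_derivative_def dirac_rhs_def
    by (intro has_vector_derivative_mult_right has_vector_derivative_add b
        has_vector_derivative_mult[OF h has_vector_derivative_N1[OF a b]])
qed

text \<open>Where the cut-off does not vanish, \<open>|b|\<^sup>2 \<le> R + 1\<close>, which makes the cubic term linear in
  \<open>|a|\<close>.\<close>

lemma truncated_rhs_growth:
  assumes "0 \<le> m" "0 \<le> R"
  shows "cmod (truncated_rhs m \<alpha> \<beta> R a b) \<le> (m + (\<bar>\<alpha>\<bar> + 4 * \<bar>\<beta>\<bar>) * (R + 1)) * (cmod a + cmod b)"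
proof -
  let ?K = "\<bar>\<alpha>\<bar> + 4 * \<bar>\<beta>\<bar>" and ?h = "cutoff R ((cmod a)\<^sup>2 + (cmod b)\<^sup>2)"
  have N: "cmod (N1 \<alpha> \<beta> a b) \<le> ?K * (cmod a * (cmod b)\<^sup>2)"
    using N1_diff_bound[of \<alpha> \<beta> a b 0 0] by (simp add: N1_monomials)
  have "?h * cmod (N1 \<alpha> \<beta> a b) \<le> ?K * (R + 1) * cmod a"
  proof (cases "R + 1 \<le> (cmod a)\<^sup>2 + (cmod b)\<^sup>2")
    case True then show ?thesis using assms by (simp add: cutoff_eq_0)
  next
    case False
    then have "(cmod b)\<^sup>2 \<le> R + 1" using zero_le_power2[of "cmod a"] by linarith
    then have "?K * (cmod a * (cmod b)\<^sup>2) \<le> ?K * (cmod a * (R + 1))" by (intro mult_left_mono) auto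
    moreover have "?h * cmod (N1 \<alpha> \<beta> a b) \<le> 1 * cmod (N1 \<alpha> \<beta> a b)"
      using cutoff_range by (intro mult_right_mono) auto
    ultimately show ?thesis using N by (simp add: mult_ac)
  qed
  moreover have "cmod (truncated_rhs m \<alpha> \<beta> R a b) \<le> m * cmod b + ?h * cmod (N1 \<alpha> \<beta> a b)"
    unfolding truncated_rhs_def dirac_rhs_def
    using norm_triangle_ineq[of "- of_real m * b" "of_real ?h * N1 \<alpha> \<beta> a b"] assms cutoff_range
    by (simp add: norm_mult)
  moreover have "0 \<le> m * cmod a" "0 \<le> ?K * (R + 1) * cmod b" using assms by auto
  ultimately show ?thesis by (simp add: distrib_left distrib_right)
qed

lemmas locally_lipschitz_intros = locally_lipschitz_basic locally_lipschitz_diff locally_lipschitz_minus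
  locally_lipschitz_fst locally_lipschitz_snd locally_lipschitz_id locally_lipschitz_cutoff

lemma truncated_rhs_locally_lipschitz:
  "locally_lipschitz (\<lambda>z. truncated_rhs m \<alpha> \<beta> R (fst z) (snd z))"
  unfolding truncated_rhs_def dirac_rhs_def N1_monomials cmod_square_Re
  by (intro locally_lipschitz_intros)

lemma truncated_rhs_derivative_locally_lipschitz:
  "locally_lipschitz (\<lambda>z. truncated_rhs_derivative m \<alpha> \<beta> R (fst z) (fst (snd z)) (fst (snd (snd z)))
      (snd (snd (snd z))))"
  unfolding truncated_rhs_derivative_def N1_derivative_def N1_monomials cmod_square_Re
  by (intro locally_lipschitz_intros)

section \<open>Global classical solutions\<close>

lemma truncated_rhs_derivative_scaleR:
  "truncated_rhs_derivative m \<alpha> \<beta> R a b (of_real r * p) (of_real r * q) =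
    of_real r * truncated_rhs_derivative m \<alpha> \<beta> R a b p q"
proof -
  have 1: "N1_derivative \<alpha> \<beta> a b (of_real r * p) (of_real r * q) =
      of_real r * N1_derivative \<alpha> \<beta> a b p q"
    unfolding N1_derivative_def by (simp add: algebra_simps)
  have "2 * Re (cnj a * (of_real r * p)) + 2 * Re (cnj b * (of_real r * q)) =
      r * (2 * Re (cnj a * p) + 2 * Re (cnj b * q))"
    by (simp add: algebra_simps)
  then show ?thesis
    unfolding truncated_rhs_derivative_def 1 by (simp add: algebra_simps del: Re_complex_of_real)
qed

text \<open>The map is real-homogeneous in \<open>(p,q)\<close>, so it suffices to compare it with its value 0 at the
  origin for \<open>|p| + |q| = 1\<close>.\<close>

lemma truncated_rhs_derivative_bound:
  "\<exists>L\<ge>0. \<forall>a b p q. cmod a \<le> B \<longrightarrow> cmod b \<le> B \<longrightarrow>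
     cmod (truncated_rhs_derivative m \<alpha> \<beta> R a b p q) \<le> L * (cmod p + cmod q)"
proof -
  let ?D = "truncated_rhs_derivative m \<alpha> \<beta> R"
  obtain L where L: "0 \<le> L" "\<And>a b p q a' b' p' q'. cmod a \<le> max B 1 \<Longrightarrow> cmod b \<le> max B 1 \<Longrightarrow> cmod p \<le>
      max B 1 \<Longrightarrow> cmod q \<le> max B 1 \<Longrightarrow>
      cmod a' \<le> max B 1 \<Longrightarrow> cmod b' \<le> max B 1 \<Longrightarrow> cmod p' \<le> max B 1 \<Longrightarrow> cmod q' \<le> max B 1 \<Longrightarrow>
      cmod (?D a b p q - ?D a' b' p' q') \<le> L * (cmod (a - a') + cmod (b - b') + cmod (p - p') +
          cmod (q - q'))"
    by (rule locally_lipschitz4E[OF truncated_rhs_derivative_locally_lipschitz, of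
        "max B 1" m \<alpha> \<beta> R]) (rule that)
  have zero: "?D a b 0 0 = 0" for a b
    using truncated_rhs_derivative_scaleR[of m \<alpha> \<beta> R a b 0 0 0] by simp
  have "cmod (?D a b p q) \<le> L * (cmod p + cmod q)" if ab: "cmod a \<le> B" "cmod b \<le> B" for a b p q
  proof (cases "cmod p + cmod q = 0")
    case True
    then have "p = 0" "q = 0" by (simp_all add: add_nonneg_eq_0_iff)
    then show ?thesis by (simp add: zero)
  next
    case False
    define s where "s = cmod p + cmod q"
    have s: "s > 0" using False by (simp add: s_def add_nonneg_pos less_le)
    define p' q' where "p' = p / of_real s" and "q' = q / of_real s"
    have pq: "p = of_real s * p'" "q = of_real s * q'" using s by (simp_all add: p'_def q'_def)
    have n: "cmod p' = cmod p / s" "cmod q' = cmod q / s" using s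
        by (simp_all add: p'_def q'_def norm_divide)
    then have "cmod p' \<le> 1" "cmod q' \<le> 1" using s by (simp_all add: s_def)
    then have "cmod (?D a b p' q' - ?D a b 0 0) \<le> L * (cmod (a - a) + cmod (b - b) + cmod (p' - 0) +
        cmod (q' - 0))"
      using ab by (intro L(2)) auto
    also have "\<dots> = L" using n s by (simp add: s_def flip: add_divide_distrib)
    finally have "cmod (?D a b p' q') \<le> L" by (simp add: zero)
    then have "s * cmod (?D a b p' q') \<le> s * L" using s by (intro mult_left_mono) auto
    moreover have "?D a b p q = of_real s * ?D a b p' q'"
      by (subst pq(1), subst pq(2)) (rule truncated_rhs_derivative_scaleR)
    then have "cmod (?D a b p q) = s * cmod (?D a b p' q')" using s by (simp add: norm_mult)
    moreover have "s * L = L * (cmod p + cmod q)" by (simp add: s_def)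
    ultimately show ?thesis by linarith
  qed
  then show ?thesis using L(1) by blast
qed

text \<open>The level \<open>R\<close> is twice the pointwise bound of one component. The truncated solution
  satisfies this bound as well, hence its cut-off factor is identically 1.\<close>

lemma C1_bounded_data_solution:
  assumes m: "0 \<le> m" and T: "0 \<le> T"
    and u0: "\<And>x. (u0 has_vector_derivative u0' x) (at x)" "continuous_on UNIV u0'"
    and v0: "\<And>x. (v0 has_vector_derivative v0' x) (at x)" "continuous_on UNIV v0'"
    and B0: "\<And>x. cmod (u0 x) \<le> B0" "\<And>x. cmod (v0 x) \<le> B0" "\<And>x. cmod (u0' x) \<le>
        B0" "\<And>x. cmod (v0' x) \<le> B0"
    and M: "\<And>a b. integral {a..b} (\<lambda>x. (cmod (u0 x))\<^sup>2 + (cmod (v0 x))\<^sup>2) \<le> M"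
  shows "\<exists>u v. classical_solution m \<alpha> \<beta> T u v \<and> u 0 = u0 \<and> v 0 = v0"
proof -
  define K where "K = \<bar>\<alpha>\<bar> + 4 * \<bar>\<beta>\<bar>"
  have M0: "0 \<le> M" using M[of 0 0] by simp
  have K0: "0 \<le> K" by (simp add: K_def)
  define R where "R = 2 * (exp (m * T + K * M) * (B0\<^sup>2 + m * M / 2))"
  have R0: "0 \<le> R" unfolding R_def using m M0 by simp
  interpret semilinear_transport "truncated_rhs m \<alpha> \<beta> R" "truncated_rhs_derivative m \<alpha> \<beta> R"
      u0 v0 u0' v0' T
    "m + (\<bar>\<alpha>\<bar> + 4 * \<bar>\<beta>\<bar>) * (R + 1)" B0
  proof
    fix B
    show "locally_lipschitz (\<lambda>z. truncated_rhs m \<alpha> \<beta> R (fst z) (snd z))"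
      by (rule truncated_rhs_locally_lipschitz)
    show "locally_lipschitz (\<lambda>z. truncated_rhs_derivative m \<alpha> \<beta> R (fst z) (fst (snd z))
        (fst (snd (snd z))) (snd (snd (snd z))))"
      by (rule truncated_rhs_derivative_locally_lipschitz)
    show "\<exists>L'\<ge>0. \<forall>a b p q. cmod a \<le> B \<longrightarrow> cmod b \<le> B \<longrightarrow>
      cmod (truncated_rhs_derivative m \<alpha> \<beta> R a b p q) \<le> L' * (cmod p + cmod q)"
      by (rule truncated_rhs_derivative_bound)
  next
    fix a b :: "real \<Rightarrow> complex" and p q x
    assume "(a has_vector_derivative p) (at x)" "(b has_vector_derivative q) (at x)"
    then show "((\<lambda>y. truncated_rhs m \<alpha> \<beta> R (a y) (b y)) has_vector_derivative
        truncated_rhs_derivative m \<alpha> \<beta> R (a x) (b x) p q) (at x)"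
      by (rule has_vector_derivative_truncated_rhs)
  next
    have "isCont (cutoff R) s" for s by (rule DERIV_isCont[OF DERIV_cutoff])
    then have c: "continuous_on UNIV (cutoff R)" by (simp add: continuous_at_imp_continuous_on)
    have c': "continuous_on UNIV (cutoff' R)"
      unfolding cutoff'_def[abs_def] ramp_def by (intro continuous_intros)
    fix S :: "(real \<times> real) set" and a b p q :: "real \<times> real \<Rightarrow> complex"
    assume ab: "continuous_on S a" "continuous_on S b"
    show "continuous_on S (\<lambda>z. truncated_rhs m \<alpha> \<beta> R (a z) (b z))"
      unfolding truncated_rhs_def dirac_rhs_def N1_monomials
      by (intro continuous_intros ab continuous_on_compose2[OF c]) auto
    assume pq: "continuous_on S p" "continuous_on S q"
    show "continuous_on S (\<lambda>z. truncated_rhs_derivative m \<alpha> \<beta> R (a z) (b z) (p z) (q z))"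
      unfolding truncated_rhs_derivative_def N1_derivative_def N1_monomials
      by (intro continuous_intros ab pq continuous_on_compose2[OF c] continuous_on_compose2[OF c']) auto
  qed (use assms R0 in \<open>auto intro: truncated_rhs_growth\<close>)
  obtain u ut ux v vt vx where u: "C1_strip T u ut ux" and v: "C1_strip T v vt vx" and init: "u 0 =
      u0" "v 0 = v0"
    and eq: "\<And>t x. t \<in> {0..T} \<Longrightarrow> ut t x + ux t x = truncated_rhs m \<alpha> \<beta> R (u t x) (v t x)"
      "\<And>t x. t \<in> {0..T} \<Longrightarrow> vt t x - vx t x = truncated_rhs m \<alpha> \<beta> R (v t x) (u t x)"
    using semilinear_transport_solution by auto
  define h where "h t x = cutoff R ((cmod (u t x))\<^sup>2 + (cmod (v t x))\<^sup>2)" for t x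
  have eqh: "ut t x + ux t x = dirac_rhs m \<alpha> \<beta> (h t x) (u t x) (v t x)"
    "vt t x - vx t x = dirac_rhs m \<alpha> \<beta> (h t x) (v t x) (u t x)" if "t \<in> {0..T}" for t x
    using eq[OF that, of x] unfolding truncated_rhs_def h_def by (simp_all add: add.commute)
  interpret P: charge_conserving_pair m K T u ut ux v vt vx
    unfolding K_def
    by (rule classical_solution_charge_conserving[OF m u v _ eqh]) (auto simp: h_def cutoff_range)
  have h1: "h t x = 1" if t: "t \<in> {0..T}" for t x
  proof -
    have M': "integral {x - t..x + t} (\<lambda>x. (cmod (u 0 x))\<^sup>2 + (cmod (v 0 x))\<^sup>2) \<le> M"
      unfolding init by (rule M)
    have *: "exp (m * T + K * M) * ((cmod z)\<^sup>2 + m * M / 2) \<le> R / 2" if "cmod z \<le> B0" for z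
      unfolding R_def using that by (simp add: power_mono)
    have "(cmod (u t x))\<^sup>2 \<le> R / 2"
      by (rule order_trans[OF P.pointwise_bound(1)[OF _ _ M']]) (use t init *[OF B0(1)] in auto)
    moreover have "(cmod (v t x))\<^sup>2 \<le> R / 2"
      by (rule order_trans[OF P.pointwise_bound(2)[OF _ _ M']]) (use t init *[OF B0(2)] in auto)
    ultimately have "(cmod (u t x))\<^sup>2 + (cmod (v t x))\<^sup>2 \<le> R" by linarith
    then show ?thesis unfolding h_def by (rule cutoff_eq_1)
  qed
  have "classical_solution m \<alpha> \<beta> T u v"
    unfolding classical_solution_iff using u v eqh h1 by (intro exI[of _ ut] exI[of _ ux] exI[of _
        vt] exI[of _ vx]) auto
  then show ?thesis using init by blast
qed

lemma C1_strip_mono: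
  assumes "C1_strip T f ft fx" "S \<le> T"
  shows "C1_strip S f ft fx"
proof -
  have "{0..S} \<subseteq> {0..T}" "{0..S} \<times> (UNIV :: real set) \<subseteq> {0..T} \<times> UNIV" using assms(2) by auto
  then show ?thesis
    using assms(1) unfolding C1_strip_def
    by (auto intro: continuous_on_subset has_vector_derivative_within_subset)
qed

lemma C1_strip_cong:
  assumes "C1_strip T f ft fx" and eq: "\<And>t x. t \<in> {0..T} \<Longrightarrow> g t x = f t x"
  shows "C1_strip T g ft fx"
  unfolding C1_strip_def
proof (intro conjI ballI allI)
  show "continuous_on ({0..T} \<times> UNIV) (\<lambda>(t, x). g t x)"
    by (rule continuous_on_eq[OF C1_stripD(1)[OF assms(1)]]) (use eq in auto)
  fix t x assume t: "t \<in> {0..T}"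
  show "((\<lambda>s. g s x) has_vector_derivative ft t x) (at t within {0..T})"
    by (rule has_vector_derivative_transform[OF t _ C1_stripD(4)[OF assms(1) t]]) (use eq in auto)
  have "g t = f t" using eq[OF t] by auto
  then show "(g t has_vector_derivative fx t x) (at x)"
    using C1_stripD(5)[OF assms(1) t] by simp
qed (use C1_stripD(2,3)[OF assms(1)] in auto)

lemma classical_solution_mono_cong:
  assumes "classical_solution m \<alpha> \<beta> T u v" "S \<le> T"
    and "\<And>t x. t \<in> {0..S} \<Longrightarrow> u' t x = u t x \<and> v' t x = v t x"
  shows "classical_solution m \<alpha> \<beta> S u' v'"
proof -
  obtain ut ux vt vx where *: "C1_strip T u ut ux" "C1_strip T v vt vx"
    "\<And>t x. t \<in> {0..T} \<Longrightarrow> ut t x + ux t x = dirac_rhs m \<alpha> \<beta> 1 (u t x) (v t x)"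
    "\<And>t x. t \<in> {0..T} \<Longrightarrow> vt t x - vx t x = dirac_rhs m \<alpha> \<beta> 1 (v t x) (u t x)"
    by (rule classical_solutionE[OF assms(1)]) (rule that)
  have "C1_strip S u' ut ux" "C1_strip S v' vt vx"
    by (rule C1_strip_cong[OF C1_strip_mono[OF *(1) assms(2)]] C1_strip_cong[OF C1_strip_mono[OF
        *(2) assms(2)]];
        use assms(3) in auto)+
  then show ?thesis
    unfolding classical_solution_iff using *(3,4) assms(2,3)
    by (intro exI[of _ ut] exI[of _ ux] exI[of _ vt] exI[of _ vx]) auto
qed

lemma continuous_integral_zero_imp_zero:
  fixes f :: "real \<Rightarrow> real"
  assumes "continuous_on UNIV f" "\<And>x. 0 \<le> f x" "integral {a..b} f \<le> 0" "x \<in> {a<..<b}"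
  shows "f x = 0"
proof -
  have c: "continuous_on (cbox a b) f" by (rule continuous_on_subset[OF assms(1)]) simp
  have i: "f integrable_on {a..b}" using integrable_continuous_interval c by simp
  have "integral {a..b} f = 0" using integral_nonneg[OF i] assms(2,3) by force
  then have "(f has_integral 0) (cbox a b)" using integrable_integral[OF i] by simp
  from has_integral_0_cbox_imp_0[OF c _ this] show ?thesis using assms(2,4) by auto
qed

text \<open>Stability on a cone that is wide enough to contain \<open>(t,x)\<close> in the interior of its last
  slice.\<close>

lemma classical_solution_unique:
  assumes m: "0 \<le> m" and T: "0 \<le> T"
    and sol: "classical_solution m \<alpha> \<beta> T u v" "classical_solution m \<alpha> \<beta> T u' v'"
    and init: "u' 0 = u 0" "v' 0 = v 0"
    and M: "\<And>R. 0 \<le> R \<Longrightarrow> integral {-R..R} (\<lambda>x. (cmod (u 0 x))\<^sup>2 + (cmod (v 0 x))\<^sup>2) \<le> M"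
    and t: "t \<in> {0..T}"
  shows "u' t x = u t x \<and> v' t x = v t x"
proof -
  obtain ut ux vt vx where u: "C1_strip T u ut ux" and v: "C1_strip T v vt vx"
    by (rule classical_solutionE[OF sol(1)]) (rule that)
  obtain ut' ux' vt' vx' where u': "C1_strip T u' ut' ux'" and v': "C1_strip T v' vt' vx'"
    by (rule classical_solutionE[OF sol(2)]) (rule that)
  note sl = C1_strip_slice(1)[OF u] C1_strip_slice(1)[OF v] C1_strip_slice(1)[OF u']
      C1_strip_slice(1)[OF v']
  note cc = C1_strip_continuous(1)[OF u] C1_strip_continuous(1)[OF v] C1_strip_continuous(1)[OF u']
      C1_strip_continuous(1)[OF v']
  let ?f = "\<lambda>x. (cmod (u t x - u' t x))\<^sup>2 + (cmod (v t x - v' t x))\<^sup>2"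
  let ?g = "\<lambda>s x. (cmod (u s x - u' s x))\<^sup>2 * (cmod (v s x))\<^sup>2"
  have M': "integral {-R..R} (\<lambda>x. (cmod (u' 0 x))\<^sup>2 + (cmod (v' 0 x))\<^sup>2) \<le> M" if "0 \<le> R" for R
    unfolding init by (rule M[OF that])
  have "integral {x - (t + 1 - t)..x + (t + 1 - t)} ?f
      + integral {0..t} (\<lambda>s. integral {x - (t + 1 - s)..x + (t + 1 - s)} (?g s)) \<le> 0"
    using stability_on_cone[OF m T sol M M' refl refl refl refl, of t "t + 1" x] t by (simp add: init)
  moreover have "0 \<le> integral {0..t} (\<lambda>s. integral {x - (t + 1 - s)..x + (t + 1 - s)} (?g s))"
  proof (rule integral_nonneg)
    show "(\<lambda>s. integral {x - (t + 1 - s)..x + (t + 1 - s)} (?g s)) integrable_on {0..t}"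
      by (rule integrable_continuous_interval cone_slice_integral_continuous)+
        (use t in \<open>auto simp: case_prod_beta intro!: continuous_intros cc\<close>)
    fix s assume "s \<in> {0..t}"
    then show "0 \<le> integral {x - (t + 1 - s)..x + (t + 1 - s)} (?g s)"
      using t by (intro integral_nonneg integrable_continuous_interval continuous_intros sl) auto
  qed
  ultimately have "integral {x - (t + 1 - t)..x + (t + 1 - t)} ?f \<le> 0" by linarith
  then have "?f x = 0"
    by (rule continuous_integral_zero_imp_zero[rotated 2]) (use t in \<open>auto intro!: continuous_intros
        sl\<close>)
  then show ?thesis by (simp add: add_nonneg_eq_0_iff)
qed

text \<open>For each \<open>k\<close> there is a solution on \<open>[0, k + 1]\<close>; by uniqueness they agree where two of them
  are defined. At time \<open>t\<close> the one on \<open>[0, \<lceil>t\<rceil> + 1]\<close> is used.\<close>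

lemma global_classical_solution:
  assumes m: "0 \<le> m"
    and u0: "\<And>x. (u0 has_vector_derivative u0' x) (at x)" "continuous_on UNIV u0'"
    and v0: "\<And>x. (v0 has_vector_derivative v0' x) (at x)" "continuous_on UNIV v0'"
    and B0: "\<And>x. cmod (u0 x) \<le> B0" "\<And>x. cmod (v0 x) \<le> B0" "\<And>x. cmod (u0' x) \<le>
        B0" "\<And>x. cmod (v0' x) \<le> B0"
    and M: "\<And>a b. integral {a..b} (\<lambda>x. (cmod (u0 x))\<^sup>2 + (cmod (v0 x))\<^sup>2) \<le> M"
  obtains u v where "\<And>T. classical_solution m \<alpha> \<beta> T u v" "u 0 = u0" "v 0 = v0"
proof -
  have "\<exists>w. classical_solution m \<alpha> \<beta> (real k + 1) (fst w) (snd w) \<and> fst w 0 = u0 \<and> snd w 0 = v0" for k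
    using C1_bounded_data_solution[OF m _ u0 v0 B0 M, of "real k + 1"] by auto
  then obtain w where w: "\<And>k. classical_solution m \<alpha> \<beta> (real k + 1) (fst (w k)) (snd (w k))"
    "\<And>k. fst (w k) 0 = u0" "\<And>k. snd (w k) 0 = v0" by metis
  define u where "u t = fst (w (nat \<lceil>t\<rceil>)) t" for t
  define v where "v t = snd (w (nat \<lceil>t\<rceil>)) t" for t
  have agree: "u t x = fst (w k) t x \<and> v t x = snd (w k) t x" if t: "t \<in> {0..real k}" for t x k
  proof -
    define j where "j = nat \<lceil>t\<rceil>"
    have j: "t \<le> real j" "j \<le> k" using t unfolding j_def by (auto simp: ceiling_le_iff) 
    have 1: "classical_solution m \<alpha> \<beta> (real j + 1) (fst (w k)) (snd (w k))"
      by (rule classical_solution_mono_cong[OF w(1)[of k]]) (use j in auto)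
    show ?thesis
      unfolding u_def v_def j_def[symmetric]
      by (rule classical_solution_unique[OF m _ 1 w(1)[of j], where M = M]) (use w M t j in auto)
  qed
  show ?thesis
  proof (rule that)
    show "classical_solution m \<alpha> \<beta> T u v" for T
    proof (rule classical_solution_mono_cong[OF w(1)[of "nat \<lceil>T\<rceil>"]])
      show "T \<le> real (nat \<lceil>T\<rceil>) + 1" by linarith
      fix t x assume t: "t \<in> {0..T}"
      then have "t \<le> real (nat \<lceil>T\<rceil>)"
        by (meson atLeastAtMost_iff order_trans real_nat_ceiling_ge)
      then have "t \<in> {0..real (nat \<lceil>T\<rceil>)}" using t by (simp only: atLeastAtMost_iff)
      then show "u t x = fst (w (nat \<lceil>T\<rceil>)) t x \<and> v t x = snd (w (nat \<lceil>T\<rceil>)) t x" by (rule agree)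
    qed
    show "u 0 = u0" "v 0 = v0" by (auto simp: u_def v_def w)
  qed
qed

section \<open>The space of square-integrable functions\<close>

text \<open>The squared \<open>L\<^sup>2\<close> norm with values in \<open>[0,\<infinity>]\<close>. It avoids integrability side conditions in
  Fatou's lemma, dominated convergence and Tonelli's theorem, at the price of factors 2 in the
  triangle inequality.\<close>

definition sqnorm :: "'a::euclidean_space set \<Rightarrow> ('a \<Rightarrow> 'b::euclidean_space) \<Rightarrow> ennreal" where
  "sqnorm S f = (\<integral>\<^sup>+x. ennreal ((norm (f x))\<^sup>2) \<partial>lebesgue_on S)"

lemma L2_iff_sqnorm:
  "L2 S f \<longleftrightarrow> f \<in> borel_measurable (lebesgue_on S) \<and> sqnorm S f < \<infinity>"
proof -
  have "integrable (lebesgue_on S) (\<lambda>x. (norm (f x))\<^sup>2) \<longleftrightarrow> sqnorm S f < \<infinity>"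
    if [measurable]: "f \<in> borel_measurable (lebesgue_on S)"
    unfolding integrable_iff_bounded sqnorm_def by simp
  then show ?thesis unfolding L2_def by blast
qed

lemma L2_norm_eq_sqnorm:
  assumes [measurable]: "f \<in> borel_measurable (lebesgue_on S)"
  shows "L2_norm S f = sqrt (enn2real (sqnorm S f))"
  unfolding L2_norm_def sqnorm_def by (subst integral_eq_nn_integral) auto

lemma sqnorm_eq_L2_norm:
  assumes "L2 S f"
  shows "sqnorm S f = ennreal ((L2_norm S f)\<^sup>2)"
  using assms unfolding L2_iff_sqnorm by (simp add: L2_norm_eq_sqnorm)

lemma L2_norm_tendsto_0:
  assumes "\<And>n. f n \<in> borel_measurable (lebesgue_on S)" and "((\<lambda>n. sqnorm S (f n)) \<longlongrightarrow> 0) F"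
  shows "((\<lambda>n. L2_norm S (f n)) \<longlongrightarrow> 0) F"
  unfolding L2_norm_eq_sqnorm[OF assms(1)]
  using tendsto_real_sqrt[OF tendsto_enn2real[of "\<lambda>n. sqnorm S (f n)" 0 F]] assms(2) by simp

lemma sqnorm_tendsto_0:
  assumes "\<forall>\<^sub>F n in F. L2 S (f n)" and "((\<lambda>n. L2_norm S (f n)) \<longlongrightarrow> 0) F"
  shows "((\<lambda>n. sqnorm S (f n)) \<longlongrightarrow> 0) F"
proof -
  have "((\<lambda>n. ennreal ((L2_norm S (f n))\<^sup>2)) \<longlongrightarrow> ennreal (0\<^sup>2)) F"
    by (intro tendsto_ennrealI tendsto_intros assms(2))
  moreover have "\<forall>\<^sub>F n in F. ennreal ((L2_norm S (f n))\<^sup>2) = sqnorm S (f n)"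
    using assms(1) by eventually_elim (simp add: sqnorm_eq_L2_norm)
  ultimately show ?thesis using tendsto_cong by fastforce
qed

lemma sqnorm_add_le:
  assumes [measurable]: "f \<in> borel_measurable (lebesgue_on S)" "g \<in> borel_measurable (lebesgue_on S)"
  shows "sqnorm S (\<lambda>x. f x + g x) \<le> 2 * sqnorm S f + 2 * sqnorm S g"
proof -
  have "(norm (f x + g x))\<^sup>2 \<le> 2 * (norm (f x))\<^sup>2 + 2 * (norm (g x))\<^sup>2" for x
  proof -
    have "(norm (f x + g x))\<^sup>2 \<le> (norm (f x) + norm (g x))\<^sup>2"
      by (intro power_mono norm_triangle_ineq) auto
    also have "\<dots> \<le> 2 * (norm (f x))\<^sup>2 + 2 * (norm (g x))\<^sup>2"
      using sum_squares_bound[of "norm (f x)" "norm (g x)"] by (simp add: power2_sum)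
    finally show ?thesis .
  qed
  then have "sqnorm S (\<lambda>x. f x + g x) \<le> (\<integral>\<^sup>+x. 2 * ennreal ((norm (f x))\<^sup>2) +
      2 * ennreal ((norm (g x))\<^sup>2) \<partial>lebesgue_on S)"
    unfolding sqnorm_def
    by (intro nn_integral_mono) (simp add: ennreal_mult'[symmetric] flip: ennreal_plus ennreal_numeral)
  also have "\<dots> = 2 * sqnorm S f + 2 * sqnorm S g"
    unfolding sqnorm_def by (simp add: nn_integral_add nn_integral_cmult)
  finally show ?thesis .
qed

lemma sqnorm_minus_commute: "sqnorm S (\<lambda>x. f x - g x) = sqnorm S (\<lambda>x. g x - f x)"
  unfolding sqnorm_def by (simp add: norm_minus_commute)

lemma sqnorm_triangle:
  assumes [measurable]: "f \<in> borel_measurable (lebesgue_on S)" "g \<in> borel_measurable (lebesgue_on S)"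
    "h \<in> borel_measurable (lebesgue_on S)"
  shows "sqnorm S (\<lambda>x. f x - h x) \<le> 2 * sqnorm S (\<lambda>x. f x - g x) + 2 * sqnorm S (\<lambda>x. g x - h x)"
  using sqnorm_add_le[of "\<lambda>x. f x - g x" S "\<lambda>x. g x - h x"] by simp

lemma tendsto_0_ennrealI:
  fixes f :: "'a \<Rightarrow> ennreal"
  assumes "\<And>e. 0 < e \<Longrightarrow> \<forall>\<^sub>F n in F. f n \<le> ennreal e"
  shows "(f \<longlongrightarrow> 0) F"
proof (rule order_tendstoI)
  fix a :: ennreal assume "0 < a"
  then obtain b where b: "0 < b" "b < a" using dense by blast
  then obtain e where e: "b = ennreal e" "0 < e"
    by (cases b) (auto simp: ennreal_less_zero_iff)
  show "\<forall>\<^sub>F n in F. f n < a"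
    using assms[OF e(2)] by eventually_elim (use b e in auto)
qed auto

lemma tendsto_0_ennrealD:
  fixes f :: "'a \<Rightarrow> ennreal"
  assumes "(f \<longlongrightarrow> 0) F" "0 < e"
  shows "\<forall>\<^sub>F n in F. f n \<le> ennreal e"
  using order_tendstoD(2)[OF assms(1), of "ennreal e"] assms(2) by (auto elim: eventually_mono)

lemma sqnorm_dominated:
  fixes h :: "nat \<Rightarrow> real \<Rightarrow> complex" and w :: "real \<Rightarrow> ennreal"
  assumes [measurable]: "\<And>n. h n \<in> borel_measurable lebesgue" "w \<in> borel_measurable lebesgue"
    and bound: "\<And>n x. ennreal ((norm (h n x))\<^sup>2) \<le> w x" and w: "(\<integral>\<^sup>+x. w x \<partial>lebesgue) < \<infinity>"
    and lim: "AE x in lebesgue. (\<lambda>n. h n x) \<longlonglongrightarrow> 0"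
  shows "(\<lambda>n. sqnorm UNIV (h n)) \<longlonglongrightarrow> 0"
proof -
  have "(\<lambda>n. \<integral>\<^sup>+x. ennreal ((norm (h n x))\<^sup>2) \<partial>lebesgue) \<longlonglongrightarrow> (\<integral>\<^sup>+x. 0 \<partial>(lebesgue :: real measure))"
  proof (rule nn_integral_dominated_convergence[where w = w])
    show "AE x in lebesgue. (\<lambda>n. ennreal ((norm (h n x))\<^sup>2)) \<longlonglongrightarrow> 0"
      using lim
    proof eventually_elim
      case (elim x)
      have "(\<lambda>n. ennreal ((norm (h n x))\<^sup>2)) \<longlonglongrightarrow> ennreal ((norm (0 :: complex))\<^sup>2)"
        by (intro tendsto_ennrealI tendsto_intros elim)
      then show ?case by simp
    qed
  qed (use bound w in auto)
  then show ?thesis by (simp add: sqnorm_def lebesgue_on_UNIV_eq)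
qed

lemma continuous_imp_measurable_lebesgue:
  fixes f :: "'a::euclidean_space \<Rightarrow> 'b::euclidean_space"
  assumes "continuous_on UNIV f"
  shows "f \<in> borel_measurable lebesgue"
  using borel_measurable_continuous_onI[OF assms] by (rule measurable_completion[of _ lborel borel,
      simplified])

lemma interval_weight:
  fixes a b c :: real
  shows "(\<lambda>x. ennreal c * indicator {a..b} x) \<in> borel_measurable lebesgue"
    and "(\<integral>\<^sup>+x. ennreal c * indicator {a..b} x \<partial>lebesgue) < \<infinity>"
proof -
  show "(\<lambda>x. ennreal c * indicator {a..b} x) \<in> borel_measurable lebesgue"
    by (rule measurable_completion[of _ lborel borel, simplified]) measurable
  have "(\<integral>\<^sup>+x. ennreal c * indicator {a..b} x \<partial>lebesgue) = ennreal c * emeasure lebesgue {a..b}"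
    by (rule nn_integral_cmult_indicator) simp
  then show "(\<integral>\<^sup>+x. ennreal c * indicator {a..b} x \<partial>lebesgue) < \<infinity>"
    by (cases "a \<le> b") (auto simp: ennreal_mult_less_top)
qed

text \<open>The moving averages of \<open>c\<close> over intervals of length \<open>1 / (n + 1)\<close>, written as difference
  quotients of an antiderivative.\<close>

lemma averages:
  fixes c :: "real \<Rightarrow> complex" and k R :: real
  assumes c: "continuous_on UNIV c" and k: "\<And>x. cmod (c x) \<le> k" and R: "\<And>x. R < \<bar>x\<bar> \<Longrightarrow> c x = 0"
  obtains g g' :: "nat \<Rightarrow> real \<Rightarrow> complex" where
    "\<And>n x. (g n has_vector_derivative g' n x) (at x)" "\<And>n. continuous_on UNIV (g' n)"
    "\<And>n x. cmod (g n x) \<le> k" "\<And>n x. cmod (g' n x) \<le> real (Suc n) * (2 * k)"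
    "\<And>n x. R + 1 < \<bar>x\<bar> \<Longrightarrow> g n x = 0" "\<And>x. (\<lambda>n. g n x) \<longlonglongrightarrow> c x"
proof -
  obtain G where "\<forall>x. -\<infinity> < ereal x \<longrightarrow> ereal x < \<infinity> \<longrightarrow> (G has_vector_derivative c x) (at x)"
    using einterval_antiderivative[of "-\<infinity>" "\<infinity>" c] c by (auto simp: continuous_on_eq_continuous_at)
  then have G: "(G has_vector_derivative c x) (at x)" for x by simp
  define h where "h n = 1 / real (Suc n)" for n
  have h: "0 < h n" "h n \<le> 1" for n by (auto simp: h_def)
  define g where "g n x = real (Suc n) *\<^sub>R (G (x + h n) - G x)" for n x
  define g' where "g' n x = real (Suc n) *\<^sub>R (c (x + h n) - c x)" for n x
  have k0: "0 \<le> k" using k[of 0] norm_ge_zero order_trans by blast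
  have ftc: "(c has_integral G (x + h n) - G x) {x..x + h n}" for n x
    by (rule fundamental_theorem_of_calculus) (use h[of n]
        in \<open>auto intro: has_vector_derivative_at_within G\<close>)
  show ?thesis
  proof (rule that[of g g'])
    fix n x
    have "(G \<circ> (\<lambda>x. x + h n) has_vector_derivative 1 *\<^sub>R c (x + h n)) (at x)"
      by (rule vector_diff_chain_at) (auto intro!: derivative_eq_intros G)
    then have "((\<lambda>x. G (x + h n)) has_vector_derivative c (x + h n)) (at x)" by (simp add: o_def)
    then show "(g n has_vector_derivative g' n x) (at x)"
      unfolding g_def[abs_def] g'_def
      by (intro bounded_linear.has_vector_derivative[OF bounded_linear_scaleR_right]
          has_vector_derivative_diff G)
    show "continuous_on UNIV (g' n)"
      unfolding g'_def[abs_def] by (intro continuous_intros continuous_on_compose2[OF c]) auto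
    have "norm (G (x + h n) - G x) \<le> k * measure lborel (cbox x (x + h n))"
      by (rule has_integral_bound[OF k0, of c]) (use ftc k in auto)
    then have "norm (G (x + h n) - G x) \<le> k * h n" using h[of n] by simp
    then have "real (Suc n) * norm (G (x + h n) - G x) \<le> real (Suc n) * (k * h n)"
        by (intro mult_left_mono) auto
    then show "cmod (g n x) \<le> k" unfolding g_def h_def by simp
    have "norm (c (x + h n) - c x) \<le> 2 * k" using norm_triangle_ineq4[of "c (x + h n)"
        "c x"] k[of x] k[of "x + h n"] by linarith
    then show "cmod (g' n x) \<le> real (Suc n) * (2 * k)" unfolding g'_def norm_scaleR
        by (simp add: mult_left_mono)
    show "g n x = 0" if x: "R + 1 < \<bar>x\<bar>"
    proof -
      have "c y = 0" if "y \<in> {x..x + h n}" for y using x that h[of n] by (intro R) auto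
      then have "((\<lambda>_. 0) has_integral G (x + h n) - G x) {x..x + h n}"
          by (intro has_integral_eq[OF _ ftc]) auto
      then have "G (x + h n) - G x = 0" using has_integral_unique has_integral_0 by blast
      then show ?thesis by (simp add: g_def)
    qed
    show "(\<lambda>n. g n x) \<longlonglongrightarrow> c x"
    proof -
      have "(\<lambda>e. norm (G (x + e) - G x - e *\<^sub>R c x) / norm e) \<midarrow>0\<rightarrow> 0"
        using G[of x] by (simp add: has_vector_derivative_def has_derivative_at)
      moreover have "h \<longlonglongrightarrow> 0" unfolding h_def using LIMSEQ_inverse_real_of_nat
          by (simp add: inverse_eq_divide)
      then have "filterlim h (at 0) sequentially"
        by (rule filterlim_atI) (use h in \<open>auto intro!: always_eventually simp:
            less_imp_neq[symmetric]\<close>)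
      ultimately have "(\<lambda>n. norm (G (x + h n) - G x - h n *\<^sub>R c x) / norm (h n)) \<longlonglongrightarrow> 0"
        by (rule filterlim_compose)
      moreover have "norm (G (x + h n) - G x - h n *\<^sub>R c x) / norm (h n) = norm (g n x - c x)" for n
      proof -
        have "g n x - c x = real (Suc n) *\<^sub>R (G (x + h n) - G x - h n *\<^sub>R c x)"
          unfolding g_def h_def by (simp add: scaleR_diff_right)
        then show ?thesis unfolding h_def by (simp add: mult.commute)
      qed
      ultimately have "(\<lambda>n. norm (g n x - c x)) \<longlonglongrightarrow> 0" by simp
      from LIM_zero_cancel[OF tendsto_norm_zero_cancel[OF this]] show ?thesis .
    qed
  qed
qed

text \<open>Three steps, each by dominated convergence: cut \<open>f\<close> off in space and amplitude; approximate
  the result almost everywhere by continuous functions, which exist by measurability and which may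
  be projected to the same amplitude and multiplied by a bump; smooth these by averaging.\<close>

lemma C1_compact_support_dense:
  fixes f :: "real \<Rightarrow> complex"
  assumes f: "L2 UNIV f" and e: "0 < e"
  shows "\<exists>g g' B R. (\<forall>x. (g has_vector_derivative g' x) (at x)) \<and> continuous_on UNIV g' \<and>
     (\<forall>x. cmod (g x) \<le> B) \<and> (\<forall>x. cmod (g' x) \<le> B) \<and> (\<forall>x. R < \<bar>x\<bar> \<longrightarrow> g x = 0) \<and>
     sqnorm UNIV (\<lambda>x. f x - g x) \<le> ennreal e"
proof -
  have fm[measurable]: "f \<in> borel_measurable lebesgue" and fin:
      "(\<integral>\<^sup>+x. ennreal ((norm (f x))\<^sup>2) \<partial>lebesgue) < \<infinity>"
    using f unfolding L2_iff_sqnorm sqnorm_def by (simp_all add: lebesgue_on_UNIV_eq)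
  define d where "d = e / 10"
  have d: "0 < d" using e by (simp add: d_def)
  define fk where "fk k x = (if \<bar>x\<bar> \<le> real k \<and> cmod (f x) \<le> real k then f x else 0)" for k x
  have [measurable]: "fk k \<in> borel_measurable lebesgue" for k
  proof -
    have [measurable]: "(\<lambda>x::real. x) \<in> borel_measurable lebesgue"
        by (rule continuous_imp_measurable_lebesgue) simp
    show ?thesis unfolding fk_def[abs_def] by measurable
  qed
  have "(\<lambda>k. sqnorm UNIV (\<lambda>x. f x - fk k x)) \<longlonglongrightarrow> 0"
  proof (rule sqnorm_dominated[where w = "\<lambda>x. ennreal ((norm (f x))\<^sup>2)"])
    show "AE x in lebesgue. (\<lambda>k. f x - fk k x) \<longlonglongrightarrow> 0"
    proof (rule AE_I2)
      fix x
      have "\<forall>\<^sub>F k in sequentially. max \<bar>x\<bar> (cmod (f x)) \<le> real k"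
        using eventually_ge_at_top[of "nat \<lceil>max \<bar>x\<bar> (cmod (f x))\<rceil>"]
        by (rule eventually_mono) (meson of_nat_le_iff order_trans real_nat_ceiling_ge)
      then have "\<forall>\<^sub>F k in sequentially. f x - fk k x = 0"
        by (rule eventually_mono) (simp add: fk_def)
      then show "(\<lambda>k. f x - fk k x) \<longlonglongrightarrow> 0" by (rule tendsto_eventually)
    qed
    show "(\<lambda>x. f x - fk k x) \<in> borel_measurable lebesgue" for k by measurable
  qed (use fin in \<open>auto simp: fk_def\<close>)
  from eventually_happens[OF tendsto_0_ennrealD[OF this d]]
  obtain k where k: "sqnorm UNIV (\<lambda>x. f x - fk k x) \<le> ennreal d" by auto
  \<comment> \<open>Equal to 1 on \<open>[-k, k]\<close> and supported in \<open>[-k - 1, k + 1]\<close>.\<close>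
  define bump where "bump x = max 0 (min 1 (real k + 1 - \<bar>x\<bar>))" for x :: real
  define P where "P = closest_point (cball (0 :: complex) (real k))"
  have P: "continuous_on UNIV P" "\<And>z. cmod (P z) \<le> real k" "\<And>z. cmod z \<le> real k \<Longrightarrow> P z = z"
  proof -
    show "continuous_on UNIV P" unfolding P_def by (rule continuous_on_closest_point) auto
    show "cmod (P z) \<le> real k" for z
      using closest_point_in_set[of "cball (0 :: complex) (real k)" z] unfolding P_def by auto
    show "P z = z" if "cmod z \<le> real k" for z unfolding P_def using that
        by (intro closest_point_self) auto
  qed
  have "fk k measurable_on UNIV"
    by (rule lebesgue_measurable_imp_measurable_on) (auto simp: lebesgue_on_UNIV_eq)
  then obtain N q where N: "negligible N" and q: "\<And>n. continuous_on UNIV (q n)"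
    "\<And>x. x \<notin> N \<Longrightarrow> (\<lambda>n. q n x) \<longlonglongrightarrow> fk k x"
    unfolding measurable_on_def by auto
  define c where "c n x = bump x *\<^sub>R P (q n x)" for n x
  have cc: "continuous_on UNIV (c n)" for n
    unfolding c_def[abs_def] bump_def
    by (intro continuous_intros continuous_on_compose2[OF P(1)] q) auto
  have ck: "cmod (c n x) \<le> real k" for n x
  proof -
    have "bump x * cmod (P (q n x)) \<le> 1 * real k" unfolding bump_def by (intro mult_mono P) auto
    moreover have "0 \<le> bump x" by (simp add: bump_def)
    ultimately show ?thesis by (simp add: c_def)
  qed
  have c0: "c n x = 0" if "real k + 1 < \<bar>x\<bar>" for n x
    using that by (simp add: c_def bump_def)
  have fk0: "fk k x = 0" if "real k < \<bar>x\<bar>" for x using that by (simp add: fk_def)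
  have fkk: "cmod (fk k x) \<le> real k" for x by (simp add: fk_def)
  have [measurable]: "c n \<in> borel_measurable lebesgue" for n
      by (rule continuous_imp_measurable_lebesgue[OF cc])
  have bd: "ennreal ((cmod (a - b))\<^sup>2) \<le> ennreal ((2 * real k)\<^sup>2)" if "cmod a \<le> real k" "cmod b \<le>
      real k" for a b
    using that norm_triangle_ineq4[of a b] by (intro ennreal_leI power_mono) auto
  have "(\<lambda>n. sqnorm UNIV (\<lambda>x. fk k x - c n x)) \<longlonglongrightarrow> 0"
  proof (rule sqnorm_dominated[OF _ interval_weight(1) _ interval_weight(2)])
    show "ennreal ((cmod (fk k x - c n x))\<^sup>2) \<le> ennreal ((2 * real k)\<^sup>2) * indicator {- (real k +
        1)..real k + 1} x" for n x
      using bd[OF fkk[of x] ck[of n x]] c0[of x n] fk0[of x] by (cases "\<bar>x\<bar> \<le>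
          real k + 1") (auto simp: indicator_def abs_le_iff)
    have "N \<in> null_sets lebesgue" using N by (simp add: negligible_iff_null_sets)
    then have "AE x in lebesgue. x \<notin> N" by (rule AE_not_in)
    then show "AE x in lebesgue. (\<lambda>n. fk k x - c n x) \<longlonglongrightarrow> 0"
    proof eventually_elim
      case (elim x)
      have "isCont P (fk k x)" using P(1) by (simp add: continuous_on_eq_continuous_at)
      then have "(\<lambda>n. P (q n x)) \<longlonglongrightarrow> P (fk k x)" using q(2)[OF elim] isCont_tendsto_compose by blast
      then have "(\<lambda>n. fk k x - c n x) \<longlonglongrightarrow> fk k x - bump x *\<^sub>R P (fk k x)"
        unfolding c_def by (intro tendsto_intros)
      moreover have "fk k x - bump x *\<^sub>R P (fk k x) = 0"
        using P(3)[OF fkk[of x]] fk0[of x] by (cases "\<bar>x\<bar> \<le> real k") (auto simp: bump_def)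
      ultimately show ?case by simp
    qed
  qed measurable
  from eventually_happens[OF tendsto_0_ennrealD[OF this d]]
  obtain n where n: "sqnorm UNIV (\<lambda>x. fk k x - c n x) \<le> ennreal d" by auto
  obtain g g' where g: "\<And>j x. (g j has_vector_derivative g' j x) (at x)" "\<And>j. continuous_on UNIV (g' j)"
    "\<And>j x. cmod (g j x) \<le> real k" "\<And>j x. cmod (g' j x) \<le> real (Suc j) * (2 * real k)"
    "\<And>j x. real k + 1 + 1 < \<bar>x\<bar> \<Longrightarrow> g j x = 0" "\<And>x. (\<lambda>j. g j x) \<longlonglongrightarrow> c n x"
    by (rule averages[of "c n" "real k" "real k + 1", OF cc ck]) (erule c0, rule that)
  have gm[measurable]: "g j \<in> borel_measurable lebesgue" for j
    by (rule continuous_imp_measurable_lebesgue)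
      (use g(1) in \<open>auto intro!: continuous_at_imp_continuous_on has_vector_derivative_continuous\<close>)
  have "(\<lambda>j. sqnorm UNIV (\<lambda>x. c n x - g j x)) \<longlonglongrightarrow> 0"
  proof (rule sqnorm_dominated[OF _ interval_weight(1) _ interval_weight(2)])
    show "ennreal ((cmod (c n x - g j x))\<^sup>2) \<le> ennreal ((2 * real k)\<^sup>2) * indicator {- (real k +
        2)..real k + 2} x" for j x
      using bd[OF ck[of n x] g(3)[of j x]] c0[of x n] g(5)[of x j] by (cases "\<bar>x\<bar> \<le>
          real k + 2") (auto simp: indicator_def abs_le_iff)
    show "AE x in lebesgue. (\<lambda>j. c n x - g j x) \<longlonglongrightarrow> 0"
      using tendsto_diff[OF tendsto_const g(6)] by (intro AE_I2) (metis diff_self)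
  qed measurable
  from eventually_happens[OF tendsto_0_ennrealD[OF this d]]
  obtain j where j: "sqnorm UNIV (\<lambda>x. c n x - g j x) \<le> ennreal d" by auto
  have [simp]: "lebesgue_on (UNIV :: real set) = lebesgue" by (rule lebesgue_on_UNIV_eq)
  have "sqnorm UNIV (\<lambda>x. f x - g j x) \<le> 2 * sqnorm UNIV (\<lambda>x. f x - fk k x) +
      2 * sqnorm UNIV (\<lambda>x. fk k x - g j x)"
    by (rule sqnorm_triangle) simp_all
  also have "\<dots> \<le> 2 * sqnorm UNIV (\<lambda>x. f x - fk k x) + 2 * (2 * sqnorm UNIV (\<lambda>x. fk k x - c n x) +
      2 * sqnorm UNIV (\<lambda>x. c n x - g j x))"
    by (intro add_left_mono mult_left_mono sqnorm_triangle) simp_all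
  also have "\<dots> \<le> 2 * ennreal d + 2 * (2 * ennreal d + 2 * ennreal d)"
    by (intro add_mono mult_left_mono k n j) simp_all
  also have "\<dots> = ennreal e"
    using d unfolding d_def by (simp flip: ennreal_plus ennreal_numeral ennreal_mult')
  finally have "sqnorm UNIV (\<lambda>x. f x - g j x) \<le> ennreal e" .
  moreover have "cmod (g j x) \<le> real (Suc j) * (2 * real k)" for x
  proof -
    have "1 * real k \<le> real (Suc j) * (2 * real k)" by (intro mult_mono) auto
    then show ?thesis using g(3)[of j x] by linarith
  qed
  ultimately show ?thesis using g(1,2,4,5)
    by (intro exI[of _ "g j"] exI[of _ "g' j"] exI[of _ "real (Suc j) * (2 * real k)"] exI[of _
        "real k + 1 + 1"]) auto
qed

section \<open>Stability in \<open>L\<^sup>2\<close>\<close>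

lemma sqnorm_lborel: "sqnorm UNIV f = (\<integral>\<^sup>+x. ennreal ((norm (f x))\<^sup>2) \<partial>lborel)"
  unfolding sqnorm_def lebesgue_on_UNIV_eq nn_integral_completion ..

lemma sqnorm_add_eq:
  assumes "continuous_on UNIV f" "continuous_on UNIV g"
  shows "sqnorm UNIV f + sqnorm UNIV g = (\<integral>\<^sup>+x. ennreal ((norm (f x))\<^sup>2 + (norm (g x))\<^sup>2) \<partial>lborel)"
proof -
  have [measurable]: "f \<in> borel_measurable borel" "g \<in> borel_measurable borel"
    using assms by (auto intro: borel_measurable_continuous_onI)
  show ?thesis unfolding sqnorm_lborel by (subst nn_integral_add[symmetric]) auto
qed

lemma nn_integral_interval:
  fixes f :: "real \<Rightarrow> real"
  assumes "continuous_on UNIV f" "\<And>x. 0 \<le> f x"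
  shows "(\<integral>\<^sup>+x. ennreal (f x) * indicator {a..b} x \<partial>lborel) = ennreal (integral {a..b} f)"
  using nn_integral_has_integral_lebesgue'[OF assms(2) integrable_integral[OF
      integrable_continuous_interval[OF
    continuous_on_subset[OF assms(1) subset_UNIV]]]] by simp

lemma nn_integral_le_of_tendsto:
  fixes g :: "nat \<Rightarrow> 'a \<Rightarrow> ennreal"
  assumes "\<And>n. g n \<in> borel_measurable M" "AE x in M. (\<lambda>n. g n x) \<longlonglongrightarrow> f x"
    and "\<forall>\<^sub>F n in sequentially. (\<integral>\<^sup>+x. g n x \<partial>M) \<le> c"
  shows "(\<integral>\<^sup>+x. f x \<partial>M) \<le> c"
proof -
  have "(\<integral>\<^sup>+x. f x \<partial>M) = (\<integral>\<^sup>+x. liminf (\<lambda>n. g n x) \<partial>M)"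
    using assms(2) by (intro nn_integral_cong_AE) (auto elim!: eventually_mono simp: lim_imp_Liminf)
  also have "\<dots> \<le> liminf (\<lambda>n. \<integral>\<^sup>+x. g n x \<partial>M)" by (rule nn_integral_liminf[OF assms(1)])
  also have "\<dots> \<le> limsup (\<lambda>n. \<integral>\<^sup>+x. g n x \<partial>M)" by (rule Liminf_le_Limsup) simp
  also have "\<dots> \<le> c" by (rule Limsup_bounded[OF assms(3)])
  finally show ?thesis .
qed

lemma interval_indicator_tendsto:
  "(\<lambda>n. c * indicator {- real n..real n} x) \<longlonglongrightarrow> (c :: ennreal)"
proof (rule tendsto_eventually)
  have "\<forall>\<^sub>F n in sequentially. \<bar>x\<bar> \<le> real n"
    using eventually_ge_at_top[of "nat \<lceil>\<bar>x\<bar>\<rceil>"]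
    by (rule eventually_mono) (meson of_nat_le_iff order_trans real_nat_ceiling_ge)
  then show "\<forall>\<^sub>F n in sequentially. c * indicator {- real n..real n} x = c"
    by (rule eventually_mono) (auto simp: indicator_def abs_le_iff)
qed

lemma nn_integral_le_of_intervals:
  fixes f :: "real \<Rightarrow> ennreal"
  assumes [measurable]: "f \<in> borel_measurable borel"
    and le: "\<And>n. (\<integral>\<^sup>+x. f x * indicator {- real n..real n} x \<partial>lborel) \<le> c"
  shows "(\<integral>\<^sup>+x. f x \<partial>lborel) \<le> c"
  by (rule nn_integral_le_of_tendsto[where g = "\<lambda>n x. f x * indicator {- real n..real n} x"])
    (use le interval_indicator_tendsto in auto)

lemma classical_solution_zero: "classical_solution m \<alpha> \<beta> T (\<lambda>_ _. 0) (\<lambda>_ _. 0)"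
  unfolding classical_solution_iff C1_strip_def dirac_rhs_def N1_monomials
  by (intro exI[of _ "\<lambda>_ _. 0"]) simp

text \<open>The constant of the stability estimate on cones; it depends on the solutions only through
  the bound \<open>M\<close> of their charges.\<close>

definition stability_constant :: "real \<Rightarrow> real \<Rightarrow> real \<Rightarrow> real \<Rightarrow> real \<Rightarrow> real" where
  "stability_constant m \<alpha> \<beta> T M = (let K = \<bar>\<alpha>\<bar> + 4 * \<bar>\<beta>\<bar>; G = exp (m * T + K * M); D = G * m * M
     in exp ((2 * m + 8 * K * D + D) * T + 4 * (4 * K + 1) * (2 * G * M)))"

lemma stability_constant_nonneg: "0 \<le> stability_constant m \<alpha> \<beta> T M"
  by (simp add: stability_constant_def Let_def)

lemma classical_solution_continuous:
  assumes "classical_solution m \<alpha> \<beta> T u v" "continuous_on S a" "continuous_on S b" "\<And>z. z \<in> S \<Longrightarrow>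
      a z \<in> {0..T}"
  shows "continuous_on S (\<lambda>z. u (a z) (b z))" "continuous_on S (\<lambda>z. v (a z) (b z))"
proof -
  obtain ut ux vt vx where u: "C1_strip T u ut ux" and v: "C1_strip T v vt vx"
    by (rule classical_solutionE[OF assms(1)]) (rule that)
  show "continuous_on S (\<lambda>z. u (a z) (b z))" "continuous_on S (\<lambda>z. v (a z) (b z))"
    by (rule C1_strip_continuous(1)[OF u assms(2-4)] C1_strip_continuous(1)[OF v assms(2-4)];
        assumption)+
qed

lemma classical_solution_slice:
  assumes "classical_solution m \<alpha> \<beta> T u v" "t \<in> {0..T}"
  shows "continuous_on S (u t)" "continuous_on S (v t)"
  by (rule classical_solution_continuous[OF assms(1), of _ "\<lambda>_. t" "\<lambda>x. x"]; use assms(2) in simp)+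

lemma interval_charge_le:
  fixes f g :: "real \<Rightarrow> complex"
  assumes "continuous_on UNIV f" "continuous_on UNIV g" "sqnorm UNIV f + sqnorm UNIV g \<le> ennreal M"
      "0 \<le> M"
  shows "integral {a..b} (\<lambda>x. (norm (f x))\<^sup>2 + (norm (g x))\<^sup>2) \<le> M"
proof -
  have "ennreal (integral {a..b} (\<lambda>x. (norm (f x))\<^sup>2 + (norm (g x))\<^sup>2)) =
      (\<integral>\<^sup>+x. ennreal ((norm (f x))\<^sup>2 + (norm (g x))\<^sup>2) * indicator {a..b} x \<partial>lborel)"
    by (rule nn_integral_interval[symmetric]) (use assms in \<open>auto intro!: continuous_intros\<close>)
  also have "\<dots> \<le> (\<integral>\<^sup>+x. ennreal ((norm (f x))\<^sup>2 + (norm (g x))\<^sup>2) \<partial>lborel)"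
    by (intro nn_integral_mono) (auto simp: indicator_def)
  also have "\<dots> \<le> ennreal M" using assms(3) unfolding sqnorm_add_eq[OF assms(1,2)] .
  finally show ?thesis using assms(4) by (simp add: ennreal_le_iff)
qed

text \<open>The estimate on cones, for cones of growing width. The second bound still cuts off the space
  integral at \<open>n\<close>: it is used together with Fatou's lemma, where \<open>n\<close> and the approximating
  solution vary at the same time.\<close>

lemma stability:
  assumes m: "0 \<le> m" and T: "0 \<le> T" and M0: "0 \<le> M"
    and sol: "classical_solution m \<alpha> \<beta> T u v" "classical_solution m \<alpha> \<beta> T u' v'"
    and M: "sqnorm UNIV (u 0) + sqnorm UNIV (v 0) \<le> ennreal M"
    and M': "sqnorm UNIV (u' 0) + sqnorm UNIV (v' 0) \<le> ennreal M"
  shows "t \<in> {0..T} \<Longrightarrow> sqnorm UNIV (\<lambda>x. u t x - u' t x) + sqnorm UNIV (\<lambda>x. v t x - v' t x) \<le>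
      ennreal (stability_constant m \<alpha> \<beta> T M) *
        (sqnorm UNIV (\<lambda>x. u 0 x - u' 0 x) + sqnorm UNIV (\<lambda>x. v 0 x - v' 0 x))"
    and "(\<integral>\<^sup>+s. (\<integral>\<^sup>+x. ennreal ((cmod (u s x - u' s x))\<^sup>2 * (cmod (v s x))\<^sup>2) * indicator {- real
        n..real n} x \<partial>lborel)
        * indicator {0..T} s \<partial>lborel) \<le> ennreal (stability_constant m \<alpha> \<beta> T M) *
        (sqnorm UNIV (\<lambda>x. u 0 x - u' 0 x) + sqnorm UNIV (\<lambda>x. v 0 x - v' 0 x))"
proof -
  let ?C = "stability_constant m \<alpha> \<beta> T M"
  let ?I = "sqnorm UNIV (\<lambda>x. u 0 x - u' 0 x) + sqnorm UNIV (\<lambda>x. v 0 x - v' 0 x)"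
  let ?e = "\<lambda>s x. (cmod (u s x - u' s x))\<^sup>2 + (cmod (v s x - v' s x))\<^sup>2"
  let ?g = "\<lambda>s x. (cmod (u s x - u' s x))\<^sup>2 * (cmod (v s x))\<^sup>2"
  note C0 = stability_constant_nonneg[of m \<alpha> \<beta> T M]
  note sl = classical_solution_slice[OF sol(1)] classical_solution_slice[OF sol(2)]
  note cc = classical_solution_continuous[OF sol(1)] classical_solution_continuous[OF sol(2)]
  have z: "0 \<in> {0..T}" using T by simp
  have data: "ennreal (integral {-R..R} (?e 0)) \<le> ?I" for R
  proof -
    have "ennreal (integral {-R..R} (?e 0)) = (\<integral>\<^sup>+x. ennreal (?e 0 x) * indicator {-R..R} x \<partial>lborel)"
      by (rule nn_integral_interval[symmetric]) (auto intro!: continuous_intros sl z)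
    also have "\<dots> \<le> (\<integral>\<^sup>+x. ennreal (?e 0 x) \<partial>lborel)"
      by (intro nn_integral_mono) (auto simp: indicator_def)
    also have "\<dots> = ?I" by (rule sqnorm_add_eq[symmetric]) (auto intro!: continuous_intros sl z)
    finally show ?thesis .
  qed
  have cone: "integral {0 - (r - t)..0 + (r - t)} (?e t) + integral {0..t} (\<lambda>s. integral {0 -
      (r - s)..0 + (r - s)} (?g s))
      \<le> ?C * integral {0 - r..0 + r} (?e 0)" if "t \<in> {0..T}" "t \<le> r" for r t
    unfolding stability_constant_def Let_def
    by (rule stability_on_cone[OF m T sol _ _ refl refl refl refl])
      (use that in \<open>auto intro!: interval_charge_le sl z M M' M0\<close>)
  have g0: "0 \<le> integral {a..b} (?g s)" if "s \<in> {0..T}" for s a b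
    by (intro integral_nonneg integrable_continuous_interval continuous_intros sl that) auto
  have e0: "0 \<le> integral {a..b} (?e s)" if "s \<in> {0..T}" for s a b
    by (intro integral_nonneg integrable_continuous_interval continuous_intros sl that) auto
  have gc: "continuous_on {0..t} (\<lambda>s. integral {0 - (r - s)..0 + (r - s)} (?g s))" if "t \<in> {0..T}"
      "t \<le> r" for r t
    by (rule cone_slice_integral_continuous[where T = T]) (use that
        in \<open>auto simp: case_prod_beta intro!: continuous_intros cc\<close>)
  show "sqnorm UNIV (\<lambda>x. u t x - u' t x) + sqnorm UNIV (\<lambda>x. v t x - v' t x) \<le> ennreal ?C * ?I" if t:
      "t \<in> {0..T}"
  proof -
    have "(\<integral>\<^sup>+x. ennreal (?e t x) \<partial>lborel) \<le> ennreal ?C * ?I"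
    proof (rule nn_integral_le_of_intervals)
      have c: "continuous_on UNIV (?e t)" by (intro continuous_intros sl t)
      show "(\<lambda>x. ennreal (?e t x)) \<in> borel_measurable borel"
        using borel_measurable_continuous_onI[OF c] by measurable
      fix n :: nat
      have "0 \<le> integral {0..t} (\<lambda>s. integral {0 - (real n + t - s)..0 + (real n + t - s)} (?g s))"
        by (intro integral_nonneg integrable_continuous_interval gc g0) (use t in auto)
      then have le: "integral {- real n..real n} (?e t) \<le> ?C * integral {- (real n + t)..real n +
          t} (?e 0)"
        using cone[OF t, of "real n + t"] by simp
      have "(\<integral>\<^sup>+x. ennreal (?e t x) * indicator {- real n..real n} x \<partial>lborel) =
          ennreal (integral {- real n..real n} (?e t))"
        by (rule nn_integral_interval[OF c]) auto
      also have "\<dots> \<le> ennreal (?C * integral {- (real n + t)..real n + t} (?e 0))"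
          by (rule ennreal_leI[OF le])
      also have "\<dots> = ennreal ?C * ennreal (integral {- (real n + t)..real n + t} (?e 0))"
        by (rule ennreal_mult'[OF C0])
      also have "\<dots> \<le> ennreal ?C * ?I" by (rule mult_left_mono[OF data]) simp
      finally show "(\<integral>\<^sup>+x. ennreal (?e t x) * indicator {- real n..real n} x \<partial>lborel) \<le>
          ennreal ?C * ?I" .
    qed
    then show ?thesis by (subst sqnorm_add_eq) (auto intro!: continuous_intros sl t)
  qed
  show "(\<integral>\<^sup>+s. (\<integral>\<^sup>+x. ennreal (?g s x) * indicator {- real n..real n} x \<partial>lborel) * indicator {0..T}
      s \<partial>lborel) \<le> ennreal ?C * ?I"
  proof -
    define r where "r = real n + T"
    have TT: "T \<in> {0..T}" "T \<le> r" using T by (auto simp: r_def)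
    define h where "h s = integral {0 - (r - s)..0 + (r - s)} (?g s)" for s
    have "(\<integral>\<^sup>+s. (\<integral>\<^sup>+x. ennreal (?g s x) * indicator {- real n..real n} x \<partial>lborel) * indicator
        {0..T} s \<partial>lborel)
        \<le> (\<integral>\<^sup>+s. ennreal (h s) * indicator {0..T} s \<partial>lborel)"
    proof (rule nn_integral_mono)
      fix s
      have "(\<integral>\<^sup>+x. ennreal (?g s x) * indicator {- real n..real n} x \<partial>lborel) \<le> ennreal (h s)" if s:
          "s \<in> {0..T}"
      proof -
        have c: "continuous_on UNIV (?g s)" by (intro continuous_intros sl s)
        have "(\<integral>\<^sup>+x. ennreal (?g s x) * indicator {- real n..real n} x \<partial>lborel) =
            ennreal (integral {- real n..real n} (?g s))"
          by (rule nn_integral_interval[OF c]) auto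
        also have "\<dots> \<le> ennreal (h s)"
          unfolding h_def by (intro ennreal_leI integral_subset_le integrable_continuous_interval
              continuous_on_subset[OF c])
            (use s in \<open>auto simp: r_def\<close>)
        finally show ?thesis .
      qed
      then show "(\<integral>\<^sup>+x. ennreal (?g s x) * indicator {- real n..real n} x \<partial>lborel) * indicator
          {0..T} s \<le> ennreal (h s) * indicator {0..T} s"
        by (auto simp: indicator_def)
    qed
    also have "\<dots> = ennreal (integral {0..T} h)"
      by (rule nn_integral_has_integral_lebesgue'[OF _ integrable_integral])
        (use gc[OF TT] g0 in \<open>auto simp: h_def intro!: integrable_continuous_interval\<close>)
    also have "\<dots> \<le> ennreal (?C * integral {-r..r} (?e 0))"
      using cone[OF TT] e0[OF TT(1), of "0 - (r - T)" "0 + (r - T)"]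
          by (intro ennreal_leI) (simp add: h_def[abs_def])
    also have "\<dots> = ennreal ?C * ennreal (integral {-r..r} (?e 0))"
      by (rule ennreal_mult'[OF C0])
    also have "\<dots> \<le> ennreal ?C * ?I" by (rule mult_left_mono[OF data]) simp
    finally show ?thesis .
  qed
qed

lemma sqnorm_solution_le:
  assumes "0 \<le> m" "0 \<le> T" "0 \<le> M" "classical_solution m \<alpha> \<beta> T u v"
    and M: "sqnorm UNIV (u 0) + sqnorm UNIV (v 0) \<le> ennreal M" and "t \<in> {0..T}"
  shows "sqnorm UNIV (u t) + sqnorm UNIV (v t) \<le> ennreal (stability_constant m \<alpha> \<beta> T M) * ennreal M"
proof -
  have 0: "sqnorm UNIV (\<lambda>x::real. 0::complex) = 0" by (simp add: sqnorm_def)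
  have "sqnorm UNIV (\<lambda>x. u t x - 0) + sqnorm UNIV (\<lambda>x. v t x - 0) \<le>
      ennreal (stability_constant m \<alpha> \<beta> T M) * (sqnorm UNIV (\<lambda>x. u 0 x - 0) +
          sqnorm UNIV (\<lambda>x. v 0 x - 0))"
    by (rule stability(1)[OF assms(1-4) classical_solution_zero M _ assms(6)]) (simp add: 0)
  also have "\<dots> \<le> ennreal (stability_constant m \<alpha> \<beta> T M) * ennreal M"
    using M by (intro mult_left_mono) auto
  finally show ?thesis by simp
qed

lemma approximate_global_solution:
  assumes m: "0 \<le> m" and u0: "L2 UNIV u0" and v0: "L2 UNIV v0" and e: "0 < e"
  shows "\<exists>u v R. (\<forall>T. classical_solution m \<alpha> \<beta> T u v) \<and> (\<forall>x. R < \<bar>x\<bar> \<longrightarrow> u 0 x = 0 \<and> v 0 x = 0) \<and>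
     sqnorm UNIV (\<lambda>x. u0 x - u 0 x) \<le> ennreal e \<and> sqnorm UNIV (\<lambda>x. v0 x - v 0 x) \<le> ennreal e"
proof -
  obtain f f' B R where f: "\<And>x. (f has_vector_derivative f' x) (at x)" "continuous_on UNIV f'"
     "\<And>x. cmod (f x) \<le> B" "\<And>x. cmod (f' x) \<le> B" "\<And>x. R < \<bar>x\<bar> \<Longrightarrow> f x = 0"
     "sqnorm UNIV (\<lambda>x. u0 x - f x) \<le> ennreal e"
    using C1_compact_support_dense[OF u0 e] by blast
  obtain g g' B' R' where g: "\<And>x. (g has_vector_derivative g' x) (at x)" "continuous_on UNIV g'"
     "\<And>x. cmod (g x) \<le> B'" "\<And>x. cmod (g' x) \<le> B'" "\<And>x. R' < \<bar>x\<bar> \<Longrightarrow> g x = 0"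
     "sqnorm UNIV (\<lambda>x. v0 x - g x) \<le> ennreal e"
    using C1_compact_support_dense[OF v0 e] by blast
  have cf: "continuous_on UNIV f" and cg: "continuous_on UNIV g"
    using f(1) g(1) by (auto intro!: continuous_at_imp_continuous_on has_vector_derivative_continuous)
  have fin: "sqnorm UNIV h < \<infinity>" if h0: "L2 UNIV h0" and ch: "continuous_on UNIV h"
    and le: "sqnorm UNIV (\<lambda>x. h0 x - h x) \<le> ennreal e" for h0 h :: "real \<Rightarrow> complex"
  proof -
    have [measurable]: "h0 \<in> borel_measurable lebesgue" "h \<in> borel_measurable lebesgue"
      using h0 continuous_imp_measurable_lebesgue[OF ch]
          by (auto simp: L2_iff_sqnorm lebesgue_on_UNIV_eq)
    have "sqnorm UNIV (\<lambda>x. h x - 0) \<le> 2 * sqnorm UNIV (\<lambda>x. h x - h0 x) + 2 * sqnorm UNIV (\<lambda>x. h0 x - 0)"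
      by (rule sqnorm_triangle) (simp_all add: lebesgue_on_UNIV_eq)
    also have "\<dots> \<le> 2 * ennreal e + 2 * sqnorm UNIV (\<lambda>x. h0 x - 0)"
      unfolding sqnorm_minus_commute[of _ h h0] by (intro add_right_mono mult_left_mono le) simp
    also have "\<dots> < \<infinity>" using h0 by (auto simp: L2_iff_sqnorm ennreal_mult_less_top)
    finally show ?thesis by simp
  qed
  define M where "M = enn2real (sqnorm UNIV f + sqnorm UNIV g)"
  have "sqnorm UNIV f + sqnorm UNIV g < \<infinity>"
    using fin[OF u0 cf f(6)] fin[OF v0 cg g(6)] by simp
  then have M: "sqnorm UNIV f + sqnorm UNIV g \<le> ennreal M" "0 \<le> M"
    by (simp_all add: M_def)
  obtain u v where uv: "\<And>T. classical_solution m \<alpha> \<beta> T u v" "u 0 = f" "v 0 = g"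
  proof (rule global_classical_solution[OF m f(1,2) g(1,2)])
    show "cmod (f x) \<le> max B B'" "cmod (g x) \<le> max B B'" "cmod (f' x) \<le> max B B'" "cmod (g' x) \<le>
        max B B'" for x
      using f(3)[of x] f(4)[of x] g(3)[of x] g(4)[of x] by (auto simp: le_max_iff_disj)
    show "integral {a..b} (\<lambda>x. (cmod (f x))\<^sup>2 + (cmod (g x))\<^sup>2) \<le> M" for a b
      by (rule interval_charge_le[OF cf cg M])
  qed (rule that)
  show ?thesis
    using uv f(5,6) g(5,6) by (intro exI[of _ u] exI[of _ v] exI[of _ "max R R'"]) auto
qed

section \<open>Limits of classical solutions\<close>

text \<open>On a bounded time interval the function lives on a compact set, where it is bounded;
  dominated convergence applies.\<close>

lemma sqnorm_time_continuous:
  fixes f :: "real \<Rightarrow> real \<Rightarrow> complex"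
  assumes cont: "\<And>T. continuous_on ({0..T} \<times> UNIV) (\<lambda>(t, x). f t x)"
    and zero: "\<And>s x. 0 \<le> s \<Longrightarrow> R + s < \<bar>x\<bar> \<Longrightarrow> f s x = 0" and t: "0 \<le> t"
  shows "((\<lambda>s. sqnorm UNIV (\<lambda>x. f s x - f t x)) \<longlongrightarrow> 0) (at t within {0..})"
  unfolding tendsto_at_iff_sequentially
proof (intro allI impI)
  fix X assume X: "\<forall>i. X i \<in> {0..} - {t}" "X \<longlonglongrightarrow> t"
  obtain T0 where T0: "\<And>i. norm (X i) \<le> T0"
    using convergent_imp_Bseq[OF convergentI[OF X(2)]] by (auto simp: Bseq_def)
  define T where "T = max T0 t"
  have XT: "X i \<in> {0..T}" for i using X(1) T0[of i] by (auto simp: T_def le_max_iff_disj)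
  have tT: "t \<in> {0..T}" using t by (auto simp: T_def)
  note cc = strip_continuous_compose[OF cont[of T]]
  have "compact ((\<lambda>(t, x). f t x) ` ({0..T} \<times> {- (R + T)..R + T}))"
    by (intro compact_continuous_image continuous_on_subset[OF cont[of T]] compact_Times) auto
  then obtain B where B: "\<And>s x. s \<in> {0..T} \<Longrightarrow> x \<in> {- (R + T)..R + T} \<Longrightarrow> cmod (f s x) \<le> B"
    using compact_imp_bounded bounded_iff by (metis (no_types, lifting) SigmaI case_prod_conv image_eqI)
  have meas: "f s \<in> borel_measurable lebesgue" if "s \<in> {0..T}" for s
    by (intro continuous_imp_measurable_lebesgue cc[of UNIV "\<lambda>_. s" "\<lambda>x. x"]) (use that in auto)
  have "(\<lambda>i. sqnorm UNIV (\<lambda>x. f (X i) x - f t x)) \<longlonglongrightarrow> 0"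
  proof (rule sqnorm_dominated[OF _ interval_weight(1) _ interval_weight(2)])
    show "(\<lambda>x. f (X i) x - f t x) \<in> borel_measurable lebesgue" for i
      by (intro borel_measurable_diff meas XT tT)
    show "ennreal ((cmod (f (X i) x - f t x))\<^sup>2) \<le> ennreal ((2 * B)\<^sup>2) * indicator {- (R + T)..R +
        T} x" for i x
    proof (cases "x \<in> {- (R + T)..R + T}")
      case True
      have "cmod (f (X i) x - f t x) \<le> 2 * B"
        using norm_triangle_ineq4[of "f (X i) x" "f t x"] B[OF XT True, of i] B[OF tT True] by linarith
      then have "ennreal ((cmod (f (X i) x - f t x))\<^sup>2) \<le> ennreal ((2 * B)\<^sup>2)"
        by (intro ennreal_leI power_mono) auto
      then show ?thesis by (simp only: indicator_simps(1)[OF True] mult_1_right)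
    next
      case False
      then have "R + T < \<bar>x\<bar>" by auto
      then have "f (X i) x = 0" "f t x = 0" using XT[of i] tT by (auto intro!: zero)
      then show ?thesis by simp
    qed
    show "AE x in lebesgue. (\<lambda>i. f (X i) x - f t x) \<longlonglongrightarrow> 0"
    proof (rule AE_I2)
      fix x
      have "continuous_on {0..T} (\<lambda>s. f s x)" by (intro cc continuous_intros) auto
      then have "(\<lambda>i. f (X i) x) \<longlonglongrightarrow> f t x"
        by (rule continuous_on_tendsto_compose[OF _ X(2) tT]) (simp only: XT eventually_True)
      then show "(\<lambda>i. f (X i) x - f t x) \<longlonglongrightarrow> 0" by (simp add: LIM_zero)
    qed
  qed
  then show "((\<lambda>s. sqnorm UNIV (\<lambda>x. f s x - f t x)) \<circ> X) \<longlonglongrightarrow> 0" by (simp add: o_def)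
qed

text \<open>The pointwise bound for a point whose light cone has a base without charge.\<close>

lemma finite_propagation:
  assumes m: "0 \<le> m" and sol: "\<And>T. classical_solution m \<alpha> \<beta> T u v"
    and supp: "\<And>x. R < \<bar>x\<bar> \<Longrightarrow> u 0 x = 0 \<and> v 0 x = 0" and s: "0 \<le> s" "R + s < \<bar>x\<bar>"
  shows "u s x = 0" "v s x = 0"
proof -
  obtain ut ux vt vx where u: "C1_strip s u ut ux" and v: "C1_strip s v vt vx"
    and eq: "\<And>t x. t \<in> {0..s} \<Longrightarrow> ut t x + ux t x = dirac_rhs m \<alpha> \<beta> 1 (u t x) (v t x)"
      "\<And>t x. t \<in> {0..s} \<Longrightarrow> vt t x - vx t x = dirac_rhs m \<alpha> \<beta> 1 (v t x) (u t x)"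
    by (rule classical_solutionE[OF sol[of s]]) (rule that)
  interpret P: charge_conserving_pair m "\<bar>\<alpha>\<bar> + 4 * \<bar>\<beta>\<bar>" s u ut ux v vt vx
    by (rule classical_solution_charge_conserving[OF m u v, where h = "\<lambda>_ _. 1"]) (use eq in auto)
  have z: "u 0 y = 0" "v 0 y = 0" if "y \<in> {x - s..x + s}" for y
  proof -
    have "R < \<bar>y\<bar>" using that s by auto
    then show "u 0 y = 0" "v 0 y = 0" using supp by auto
  qed
  have "integral {x - s..x + s} (\<lambda>x. (cmod (u 0 x))\<^sup>2 + (cmod (v 0 x))\<^sup>2) = integral {x - s..x +
      s} (\<lambda>_. 0)"
    by (rule integral_cong) (simp add: z)
  then have C: "integral {x - s..x + s} (\<lambda>x. (cmod (u 0 x))\<^sup>2 + (cmod (v 0 x))\<^sup>2) \<le> 0" by simp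
  show "u s x = 0" "v s x = 0"
    using P.pointwise_bound[OF s(1) order_refl C] z[of "x - s"] z[of "x + s"] s by auto
qed

text \<open>The squared norms of the increments decay like \<open>4\<^sup>-\<^sup>n\<close>, so \<open>\<Sum>n. 2\<^sup>n |f\<^sub>n\<^sub>+\<^sub>1 - f\<^sub>n|\<^sup>2\<close> has a
  finite integral and is finite almost everywhere. There the increments decay geometrically. The
  bound of the distance to the limit is Fatou's lemma.\<close>

lemma sqnorm_fast_cauchy_limit:
  fixes f :: "nat \<Rightarrow> real \<Rightarrow> complex"
  assumes cont: "\<And>n. continuous_on UNIV (f n)" and c: "0 \<le> c"
    and cauchy: "\<And>n k. n \<le> k \<Longrightarrow> sqnorm UNIV (\<lambda>x. f k x - f n x) \<le> ennreal (c / 4 ^ n)"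
  shows "AE x in lborel. convergent (\<lambda>n. f n x)"
    and "sqnorm UNIV (\<lambda>x. lim (\<lambda>n. f n x) - f n x) \<le> ennreal (c / 4 ^ n)"
proof -
  have [measurable]: "f n \<in> borel_measurable borel" for n
    by (rule borel_measurable_continuous_onI[OF cont])
  let ?d = "\<lambda>n x. 2 ^ n * (cmod (f (Suc n) x - f n x))\<^sup>2"
  have "(\<integral>\<^sup>+x. (\<Sum>n. ennreal (?d n x)) \<partial>lborel) = (\<Sum>n. \<integral>\<^sup>+x. ennreal (?d n x) \<partial>lborel)"
    by (rule nn_integral_suminf) simp
  also have "\<dots> = (\<Sum>n. ennreal (2 ^ n) * sqnorm UNIV (\<lambda>x. f (Suc n) x - f n x))"
    unfolding sqnorm_lborel by (subst nn_integral_cmult[symmetric]) (simp_all add: ennreal_mult')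
  also have "\<dots> \<le> (\<Sum>n. ennreal (c * (1 / 2) ^ n))"
  proof (rule suminf_le)
    fix n
    have "ennreal (2 ^ n) * sqnorm UNIV (\<lambda>x. f (Suc n) x - f n x) \<le>
        ennreal (2 ^ n) * ennreal (c / 4 ^ n)"
      by (intro mult_left_mono cauchy) auto
    also have "\<dots> = ennreal (2 ^ n * (c / 4 ^ n))" by (rule ennreal_mult[symmetric]) (use c in auto)
    also have "2 ^ n * (c / 4 ^ n) = c * (1 / 2) ^ n"
    proof -
      have "(4 :: real) ^ n = 2 ^ n * 2 ^ n" by (simp flip: power_mult_distrib)
      then show ?thesis by (simp add: power_one_over field_simps)
    qed
    finally show "ennreal (2 ^ n) * sqnorm UNIV (\<lambda>x. f (Suc n) x - f n x) \<le> ennreal (c * (1 / 2) ^ n)" .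
  qed auto
  also have "\<dots> = ennreal (\<Sum>n. c * (1 / 2) ^ n)"
    using c by (intro suminf_ennreal2 summable_mult summable_geometric) auto
  also have "\<dots> < \<infinity>" by simp
  finally have "(\<integral>\<^sup>+x. (\<Sum>n. ennreal (?d n x)) \<partial>lborel) \<noteq> \<infinity>" by simp
  then have "AE x in lborel. (\<Sum>n. ennreal (?d n x)) \<noteq> \<infinity>"
    by (intro nn_integral_PInf_AE) auto
  then show ae: "AE x in lborel. convergent (\<lambda>n. f n x)"
  proof eventually_elim
    case (elim x)
    have s: "summable (\<lambda>n. ?d n x)"
      by (rule summable_suminf_not_top) (use elim in auto)
    define S where "S = (\<Sum>n. ?d n x)"
    have dS: "?d n x \<le> S" for n
      unfolding S_def using sum_le_suminf[OF s, of "{n}"] by auto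
    have S0: "0 \<le> S" using dS[of 0] by (auto intro: order_trans[rotated])
    have d: "cmod (f (Suc n) x - f n x) \<le> sqrt S * (1 / sqrt 2) ^ n" for n
    proof -
      have "(cmod (f (Suc n) x - f n x))\<^sup>2 \<le> S / 2 ^ n"
        using dS[of n] by (simp add: pos_le_divide_eq mult.commute)
      also have "\<dots> = (sqrt S * (1 / sqrt 2) ^ n)\<^sup>2"
      proof -
        have "((1 / sqrt 2) ^ n)\<^sup>2 = ((1 / sqrt 2)\<^sup>2) ^ n" by (metis power_mult mult.commute)
        then have "((1 / sqrt 2) ^ n)\<^sup>2 = (1 / 2) ^ n" by (simp add: power_divide)
        then show ?thesis using S0 by (simp add: power_mult_distrib power_divide)
      qed
      finally show ?thesis by (rule power2_le_imp_le) (use S0 in auto)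
    qed
    have "summable (\<lambda>n. sqrt S * (1 / sqrt 2) ^ n)"
      by (intro summable_mult summable_geometric) simp
    then have "summable (\<lambda>n. f (Suc n) x - f n x)"
      by (rule summable_comparison_test'[where N = 0]) (rule d)
    then have "convergent (\<lambda>n. \<Sum>i<n. f (Suc i) x - f i x)" by (simp add: summable_iff_convergent)
    then have "convergent (\<lambda>n. f n x - f 0 x)" by (simp only: sum_lessThan_telescope[of "\<lambda>i. f i x"])
    then have "convergent (\<lambda>n. (f n x - f 0 x) + f 0 x)"
      by (intro convergent_add convergent_const)
    then show ?case by simp
  qed
  show "sqnorm UNIV (\<lambda>x. lim (\<lambda>n. f n x) - f n x) \<le> ennreal (c / 4 ^ n)"
    unfolding sqnorm_lborel
  proof (rule nn_integral_le_of_tendsto)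
    show "AE x in lborel. (\<lambda>k. ennreal ((cmod (f k x - f n x))\<^sup>2)) \<longlonglongrightarrow>
        ennreal ((cmod (lim (\<lambda>n. f n x) - f n x))\<^sup>2)"
      using ae by eventually_elim (auto intro!: tendsto_intros simp: convergent_LIMSEQ_iff)
    show "\<forall>\<^sub>F k in sequentially. (\<integral>\<^sup>+x. ennreal ((cmod (f k x - f n x))\<^sup>2) \<partial>lborel) \<le>
        ennreal (c / 4 ^ n)"
      using eventually_ge_at_top[of n] by eventually_elim (use cauchy in \<open>simp add: sqnorm_lborel\<close>)
  qed auto
qed

lemma continuous_extension_to_negative_times:
  fixes f :: "real \<Rightarrow> real \<Rightarrow> complex"
  assumes cont: "\<And>T. continuous_on ({0..T} \<times> UNIV) (\<lambda>(t, x). f t x)"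
  shows "continuous_on UNIV (\<lambda>(t, x). f (max 0 t) x)"
proof (rule continuous_at_imp_continuous_on, rule ballI)
  fix z :: "real \<times> real"
  define T where "T = \<bar>fst z\<bar> + 1"
  have "continuous_on ({..<T} \<times> UNIV) (\<lambda>z. f (max 0 (fst z)) (snd z))"
    by (intro strip_continuous_compose[OF cont[of T]] continuous_intros) (auto simp: T_def)
  then have "continuous_on ({..<T} \<times> UNIV) (\<lambda>(t, x). f (max 0 t) x)" by (simp add: case_prod_beta)
  moreover have "open ({..<T} \<times> (UNIV :: real set))" by (intro open_Times) auto
  moreover have "z \<in> {..<T} \<times> UNIV" by (auto simp: T_def mem_Times_iff)
  ultimately show "isCont (\<lambda>(t, x). f (max 0 t) x) z"
    using continuous_on_eq_continuous_at by blast
qed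

lemma strip_in_sets: "{0..T::real} \<times> (UNIV :: real set) \<in> sets lebesgue"
proof -
  have "closed ({0..T} \<times> (UNIV :: real set))" by (intro closed_Times) auto
  then show ?thesis by auto
qed

lemma nn_integral_lborel_pair:
  fixes h :: "real \<times> real \<Rightarrow> ennreal"
  assumes [measurable]: "h \<in> borel_measurable borel"
  shows "(\<integral>\<^sup>+z. h z \<partial>lborel) = (\<integral>\<^sup>+s. \<integral>\<^sup>+x. h (s, x) \<partial>lborel \<partial>lborel)"
proof -
  have "h \<in> borel_measurable (lborel \<Otimes>\<^sub>M lborel)" unfolding lborel_prod by simp
  from lborel.nn_integral_fst[OF this] show ?thesis unfolding lborel_prod by simp
qed

lemma sqnorm_strip:
  fixes F :: "real \<times> real \<Rightarrow> 'b::euclidean_space"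
  assumes [measurable]: "F \<in> borel_measurable borel"
  shows "sqnorm ({0..T} \<times> UNIV) F = (\<integral>\<^sup>+s. sqnorm UNIV (\<lambda>x. F (s, x)) * indicator {0..T} s \<partial>lborel)"
proof -
  have [measurable]: "{0..T} \<times> (UNIV :: real set) \<in> sets borel"
    by (intro borel_closed closed_Times) auto
  have "sqnorm ({0..T} \<times> UNIV) F = (\<integral>\<^sup>+z. ennreal ((norm (F z))\<^sup>2) * indicator ({0..T} \<times> UNIV) z
      \<partial>lborel)"
    unfolding sqnorm_def by (subst nn_integral_restrict_space) (use strip_in_sets
        in \<open>auto simp: nn_integral_completion\<close>)
  also have "\<dots> = (\<integral>\<^sup>+s. \<integral>\<^sup>+x. ennreal ((norm (F (s, x)))\<^sup>2) * indicator ({0..T} \<times> UNIV) (s, x)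
      \<partial>lborel \<partial>lborel)"
    by (rule nn_integral_lborel_pair) measurable
  also have "\<dots> = (\<integral>\<^sup>+s. sqnorm UNIV (\<lambda>x. F (s, x)) * indicator {0..T} s \<partial>lborel)"
    unfolding sqnorm_lborel by (intro nn_integral_cong) (auto simp: indicator_def)
  finally show ?thesis .
qed

lemma sqnorm_strip_le:
  fixes F :: "real \<times> real \<Rightarrow> 'b::euclidean_space"
  assumes "F \<in> borel_measurable borel" "0 \<le> T" and le: "\<And>s. s \<in> {0..T} \<Longrightarrow> sqnorm UNIV (\<lambda>x. F (s, x)) \<le> c"
  shows "sqnorm ({0..T} \<times> UNIV) F \<le> c * ennreal T"
proof -
  have "sqnorm ({0..T} \<times> UNIV) F \<le> (\<integral>\<^sup>+s. c * indicator {0..T} s \<partial>lborel)"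
    unfolding sqnorm_strip[OF assms(1)] using le by (intro nn_integral_mono) (auto simp: indicator_def)
  also have "\<dots> = c * ennreal T" using assms(2) by (subst nn_integral_cmult_indicator) auto
  finally show ?thesis .
qed

lemma sqnorm_cong: "(\<And>z. z \<in> S \<Longrightarrow> f z = g z) \<Longrightarrow> sqnorm S f = sqnorm S g"
  unfolding sqnorm_def by (intro nn_integral_cong) (auto simp: space_restrict_space)

lemma borel_measurable_lebesgue_on:
  fixes F :: "'a::euclidean_space \<Rightarrow> 'b::euclidean_space"
  shows "F \<in> borel_measurable borel \<Longrightarrow> F \<in> borel_measurable (lebesgue_on S)"
  by (rule measurable_restrict_space1) (rule measurable_completion[of _ lborel borel, simplified])

lemma lebesgue_on_cong:
  "f \<in> borel_measurable (lebesgue_on S) \<Longrightarrow> (\<And>z. z \<in> S \<Longrightarrow> f z = g z) \<Longrightarrow>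
      g \<in> borel_measurable (lebesgue_on S)"
  by (subst (asm) measurable_cong[where g = g]) (auto simp: space_restrict_space)

lemma pow_quarter_tendsto: "(\<lambda>n. ennreal (c / 4 ^ n)) \<longlonglongrightarrow> 0"
proof -
  have "(\<lambda>n. c * (1 / 4) ^ n) \<longlonglongrightarrow> c * 0"
    by (intro tendsto_mult tendsto_const LIMSEQ_power_zero) simp
  then have "(\<lambda>n. ennreal (c * (1 / 4) ^ n)) \<longlonglongrightarrow> ennreal 0" by (intro tendsto_ennrealI) simp
  then show ?thesis by (simp add: power_one_over field_simps)
qed

text \<open>The properties of one component of the approximating solutions that are needed to pass to
  the limit. The constants \<open>b T\<close> and \<open>c T\<close> are uniform on \<open>[0,T]\<close>.\<close>

locale fast_cauchy_curves =
  fixes f :: "nat \<Rightarrow> real \<Rightarrow> real \<Rightarrow> complex" and b c :: "real \<Rightarrow> real"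
  assumes cont: "\<And>n T. continuous_on ({0..T} \<times> UNIV) (\<lambda>(t, x). f n t x)"
    and fin: "\<And>n T t. t \<in> {0..T} \<Longrightarrow> sqnorm UNIV (f n t) \<le> ennreal (b T)"
    and c: "\<And>T. 0 \<le> c T"
    and cauchy: "\<And>n k T t. n \<le> k \<Longrightarrow> t \<in> {0..T} \<Longrightarrow> sqnorm UNIV (\<lambda>x. f k t x - f n t x) \<le>
        ennreal (c T / 4 ^ n)"
    and time: "\<And>n t. 0 \<le> t \<Longrightarrow> ((\<lambda>s. sqnorm UNIV (\<lambda>x. f n s x - f n t x)) \<longlongrightarrow> 0) (at t within {0..})"
begin

text \<open>The limit is taken pointwise, with the initial value at negative times. As a limit of
  continuous functions on the plane it is jointly measurable, and at every time it represents the
  \<open>L\<^sup>2\<close> limit.\<close>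

definition limit_curve :: "real \<Rightarrow> real \<Rightarrow> complex" where
  "limit_curve t x = lim (\<lambda>n. f n (max 0 t) x)"

lemma slice_continuous: "0 \<le> t \<Longrightarrow> continuous_on UNIV (f n t)"
  using strip_continuous_compose[OF cont[of t], of UNIV "\<lambda>_. t" "\<lambda>x. x"] by simp

lemma extended_measurable: "(\<lambda>(t, x). f n (max 0 t) x) \<in> borel_measurable borel"
  by (rule borel_measurable_continuous_onI[OF continuous_extension_to_negative_times[OF cont]])

lemma limit_measurable: "(\<lambda>(t, x). limit_curve t x) \<in> borel_measurable borel"
proof -
  have "(\<lambda>z. lim (\<lambda>n. case z of (t, x) \<Rightarrow> f n (max 0 t) x)) \<in> borel_measurable borel"
    by (rule borel_measurable_lim_metric[OF extended_measurable])
  then show ?thesis unfolding limit_curve_def by (simp add: case_prod_beta')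
qed

lemma limit_slice_measurable: "limit_curve t \<in> borel_measurable borel"
  unfolding limit_curve_def
  by (rule borel_measurable_lim_metric) (rule borel_measurable_continuous_onI[OF slice_continuous],
      simp)

lemma lebesgue_measurable_slice: "0 \<le> t \<Longrightarrow> f n t \<in> borel_measurable (lebesgue_on UNIV)"
  "limit_curve t \<in> borel_measurable (lebesgue_on UNIV)"
  by (rule borel_measurable_lebesgue_on[OF borel_measurable_continuous_onI[OF slice_continuous]],
      assumption)
    (rule borel_measurable_lebesgue_on[OF limit_slice_measurable])

lemma limit_close:
  assumes "t \<in> {0..T}"
  shows "sqnorm UNIV (\<lambda>x. limit_curve t x - f n t x) \<le> ennreal (c T / 4 ^ n)"
  using sqnorm_fast_cauchy_limit(2)[of "\<lambda>n. f n t" "c T" n, OF slice_continuous c cauchy[of _ _ t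
      T]] assms
  by (simp add: limit_curve_def)

lemma convergent_ae: "AE z in lborel. convergent (\<lambda>n. case z of (t, x) \<Rightarrow> f n (max 0 t) x)"
proof -
  have "AE z in lborel \<Otimes>\<^sub>M lborel. Cauchy (\<lambda>n. case z of (t, x) \<Rightarrow> f n (max 0 t) x)"
  proof (rule lborel_pair.AE_pair_measure)
    have "{z \<in> space borel. Cauchy (\<lambda>n. case z of (t, x) \<Rightarrow> f n (max 0 t) x)} \<in> sets borel"
      by (rule sets_Collect_Cauchy) (rule extended_measurable)
    then show "{z \<in> space (lborel \<Otimes>\<^sub>M lborel). Cauchy (\<lambda>n. case z of (t, x) \<Rightarrow> f n (max 0 t) x)} \<in>
        sets (lborel \<Otimes>\<^sub>M lborel)"
      unfolding lborel_prod by simp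
    have "AE x in lborel. convergent (\<lambda>n. f n (max 0 t) x)" for t
      by (rule sqnorm_fast_cauchy_limit(1)[of "\<lambda>n. f n (max 0 t)" "c (max 0 t)"])
        (auto intro: slice_continuous c cauchy)
    then show "AE t in lborel. AE x in lborel. Cauchy (\<lambda>n. case (t, x) of (t, x) \<Rightarrow> f n (max 0 t) x)"
      by (simp add: Cauchy_convergent_iff)
  qed
  then show ?thesis unfolding lborel_prod by (simp add: Cauchy_convergent_iff)
qed

lemma limit_L2: "0 \<le> t \<Longrightarrow> L2 UNIV (limit_curve t)"
proof -
  assume t: "0 \<le> t"
  have "sqnorm UNIV (\<lambda>x. limit_curve t x - 0) \<le> 2 * sqnorm UNIV (\<lambda>x. limit_curve t x - f 0 t x) +
      2 * sqnorm UNIV (\<lambda>x. f 0 t x - 0)"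
    by (rule sqnorm_triangle) (auto intro: lebesgue_measurable_slice t)
  also have "\<dots> \<le> 2 * ennreal (c t / 4 ^ 0) + 2 * ennreal (b t)"
    using limit_close[of t t 0] fin[of t t 0] t by (intro add_mono mult_left_mono) auto
  also have "\<dots> < \<infinity>" by (simp add: ennreal_mult_less_top)
  finally show ?thesis unfolding L2_iff_sqnorm by (simp add: lebesgue_measurable_slice)
qed

lemma limit_time_continuous:
  assumes t: "0 \<le> t"
  shows "((\<lambda>s. sqnorm UNIV (\<lambda>x. limit_curve s x - limit_curve t x)) \<longlongrightarrow> 0) (at t within {0..})"
proof (rule tendsto_0_ennrealI)
  fix e :: real assume e: "0 < e"
  define T where "T = t + 1"
  have tT: "t \<in> {0..T}" using t by (simp add: T_def)
  obtain n where n: "ennreal (c T / 4 ^ n) \<le> ennreal (e / 10)"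
    using eventually_happens[OF tendsto_0_ennrealD[OF pow_quarter_tendsto[of "c T"], of "e / 10"]] e
        by auto
  have "\<forall>\<^sub>F s in at t within {0..}. s < T"
    by (rule eventually_at_ball'[THEN eventually_mono, of 1]) (auto simp: T_def dist_real_def)
  moreover have "\<forall>\<^sub>F s in at t within {0..}. s \<in> {0..}"
    by (simp add: eventually_at_filter)
  moreover have "\<forall>\<^sub>F s in at t within {0..}. sqnorm UNIV (\<lambda>x. f n s x - f n t x) \<le> ennreal (e / 10)"
    by (rule tendsto_0_ennrealD[OF time[OF t]]) (use e in simp)
  ultimately show "\<forall>\<^sub>F s in at t within {0..}. sqnorm UNIV (\<lambda>x. limit_curve s x - limit_curve t x) \<le>
      ennreal e"
  proof eventually_elim
    case (elim s)
    then have s: "0 \<le> s" "s \<in> {0..T}" by auto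
    have "sqnorm UNIV (\<lambda>x. limit_curve s x - limit_curve t x) \<le>
        2 * sqnorm UNIV (\<lambda>x. limit_curve s x - f n s x) + 2 * sqnorm UNIV (\<lambda>x. f n s x - limit_curve
            t x)"
      by (intro sqnorm_triangle lebesgue_measurable_slice s t)
    also have "\<dots> \<le> 2 * sqnorm UNIV (\<lambda>x. limit_curve s x - f n s x) +
        2 * (2 * sqnorm UNIV (\<lambda>x. f n s x - f n t x) + 2 * sqnorm UNIV (\<lambda>x. f n t x - limit_curve t x))"
      by (intro add_left_mono mult_left_mono sqnorm_triangle lebesgue_measurable_slice s t) simp
    also have "\<dots> \<le> 2 * ennreal (e / 10) + 2 * (2 * ennreal (e / 10) + 2 * ennreal (e / 10))"
      unfolding sqnorm_minus_commute[of _ "f n t" "limit_curve t"]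
      using elim(3) order_trans[OF limit_close[OF s(2)] n] order_trans[OF limit_close[OF tT] n]
      by (intro add_mono mult_left_mono) auto
    also have "\<dots> = ennreal e"
      using e by (simp flip: ennreal_plus ennreal_numeral ennreal_mult')
    finally show ?case .
  qed
qed

lemma limit_continuous_L2_curve: "continuous_L2_curve limit_curve"
  unfolding continuous_L2_curve_def
proof (intro conjI allI impI limit_L2 L2_norm_tendsto_0 limit_time_continuous)
  fix t s
  show "(\<lambda>x. limit_curve s x - limit_curve t x) \<in> borel_measurable (lebesgue_on UNIV)"
    by (intro borel_measurable_diff lebesgue_measurable_slice)
qed auto

lemma strip_measurable:
  "(\<lambda>(t, x). f n t x) \<in> borel_measurable (lebesgue_on ({0..T} \<times> UNIV))"
  "(\<lambda>(t, x). limit_curve t x) \<in> borel_measurable (lebesgue_on ({0..T} \<times> UNIV))"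
  by (rule lebesgue_on_cong[OF borel_measurable_lebesgue_on[OF extended_measurable[of n]]], auto)
    (rule borel_measurable_lebesgue_on[OF limit_measurable])

lemma strip_close:
  assumes "0 \<le> T"
  shows "sqnorm ({0..T} \<times> UNIV) (\<lambda>z. (case z of (t, x) \<Rightarrow> f n t x) - (case z of (t, x) \<Rightarrow> limit_curve
      t x))
     \<le> ennreal (c T / 4 ^ n) * ennreal T"
proof -
  have "sqnorm ({0..T} \<times> UNIV) (\<lambda>z. (case z of (t, x) \<Rightarrow> f n t x) - (case z of (t, x) \<Rightarrow> limit_curve t
      x)) =
     sqnorm ({0..T} \<times> UNIV) (\<lambda>z. (case z of (t, x) \<Rightarrow> f n (max 0 t) x) - (case z of (t, x) \<Rightarrow>
         limit_curve t x))"
    by (rule sqnorm_cong) auto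
  also have "\<dots> \<le> ennreal (c T / 4 ^ n) * ennreal T"
  proof (rule sqnorm_strip_le[OF _ assms])
    show "(\<lambda>z. (case z of (t, x) \<Rightarrow> f n (max 0 t) x) - (case z of (t, x) \<Rightarrow> limit_curve t x)) \<in>
        borel_measurable borel"
      by (intro borel_measurable_diff extended_measurable limit_measurable)
    fix s assume s: "s \<in> {0..T}"
    then show "sqnorm UNIV (\<lambda>x. (case (s, x) of (t, x) \<Rightarrow> f n (max 0 t) x) - (case (s, x) of (t, x) \<Rightarrow>
        limit_curve t x))
        \<le> ennreal (c T / 4 ^ n)"
      using limit_close[OF s, of n] by (simp add: sqnorm_minus_commute[of _ "f n s"])
  qed
  finally show ?thesis .
qed

lemma strip_converges:
  assumes T: "0 \<le> T"
  shows "L2_converges ({0..T} \<times> UNIV) (\<lambda>n (t, x). f n t x) (\<lambda>(t, x). limit_curve t x)"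
  unfolding L2_converges_def
proof (intro conjI allI)
  show L: "L2 ({0..T} \<times> UNIV) (\<lambda>(t, x). f n t x)" for n
  proof -
    have "sqnorm ({0..T} \<times> UNIV) (\<lambda>(t, x). f n t x) = sqnorm ({0..T} \<times> UNIV) (\<lambda>(t, x). f n (max 0 t) x)"
      by (rule sqnorm_cong) auto
    also have "\<dots> \<le> ennreal (b T) * ennreal T"
      by (rule sqnorm_strip_le[OF extended_measurable T]) (use fin in auto)
    also have "\<dots> < \<infinity>" by (simp add: ennreal_mult_less_top)
    finally show ?thesis unfolding L2_iff_sqnorm using strip_measurable by simp
  qed
  have "sqnorm ({0..T} \<times> UNIV) (\<lambda>z. (\<lambda>(t, x). limit_curve t x) z - 0) \<le>
      2 * sqnorm ({0..T} \<times> UNIV) (\<lambda>z. (\<lambda>(t, x). limit_curve t x) z - (\<lambda>(t, x). f 0 t x) z)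
      + 2 * sqnorm ({0..T} \<times> UNIV) (\<lambda>z. (\<lambda>(t, x). f 0 t x) z - 0)"
    by (rule sqnorm_triangle) (auto intro: strip_measurable)
  also have "\<dots> < \<infinity>"
    using strip_close[OF T, of 0] L[of 0] unfolding L2_iff_sqnorm
    by (subst sqnorm_minus_commute) (auto simp: ennreal_mult_less_top intro: le_less_trans)
  finally show "L2 ({0..T} \<times> UNIV) (\<lambda>(t, x). limit_curve t x)"
    unfolding L2_iff_sqnorm using strip_measurable by simp
  show "(\<lambda>n. L2_norm ({0..T} \<times> UNIV) (\<lambda>x. (case x of (t, x) \<Rightarrow> f n t x) - (case x of (t, x) \<Rightarrow>
      limit_curve t x))) \<longlonglongrightarrow> 0"
  proof (rule L2_norm_tendsto_0)
    have "(\<lambda>n. ennreal (c T / 4 ^ n) * ennreal T) \<longlonglongrightarrow> 0 * ennreal T"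
      by (intro tendsto_mult_ennreal pow_quarter_tendsto tendsto_const) auto
    then have lim: "(\<lambda>n. ennreal (c T / 4 ^ n) * ennreal T) \<longlonglongrightarrow> 0" by simp
    show "(\<lambda>n. sqnorm ({0..T} \<times> UNIV) (\<lambda>x. (case x of (t, x) \<Rightarrow> f n t x) - (case x of (t, x) \<Rightarrow>
        limit_curve t x))) \<longlonglongrightarrow> 0"
    proof (rule tendsto_sandwich[OF _ _ tendsto_const lim])
      show "\<forall>\<^sub>F n in sequentially. sqnorm ({0..T} \<times> UNIV) (\<lambda>x. (case x of (t, x) \<Rightarrow> f n t x) -
          (case x of (t, x) \<Rightarrow> limit_curve t x)) \<le> ennreal (c T / 4 ^ n) * ennreal T"
        by (intro always_eventually allI strip_close[OF T])
    qed simp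
  qed (intro borel_measurable_diff strip_measurable)
qed

end

section \<open>Well-posedness in \<open>L\<^sup>2\<close>\<close>

lemma AE_interval_witness:
  fixes a b :: real
  assumes "AE s in lborel. P s" "a < b"
  shows "\<exists>s\<in>{a<..<b}. P s"
proof (rule ccontr)
  assume "\<not> ?thesis"
  then have "AE s in lborel. s \<notin> {a<..<b}" using assms(1) by (auto elim!: eventually_mono)
  then have "{a<..<b} \<in> null_sets lborel" by (subst AE_iff_null_sets) auto
  then have "emeasure lborel {a<..<b} = 0" by auto
  then show False using assms(2) by simp
qed

lemma L2_diff:
  assumes "L2 S f" "L2 S g"
  shows "L2 S (\<lambda>x. f x - g x)"
proof -
  have [measurable]: "f \<in> borel_measurable (lebesgue_on S)" "g \<in> borel_measurable (lebesgue_on S)"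
    using assms by (auto simp: L2_iff_sqnorm)
  have "sqnorm S (\<lambda>x. f x - g x) \<le> 2 * sqnorm S (\<lambda>x. f x - 0) + 2 * sqnorm S (\<lambda>x. 0 - g x)"
    by (rule sqnorm_triangle) auto
  also have "\<dots> < \<infinity>"
    using assms unfolding sqnorm_minus_commute[of S "\<lambda>_. 0" g]
        by (auto simp: L2_iff_sqnorm ennreal_mult_less_top)
  finally show ?thesis unfolding L2_iff_sqnorm by simp
qed

lemma L2_converges_sqnorm:
  assumes "L2_converges S f g"
  shows "(\<lambda>n. sqnorm S (\<lambda>x. f n x - g x)) \<longlonglongrightarrow> 0"
  using assms unfolding L2_converges_def by (intro sqnorm_tendsto_0) (auto intro!: always_eventually
      L2_diff)

lemma continuous_L2_curve_sqnorm:
  assumes "continuous_L2_curve u" "0 \<le> t"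
  shows "((\<lambda>s. sqnorm UNIV (\<lambda>x. u s x - u t x)) \<longlongrightarrow> 0) (at t within {0..})"
proof (rule sqnorm_tendsto_0)
  have "\<forall>\<^sub>F s in at t within {0..}. s \<in> {0..}" by (simp add: eventually_at_filter)
  then show "\<forall>\<^sub>F s in at t within {0..}. L2 UNIV (\<lambda>x. u s x - u t x)"
    by eventually_elim (use assms in \<open>auto simp: continuous_L2_curve_def intro: L2_diff\<close>)
  show "((\<lambda>s. L2_norm UNIV (\<lambda>x. u s x - u t x)) \<longlongrightarrow> 0) (at t within {0..})"
    using assms by (simp add: continuous_L2_curve_def)
qed

lemma tendsto_0_cmult_ennreal:
  fixes f :: "'a \<Rightarrow> ennreal"
  assumes "(f \<longlongrightarrow> 0) F" "c < \<infinity>"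
  shows "((\<lambda>n. c * f n) \<longlongrightarrow> 0) F"
proof -
  have "((\<lambda>n. c * f n) \<longlongrightarrow> c * 0) F"
    by (rule tendsto_mult_ennreal[OF tendsto_const assms(1)]) (use assms(2) in auto)
  then show ?thesis by simp
qed

text \<open>By Fubini's theorem the curves agree at almost every time, in particular at times
  arbitrarily close to \<open>t\<close>; continuity in \<open>L\<^sup>2\<close> carries the equality over to \<open>t\<close>. The times are
  taken to the right of \<open>t\<close>, hence the requirement \<open>t < T\<close>.\<close>

lemma curves_equal_on_strip_imp_equal:
  fixes u u' :: "real \<Rightarrow> real \<Rightarrow> complex"
  assumes cu: "continuous_L2_curve u" and cu': "continuous_L2_curve u'"
    and meas: "(\<lambda>(t, x). u t x) \<in> borel_measurable (lebesgue_on ({0..T} \<times> UNIV))"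
      "(\<lambda>(t, x). u' t x) \<in> borel_measurable (lebesgue_on ({0..T} \<times> UNIV))"
    and eq: "sqnorm ({0..T} \<times> UNIV) (\<lambda>z. (\<lambda>(t, x). u' t x) z - (\<lambda>(t, x). u t x) z) = 0"
    and t: "0 \<le> t" "t < T"
  shows "AE x in lebesgue. u' t x = u t x"
proof -
  have L2: "L2 UNIV (u s)" "L2 UNIV (u' s)" if "0 \<le> s" for s
    using cu cu' that by (auto simp: continuous_L2_curve_def)
  have m: "u s \<in> borel_measurable (lebesgue_on UNIV)" "u' s \<in> borel_measurable (lebesgue_on UNIV)"
      if "0 \<le> s" for s
    using L2[OF that] by (auto simp: L2_iff_sqnorm)
  note [measurable] = meas
  have "AE z in lebesgue_on ({0..T} \<times> UNIV). ennreal ((cmod ((\<lambda>(t, x). u' t x) z - (\<lambda>(t, x). u t x)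
      z))\<^sup>2) = 0"
    using eq unfolding sqnorm_def by (subst nn_integral_0_iff_AE[symmetric]) measurable
  then have "AE z in lborel. z \<in> {0..T} \<times> UNIV \<longrightarrow> (\<lambda>(t, x). u' t x) z = (\<lambda>(t, x). u t x) z"
    by (subst (asm) AE_restrict_space_iff) (use strip_in_sets in \<open>auto simp: AE_completion_iff\<close>)
  then have "AE s in lborel. AE x in lborel. (s, x) \<in> {0..T} \<times> UNIV \<longrightarrow> (\<lambda>(t, x). u' t x) (s, x) =
      (\<lambda>(t, x). u t x) (s, x)"
    unfolding lborel_prod[symmetric] by (rule lborel_pair.AE_pair)
  then have ae: "AE s in lborel. s \<in> {0..T} \<longrightarrow> sqnorm UNIV (\<lambda>x. u' s x - u s x) = 0"
  proof eventually_elim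
    case (elim s)
    have "sqnorm UNIV (\<lambda>x. u' s x - u s x) = (\<integral>\<^sup>+x. 0 \<partial>(lborel :: real measure))" if "s \<in> {0..T}"
      unfolding sqnorm_lborel using elim that by (intro nn_integral_cong_AE) (auto elim!:
          eventually_mono)
    then show ?case by simp
  qed
  have "((\<lambda>_::nat. sqnorm UNIV (\<lambda>x. u' t x - u t x)) \<longlongrightarrow> 0) sequentially"
  proof (rule tendsto_0_ennrealI)
    fix e :: real assume e: "0 < e"
    have "\<forall>\<^sub>F s in at t within {0..}. sqnorm UNIV (\<lambda>x. u s x - u t x) \<le> ennreal (e / 10) \<and>
        sqnorm UNIV (\<lambda>x. u' s x - u' t x) \<le> ennreal (e / 10)"
      by (intro eventually_conj tendsto_0_ennrealD[OF continuous_L2_curve_sqnorm] cu cu' t) (use e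
          in auto)
    then obtain d where d: "0 < d" "\<And>s. 0 \<le> s \<Longrightarrow> s \<noteq> t \<Longrightarrow> dist s t < d \<Longrightarrow>
        sqnorm UNIV (\<lambda>x. u s x - u t x) \<le> ennreal (e / 10) \<and> sqnorm UNIV (\<lambda>x. u' s x - u' t x) \<le>
            ennreal (e / 10)"
      unfolding eventually_at by auto
    obtain s where s: "s \<in> {t<..<min (t + d) T}" "s \<in> {0..T} \<longrightarrow> sqnorm UNIV (\<lambda>x. u' s x - u s x) = 0"
      using AE_interval_witness[OF ae, of t "min (t + d) T"] d t by auto
    have s0: "0 \<le> s" "s \<noteq> t" "dist s t < d" "sqnorm UNIV (\<lambda>x. u' s x - u s x) = 0"
      using s t by (auto simp: dist_real_def)
    have "sqnorm UNIV (\<lambda>x. u' t x - u t x) \<le> 2 * sqnorm UNIV (\<lambda>x. u' t x - u' s x) +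
        2 * sqnorm UNIV (\<lambda>x. u' s x - u t x)"
      by (intro sqnorm_triangle m t s0)
    also have "\<dots> \<le> 2 * sqnorm UNIV (\<lambda>x. u' t x - u' s x) +
        2 * (2 * sqnorm UNIV (\<lambda>x. u' s x - u s x) + 2 * sqnorm UNIV (\<lambda>x. u s x - u t x))"
      by (intro add_left_mono mult_left_mono sqnorm_triangle m t s0) simp
    also have "\<dots> \<le> 2 * ennreal (e / 10) + 2 * (2 * ennreal (e / 10) + 2 * ennreal (e / 10))"
      unfolding sqnorm_minus_commute[of _ "u' t" "u' s"] using d(2)[OF s0(1-3)] s0(4)
      by (intro add_mono mult_left_mono) auto
    also have "\<dots> = ennreal e"
      using e by (simp flip: ennreal_plus ennreal_numeral ennreal_mult')
    finally show "\<forall>\<^sub>F n in sequentially. sqnorm UNIV (\<lambda>x. u' t x - u t x) \<le> ennreal e" by simp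
  qed
  then have "sqnorm UNIV (\<lambda>x. u' t x - u t x) = 0" by (simp add: tendsto_const_iff)
  moreover have "(\<lambda>x. ennreal ((cmod (u' t x - u t x))\<^sup>2)) \<in> borel_measurable (lebesgue_on UNIV)"
    using m[OF t(1)] by measurable
  ultimately have "AE x in lebesgue_on UNIV. ennreal ((cmod (u' t x - u t x))\<^sup>2) = 0"
    unfolding sqnorm_def by (simp only: nn_integral_0_iff_AE)
  then show ?thesis unfolding lebesgue_on_UNIV_eq by (rule eventually_mono) simp
qed

lemma strong_solutionI:
  assumes "continuous_L2_curve u" "continuous_L2_curve v"
    and "\<And>n. classical_solution m \<alpha> \<beta> T (un n) (vn n)"
    and "L2_converges ({0..T} \<times> UNIV) (\<lambda>n (t, x). un n t x) (\<lambda>(t, x). u t x)"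
    and "L2_converges ({0..T} \<times> UNIV) (\<lambda>n (t, x). vn n t x) (\<lambda>(t, x). v t x)"
    and "L2_converges UNIV (\<lambda>n. un n 0) u0" "L2_converges UNIV (\<lambda>n. vn n 0) v0"
  shows "strong_solution m \<alpha> \<beta> u0 v0 T u v"
  unfolding strong_solution_def
  by (rule conjI[OF assms(1)], rule conjI[OF assms(2)], rule exI[of _ un], rule exI[of _ vn])
    (intro conjI allI assms)

lemma sqnorm_le_of_close:
  assumes f: "L2 UNIV f" and g: "g \<in> borel_measurable (lebesgue_on UNIV)"
    and le: "sqnorm UNIV (\<lambda>x. f x - g x) \<le> 1"
  shows "sqnorm UNIV g \<le> 2 * sqnorm UNIV f + 2"
proof -
  have "sqnorm UNIV (\<lambda>x. g x - 0) \<le> 2 * sqnorm UNIV (\<lambda>x. g x - f x) + 2 * sqnorm UNIV (\<lambda>x. f x - 0)"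
    by (rule sqnorm_triangle) (use f g in \<open>auto simp: L2_iff_sqnorm\<close>)
  also have "\<dots> \<le> 2 * 1 + 2 * sqnorm UNIV (\<lambda>x. f x - 0)"
    unfolding sqnorm_minus_commute[of _ g f] by (intro add_right_mono mult_left_mono le) simp
  finally show ?thesis by (simp add: add.commute)
qed

text \<open>Global classical solutions whose data approach \<open>(u\<^sub>0,v\<^sub>0)\<close> geometrically fast. The number
  \<open>M\<close> bounds the charge of all data within distance 1 of \<open>(u\<^sub>0,v\<^sub>0)\<close>, so that one stability
  constant serves these solutions and the approximations of any competing strong solution.\<close>

locale approximating_solutions =
  fixes m \<alpha> \<beta> M :: real and u0 v0 :: "real \<Rightarrow> complex"
    and U V :: "nat \<Rightarrow> real \<Rightarrow> real \<Rightarrow> complex" and R :: "nat \<Rightarrow> real"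
  assumes m: "0 \<le> m" and u0: "L2 UNIV u0" and v0: "L2 UNIV v0" and M0: "0 \<le> M"
    and M: "(2 * sqnorm UNIV u0 + 2) + (2 * sqnorm UNIV v0 + 2) = ennreal M"
    and sol: "\<And>n T. classical_solution m \<alpha> \<beta> T (U n) (V n)"
    and supp: "\<And>n x. R n < \<bar>x\<bar> \<Longrightarrow> U n 0 x = 0 \<and> V n 0 x = 0"
    and close: "\<And>n. sqnorm UNIV (\<lambda>x. u0 x - U n 0 x) \<le> ennreal (1 / 4 ^ n)"
      "\<And>n. sqnorm UNIV (\<lambda>x. v0 x - V n 0 x) \<le> ennreal (1 / 4 ^ n)"
begin

definition C :: "real \<Rightarrow> real" where "C T = stability_constant m \<alpha> \<beta> T M"

lemma C_nonneg: "0 \<le> C T"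
  by (simp add: C_def stability_constant_nonneg)

lemma target_measurable: "u0 \<in> borel_measurable (lebesgue_on UNIV)"
    "v0 \<in> borel_measurable (lebesgue_on UNIV)"
  using u0 v0 by (auto simp: L2_iff_sqnorm)

lemma data_measurable: "U n 0 \<in> borel_measurable (lebesgue_on UNIV)"
    "V n 0 \<in> borel_measurable (lebesgue_on UNIV)"
  by (rule borel_measurable_lebesgue_on[OF borel_measurable_continuous_onI];
      rule classical_solution_slice[OF sol[of 0]]; simp)+

lemma charge_le_of_close:
  assumes "sqnorm UNIV (\<lambda>x. u0 x - a x) \<le> 1" "sqnorm UNIV (\<lambda>x. v0 x - b x) \<le> 1"
    "a \<in> borel_measurable (lebesgue_on UNIV)" "b \<in> borel_measurable (lebesgue_on UNIV)"
  shows "sqnorm UNIV a + sqnorm UNIV b \<le> ennreal M"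
  unfolding M[symmetric] by (intro add_mono sqnorm_le_of_close u0 v0 assms)

lemma data_charge: "sqnorm UNIV (U n 0) + sqnorm UNIV (V n 0) \<le> ennreal M"
proof -
  have q1: "ennreal (1 / 4 ^ n) \<le> 1"
    using ennreal_leI[of "1 / 4 ^ n" 1] by (simp add: divide_le_eq)
  show ?thesis
    by (intro charge_le_of_close order_trans[OF close(1) q1] order_trans[OF close(2) q1]
        data_measurable)
qed

lemma data_increment:
  assumes "n \<le> k"
  shows "sqnorm UNIV (\<lambda>x. U k 0 x - U n 0 x) + sqnorm UNIV (\<lambda>x. V k 0 x - V n 0 x) \<le>
      ennreal (8 / 4 ^ n)"
proof -
  have q: "ennreal (1 / 4 ^ k) \<le> ennreal (1 / 4 ^ n)"
    using assms by (intro ennreal_leI) (simp add: frac_le power_increasing)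
  have "sqnorm UNIV (\<lambda>x. U k 0 x - U n 0 x) \<le> 2 * sqnorm UNIV (\<lambda>x. U k 0 x - u0 x) +
      2 * sqnorm UNIV (\<lambda>x. u0 x - U n 0 x)"
    by (intro sqnorm_triangle data_measurable target_measurable)
  also have "\<dots> \<le> 2 * ennreal (1 / 4 ^ n) + 2 * ennreal (1 / 4 ^ n)"
    unfolding sqnorm_minus_commute[of _ "U k 0" u0]
    by (intro add_mono mult_left_mono close order_trans[OF close(1) q]) auto
  finally have 1: "sqnorm UNIV (\<lambda>x. U k 0 x - U n 0 x) \<le> 2 * ennreal (1 / 4 ^ n) +
      2 * ennreal (1 / 4 ^ n)" .
  have "sqnorm UNIV (\<lambda>x. V k 0 x - V n 0 x) \<le> 2 * sqnorm UNIV (\<lambda>x. V k 0 x - v0 x) +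
      2 * sqnorm UNIV (\<lambda>x. v0 x - V n 0 x)"
    by (intro sqnorm_triangle data_measurable target_measurable)
  also have "\<dots> \<le> 2 * ennreal (1 / 4 ^ n) + 2 * ennreal (1 / 4 ^ n)"
    unfolding sqnorm_minus_commute[of _ "V k 0" v0]
    by (intro add_mono mult_left_mono close order_trans[OF close(2) q]) auto
  finally have 2: "sqnorm UNIV (\<lambda>x. V k 0 x - V n 0 x) \<le> 2 * ennreal (1 / 4 ^ n) +
      2 * ennreal (1 / 4 ^ n)" .
  have "(2 * ennreal (1 / 4 ^ n) + 2 * ennreal (1 / 4 ^ n)) + (2 * ennreal (1 / 4 ^ n) +
      2 * ennreal (1 / 4 ^ n)) = ennreal (8 / 4 ^ n)"
    by (simp flip: ennreal_plus ennreal_numeral ennreal_mult')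
  then show ?thesis using add_mono[OF 1 2] by simp
qed

lemma solution_increment:
  assumes nk: "n \<le> k" and t: "t \<in> {0..T}"
  shows "sqnorm UNIV (\<lambda>x. U k t x - U n t x) + sqnorm UNIV (\<lambda>x. V k t x - V n t x) \<le>
      ennreal (8 * C T / 4 ^ n)"
proof -
  have T: "0 \<le> T" using t by auto
  have "sqnorm UNIV (\<lambda>x. U k t x - U n t x) + sqnorm UNIV (\<lambda>x. V k t x - V n t x) \<le>
      ennreal (C T) * (sqnorm UNIV (\<lambda>x. U k 0 x - U n 0 x) + sqnorm UNIV (\<lambda>x. V k 0 x - V n 0 x))"
    unfolding C_def by (rule stability(1)[OF m T M0 sol sol data_charge data_charge t])
  also have "\<dots> \<le> ennreal (C T) * ennreal (8 / 4 ^ n)" by (intro mult_left_mono data_increment nk) simp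
  also have "\<dots> = ennreal (8 * C T / 4 ^ n)" using C_nonneg[of T]
      by (simp flip: ennreal_mult' add: mult.commute)
  finally show ?thesis .
qed

lemma solution_bound:
  assumes t: "t \<in> {0..T}"
  shows "sqnorm UNIV (U n t) + sqnorm UNIV (V n t) \<le> ennreal (C T * M)"
proof -
  have "0 \<le> T" using t by auto
  from sqnorm_solution_le[OF m this M0 sol data_charge t] show ?thesis
    unfolding C_def[symmetric] using C_nonneg[of T] by (simp add: ennreal_mult')
qed

lemma solutions_continuous:
  "continuous_on ({0..T} \<times> UNIV) (\<lambda>(t, x). U n t x)" "continuous_on ({0..T} \<times> UNIV) (\<lambda>(t, x). V n t x)"
  unfolding case_prod_beta by (intro classical_solution_continuous[OF sol[of T]] continuous_intros;
      auto)+

sublocale A: fast_cauchy_curves U "\<lambda>T. C T * M" "\<lambda>T. 8 * C T"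
proof
  fix n k T t
  show "continuous_on ({0..T} \<times> UNIV) (\<lambda>(t, x). U n t x)" by (rule solutions_continuous)
  show "0 \<le> 8 * C T" using C_nonneg by simp
  show "sqnorm UNIV (U n t) \<le> ennreal (C T * M)" if "t \<in> {0..T}"
    using solution_bound[OF that, of n] by (rule order_trans[rotated]) simp
  show "sqnorm UNIV (\<lambda>x. U k t x - U n t x) \<le> ennreal (8 * C T / 4 ^ n)" if "n \<le> k" "t \<in> {0..T}"
    using solution_increment[OF that] by (rule order_trans[rotated]) simp
  show "((\<lambda>s. sqnorm UNIV (\<lambda>x. U n s x - U n t x)) \<longlongrightarrow> 0) (at t within {0..})" if "0 \<le> t"
    by (rule sqnorm_time_continuous[OF solutions_continuous(1) _ that])
        (rule finite_propagation(1)[OF m sol supp])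
qed

sublocale B: fast_cauchy_curves V "\<lambda>T. C T * M" "\<lambda>T. 8 * C T"
proof
  fix n k T t
  show "continuous_on ({0..T} \<times> UNIV) (\<lambda>(t, x). V n t x)" by (rule solutions_continuous)
  show "0 \<le> 8 * C T" using C_nonneg by simp
  show "sqnorm UNIV (V n t) \<le> ennreal (C T * M)" if "t \<in> {0..T}"
    using solution_bound[OF that, of n] by (rule order_trans[rotated]) simp
  show "sqnorm UNIV (\<lambda>x. V k t x - V n t x) \<le> ennreal (8 * C T / 4 ^ n)" if "n \<le> k" "t \<in> {0..T}"
    using solution_increment[OF that] by (rule order_trans[rotated]) simp
  show "((\<lambda>s. sqnorm UNIV (\<lambda>x. V n s x - V n t x)) \<longlongrightarrow> 0) (at t within {0..})" if "0 \<le> t"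
    by (rule sqnorm_time_continuous[OF solutions_continuous(2) _ that])
        (rule finite_propagation(2)[OF m sol supp])
qed

abbreviation "u \<equiv> A.limit_curve"
abbreviation "v \<equiv> B.limit_curve"

lemma data_limit:
  "(\<lambda>n. sqnorm UNIV (\<lambda>x. U n 0 x - u0 x)) \<longlonglongrightarrow> 0" "(\<lambda>n. sqnorm UNIV (\<lambda>x. V n 0 x - v0 x)) \<longlonglongrightarrow> 0"
  unfolding sqnorm_minus_commute[of _ "U _ 0" u0] sqnorm_minus_commute[of _ "V _ 0" v0]
  by (rule tendsto_sandwich[OF _ _ tendsto_const pow_quarter_tendsto[of 1]]; simp add: close)+

lemma data_L2: "L2 UNIV (U n 0)" "L2 UNIV (V n 0)"
  using data_charge[of n] data_measurable[of n] unfolding L2_iff_sqnorm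
      by (auto simp: order_le_less_trans[OF _ ennreal_less_top] dest!: order_le_less_trans[OF _
      ennreal_less_top])

lemma limit_strong_solution:
  assumes T: "0 < T"
  shows "strong_solution m \<alpha> \<beta> u0 v0 T u v"
proof (rule strong_solutionI[of u v m \<alpha> \<beta> T U V])
  show "continuous_L2_curve u" "continuous_L2_curve v"
    by (rule A.limit_continuous_L2_curve B.limit_continuous_L2_curve)+
  show "classical_solution m \<alpha> \<beta> T (U n) (V n)" for n by (rule sol)
  show "L2_converges ({0..T} \<times> UNIV) (\<lambda>n (t, x). U n t x) (\<lambda>(t, x). u t x)"
    by (rule A.strip_converges) (use T in simp)
  show "L2_converges ({0..T} \<times> UNIV) (\<lambda>n (t, x). V n t x) (\<lambda>(t, x). v t x)"
    by (rule B.strip_converges) (use T in simp)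
  show "L2_converges UNIV (\<lambda>n. U n 0) u0" "L2_converges UNIV (\<lambda>n. V n 0) v0"
    unfolding L2_converges_def using data_L2 u0 v0 data_limit data_measurable target_measurable
    by (auto intro!: L2_norm_tendsto_0 borel_measurable_diff)
qed

text \<open>The approximations of the competing solution and \<open>(U n, V n)\<close> have asymptotically equal
  data, so by stability their difference tends to 0 on the strip. Both solutions are therefore the
  same element of \<open>L\<^sup>2\<close> of a strip that reaches beyond \<open>t\<close>.\<close>

lemma strong_solution_unique:
  assumes gs: "global_strong_solution m \<alpha> \<beta> u0 v0 u' v'" and t: "0 \<le> t"
  shows "AE x in lebesgue. u' t x = u t x \<and> v' t x = v t x"
proof -
  define T where "T = t + 1"
  have T: "0 < T" "0 \<le> T" "t < T" using t by (auto simp: T_def)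
  let ?S = "{0..T} \<times> (UNIV :: real set)"
  obtain a b where cu: "continuous_L2_curve u'" "continuous_L2_curve v'"
    and ab: "\<And>n. classical_solution m \<alpha> \<beta> T (a n) (b n)"
    and conv: "L2_converges ?S (\<lambda>n (t, x). a n t x) (\<lambda>(t, x). u' t x)"
        "L2_converges ?S (\<lambda>n (t, x). b n t x) (\<lambda>(t, x). v' t x)"
    and init: "L2_converges UNIV (\<lambda>n. a n 0) u0" "L2_converges UNIV (\<lambda>n. b n 0) v0"
    using gs T(1) unfolding global_strong_solution_def strong_solution_def by blast
  have abm: "a n 0 \<in> borel_measurable (lebesgue_on UNIV)" "b n 0 \<in> borel_measurable (lebesgue_on
      UNIV)" for n
    using init unfolding L2_converges_def L2_iff_sqnorm by auto
  note i = L2_converges_sqnorm[OF init(1)] L2_converges_sqnorm[OF init(2)]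
  define d where "d n = sqnorm UNIV (\<lambda>x. a n 0 x - U n 0 x) + sqnorm UNIV (\<lambda>x. b n 0 x - V n 0 x)" for n
  have "d \<longlonglongrightarrow> 0"
  proof -
    let ?h = "\<lambda>n. (2 * sqnorm UNIV (\<lambda>x. a n 0 x - u0 x) + 2 * sqnorm UNIV (\<lambda>x. U n 0 x - u0 x)) +
       (2 * sqnorm UNIV (\<lambda>x. b n 0 x - v0 x) + 2 * sqnorm UNIV (\<lambda>x. V n 0 x - v0 x))"
    have "?h \<longlonglongrightarrow> (0 + 0) + (0 + 0)"
      by (intro tendsto_add tendsto_0_cmult_ennreal i data_limit) auto
    then have h: "?h \<longlonglongrightarrow> 0" by simp
    have "d n \<le> ?h n" for n
      unfolding d_def sqnorm_minus_commute[of _ "U n 0" u0] sqnorm_minus_commute[of _ "V n 0" v0]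
      by (intro add_mono sqnorm_triangle abm data_measurable target_measurable)
    then show ?thesis by (intro tendsto_sandwich[OF _ _ tendsto_const h]) auto
  qed
  then have dlim: "(\<lambda>n. ennreal T * (ennreal (C T) * d n)) \<longlonglongrightarrow> 0"
    by (intro tendsto_0_cmult_ennreal) auto
  have ev1: "\<forall>\<^sub>F n in sequentially. sqnorm UNIV (\<lambda>x. u0 x - a n 0 x) \<le> 1 \<and>
      sqnorm UNIV (\<lambda>x. v0 x - b n 0 x) \<le> 1"
    using tendsto_0_ennrealD[OF i(1), of 1] tendsto_0_ennrealD[OF i(2), of 1]
    unfolding sqnorm_minus_commute[of _ u0] sqnorm_minus_commute[of _ v0]
    by (auto intro: eventually_conj)
  \<comment> \<open>Clamping the time to \<open>[0,T]\<close> extends the solutions continuously to the plane, which makes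
      them Borel measurable there.\<close>
  define cl where "cl s = max 0 (min T s)" for s
  have clT: "cl s \<in> {0..T}" for s using T by (auto simp: cl_def)
  have clc: "continuous_on UNIV (\<lambda>z :: real \<times> real. cl (fst z))" unfolding cl_def
      by (intro continuous_intros)
  have strip: "\<forall>\<^sub>F n in sequentially.
      sqnorm ?S (\<lambda>z. (\<lambda>(t, x). a n t x) z - (\<lambda>(t, x). U n t x) z) \<le> ennreal T * (ennreal (C T) * d n) \<and>
      sqnorm ?S (\<lambda>z. (\<lambda>(t, x). b n t x) z - (\<lambda>(t, x). V n t x) z) \<le> ennreal T * (ennreal (C T) * d n)"
    using ev1
  proof eventually_elim
    case (elim n)
    have abM: "sqnorm UNIV (a n 0) + sqnorm UNIV (b n 0) \<le> ennreal M"
      using elim by (intro charge_le_of_close abm) auto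
    have st: "sqnorm UNIV (\<lambda>x. a n s x - U n s x) + sqnorm UNIV (\<lambda>x. b n s x - V n s x) \<le>
        ennreal (C T) * d n"
      if "s \<in> {0..T}" for s
      unfolding C_def d_def by (rule stability(1)[OF m T(2) M0 ab sol abM data_charge that])
    have gen: "sqnorm ?S (\<lambda>z. (\<lambda>(t, x). f t x) z - (\<lambda>(t, x). g t x) z) \<le>
        ennreal T * (ennreal (C T) * d n)"
      if f: "continuous_on UNIV (\<lambda>z. f (cl (fst z)) (snd z))" and g:
          "continuous_on UNIV (\<lambda>z. g (cl (fst z)) (snd z))"
        and le: "\<And>s. s \<in> {0..T} \<Longrightarrow> sqnorm UNIV (\<lambda>x. f s x - g s x) \<le> ennreal (C T) * d n"
      for f g :: "real \<Rightarrow> real \<Rightarrow> complex"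
    proof -
      have "sqnorm ?S (\<lambda>z. (\<lambda>(t, x). f t x) z - (\<lambda>(t, x). g t x) z) =
          sqnorm ?S (\<lambda>z. f (cl (fst z)) (snd z) - g (cl (fst z)) (snd z))"
        by (rule sqnorm_cong) (auto simp: cl_def min_absorb2 max_absorb2)
      also have "\<dots> \<le> (ennreal (C T) * d n) * ennreal T"
        by (rule sqnorm_strip_le[OF _ T(2)])
          (use le[OF clT] in \<open>auto intro!: borel_measurable_continuous_onI continuous_intros f g\<close>)
      finally show ?thesis by (simp add: mult.commute)
    qed
    note cc = classical_solution_continuous[OF ab clc continuous_on_snd[OF continuous_on_id] clT]
      classical_solution_continuous[OF sol[of T] clc continuous_on_snd[OF continuous_on_id] clT]
    show ?case
    proof
      show "sqnorm ?S (\<lambda>z. (\<lambda>(t, x). a n t x) z - (\<lambda>(t, x). U n t x) z) \<le>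
          ennreal T * (ennreal (C T) * d n)"
        by (rule gen[OF cc(1,3)]) (rule order_trans[OF add_increasing2[OF zero_le order_refl] st])
      show "sqnorm ?S (\<lambda>z. (\<lambda>(t, x). b n t x) z - (\<lambda>(t, x). V n t x) z) \<le>
          ennreal T * (ennreal (C T) * d n)"
        by (rule gen[OF cc(2,4)]) (rule order_trans[OF add_increasing[OF zero_le order_refl] st])
    qed
  qed
  have zero: "sqnorm ?S (\<lambda>z. f' z - f z) = 0"
    if p: "L2_converges ?S p f'" and q: "L2_converges ?S q f"
      and le: "\<forall>\<^sub>F n in sequentially. sqnorm ?S (\<lambda>z. p n z - q n z) \<le> ennreal T * (ennreal (C T) * d n)"
    for p q :: "nat \<Rightarrow> real \<times> real \<Rightarrow> complex" and f f'
  proof -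
    have mm: "p n \<in> borel_measurable (lebesgue_on ?S)" "q n \<in> borel_measurable (lebesgue_on ?S)"
      "f \<in> borel_measurable (lebesgue_on ?S)" "f' \<in> borel_measurable (lebesgue_on ?S)" for n
      using p q unfolding L2_converges_def L2_iff_sqnorm by auto
    let ?h = "\<lambda>n. 2 * sqnorm ?S (\<lambda>z. p n z - f' z) + (2 * (2 * (ennreal T * (ennreal (C T) * d n)))
        + 2 * (2 * sqnorm ?S (\<lambda>z. q n z - f z)))"
    have "?h \<longlonglongrightarrow> 0 + (0 + 0)"
      by (intro tendsto_add tendsto_0_cmult_ennreal dlim L2_converges_sqnorm p q) auto
    then have h: "?h \<longlonglongrightarrow> 0" by simp
    have "\<forall>\<^sub>F n in sequentially. sqnorm ?S (\<lambda>z. f' z - f z) \<le> ?h n"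
      using le
    proof eventually_elim
      case (elim n)
      have "sqnorm ?S (\<lambda>z. f' z - f z) \<le> 2 * sqnorm ?S (\<lambda>z. f' z - p n z) +
          2 * sqnorm ?S (\<lambda>z. p n z - f z)"
        by (intro sqnorm_triangle mm)
      also have "\<dots> \<le> 2 * sqnorm ?S (\<lambda>z. f' z - p n z) +
          2 * (2 * sqnorm ?S (\<lambda>z. p n z - q n z) + 2 * sqnorm ?S (\<lambda>z. q n z - f z))"
        by (intro add_left_mono mult_left_mono sqnorm_triangle mm) simp
      also have "\<dots> \<le> ?h n"
        unfolding sqnorm_minus_commute[of _ f' "p n"] distrib_left
        by (intro add_left_mono add_right_mono mult_left_mono elim) simp_all
      finally show ?case .
    qed
    from tendsto_lowerbound[OF h this] show ?thesis by simp
  qed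
  have "AE x in lebesgue. u' t x = u t x"
  proof (rule curves_equal_on_strip_imp_equal[OF _ cu(1) _ _ _ t T(3)])
    show "continuous_L2_curve u" by (rule A.limit_continuous_L2_curve)
    show "(\<lambda>(t, x). u t x) \<in> borel_measurable (lebesgue_on ?S)" by (rule A.strip_measurable)
    show "(\<lambda>(t, x). u' t x) \<in> borel_measurable (lebesgue_on ?S)"
      using conv(1) unfolding L2_converges_def L2_iff_sqnorm by simp
    show "sqnorm ?S (\<lambda>z. (\<lambda>(t, x). u' t x) z - (\<lambda>(t, x). u t x) z) = 0"
      by (rule zero[OF conv(1) A.strip_converges[OF T(2)] eventually_mono[OF strip]]) blast
  qed
  moreover have "AE x in lebesgue. v' t x = v t x"
  proof (rule curves_equal_on_strip_imp_equal[OF _ cu(2) _ _ _ t T(3)])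
    show "continuous_L2_curve v" by (rule B.limit_continuous_L2_curve)
    show "(\<lambda>(t, x). v t x) \<in> borel_measurable (lebesgue_on ?S)" by (rule B.strip_measurable)
    show "(\<lambda>(t, x). v' t x) \<in> borel_measurable (lebesgue_on ?S)"
      using conv(2) unfolding L2_converges_def L2_iff_sqnorm by simp
    show "sqnorm ?S (\<lambda>z. (\<lambda>(t, x). v' t x) z - (\<lambda>(t, x). v t x) z) = 0"
      by (rule zero[OF conv(2) B.strip_converges[OF T(2)] eventually_mono[OF strip]]) blast
  qed
  ultimately show ?thesis by eventually_elim simp
qed

text \<open>The dissipation in the stability estimate, applied to \<open>(U n, V n)\<close> and the zero solution,
  bounds the integral of \<open>|U n|\<^sup>2 |V n|\<^sup>2\<close> uniformly in \<open>n\<close>.\<close>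

lemma limit_product_L2:
  assumes T: "0 < T"
  shows "L2 ({0..T} \<times> UNIV) (\<lambda>(t, x). cmod (u t x) * cmod (v t x))"
proof -
  have T0: "0 \<le> T" using T by simp
  have um[measurable]: "(\<lambda>(t, x). u t x) \<in> borel_measurable borel"
      "(\<lambda>(t, x). v t x) \<in> borel_measurable borel"
    by (rule A.limit_measurable B.limit_measurable)+
  have [measurable]: "(\<lambda>(t, x). U n (max 0 t) x) \<in> borel_measurable borel"
      "(\<lambda>(t, x). V n (max 0 t) x) \<in> borel_measurable borel" for n
    by (rule A.extended_measurable B.extended_measurable)+
  define e where "e n z = (cmod ((\<lambda>(t, x). U n (max 0 t) x) z))\<^sup>2 * (cmod ((\<lambda>(t, x). V n (max 0 t)
      x) z))\<^sup>2" for n z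
  have em[measurable]: "e n \<in> borel_measurable borel" for n unfolding e_def[abs_def] by measurable
  \<comment> \<open>The cut-off in space grows with \<open>n\<close> and disappears in the limit.\<close>
  define g where "g n z = ennreal (e n z) * indicator {- real n..real n} (snd z) * indicator {0..T}
      (fst z)" for n and z :: "real \<times> real"
  have gm: "g n \<in> borel_measurable borel" for n
  proof -
    have "fst \<in> borel_measurable (borel :: (real \<times> real) measure)"
        "snd \<in> borel_measurable (borel :: (real \<times> real) measure)"
      by (auto intro!: borel_measurable_continuous_onI continuous_intros)
    then show ?thesis unfolding g_def[abs_def] by measurable
  qed
  define F where "F = (\<lambda>(t, x). cmod (u t x) * cmod (v t x))"
  have Fm: "F \<in> borel_measurable borel"
  proof -
    have "(\<lambda>z. cmod ((\<lambda>(t, x). u t x) z) * cmod ((\<lambda>(t, x). v t x) z)) \<in> borel_measurable borel"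
        by measurable
    then show ?thesis unfolding F_def by (simp add: case_prod_beta')
  qed
  have "sqnorm ({0..T} \<times> UNIV) F = (\<integral>\<^sup>+z. ennreal ((norm (F z))\<^sup>2) * indicator ({0..T} \<times> UNIV) z
      \<partial>lborel)"
    unfolding sqnorm_def by (subst nn_integral_restrict_space) (use strip_in_sets
        in \<open>auto simp: nn_integral_completion\<close>)
  also have "\<dots> \<le> ennreal (C T) * ennreal M"
  proof (rule nn_integral_le_of_tendsto[where g = g])
    show "g n \<in> borel_measurable lborel" for n using gm by simp
    have "AE z in lborel. (\<lambda>n. g n z) \<longlonglongrightarrow> ennreal ((norm (F z))\<^sup>2) * indicator ({0..T} \<times> UNIV) z"
      using A.convergent_ae B.convergent_ae
    proof eventually_elim
      case (elim z)
      obtain t x where z: "z = (t, x)" by (cases z)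
      have "(\<lambda>n. U n (max 0 t) x) \<longlonglongrightarrow> u t x" "(\<lambda>n. V n (max 0 t) x) \<longlonglongrightarrow> v t x"
        using elim unfolding z A.limit_curve_def B.limit_curve_def
            by (simp_all add: convergent_LIMSEQ_iff)
      then have "(\<lambda>n. ennreal (e n z)) \<longlonglongrightarrow> ennreal ((cmod (u t x))\<^sup>2 * (cmod (v t x))\<^sup>2)"
        unfolding e_def z by (auto intro!: tendsto_intros)
      then have lim: "(\<lambda>n. ennreal (e n z)) \<longlonglongrightarrow> ennreal ((norm (F z))\<^sup>2)"
        by (simp add: F_def z power_mult_distrib)
      have "\<forall>\<^sub>F n in sequentially. \<bar>x\<bar> \<le> real n"
        using eventually_ge_at_top[of "nat \<lceil>\<bar>x\<bar>\<rceil>"]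
        by (rule eventually_mono) (meson of_nat_le_iff order_trans real_nat_ceiling_ge)
      then have ev: "\<forall>\<^sub>F n in sequentially. ennreal (e n z) * indicator ({0..T} \<times> UNIV) z = g n z"
        by eventually_elim (auto simp: g_def z indicator_def abs_le_iff)
      have "(\<lambda>n. ennreal (e n z) * indicator ({0..T} \<times> UNIV) z) \<longlonglongrightarrow>
          ennreal ((norm (F z))\<^sup>2) * indicator ({0..T} \<times> UNIV) z"
        by (cases "z \<in> {0..T} \<times> UNIV") (use lim in simp_all)
      then show ?case using ev by (rule Lim_transform_eventually)
    qed
    then show "AE z in lborel. (\<lambda>n. g n z) \<longlonglongrightarrow> ennreal ((norm (F z))\<^sup>2) * indicator ({0..T} \<times> UNIV) z" .
    have "(\<integral>\<^sup>+z. g n z \<partial>lborel) \<le> ennreal (C T) * ennreal M" for n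
    proof -
      have "(\<integral>\<^sup>+z. g n z \<partial>lborel) = (\<integral>\<^sup>+s. \<integral>\<^sup>+x. g n (s, x) \<partial>lborel \<partial>lborel)"
        by (rule nn_integral_lborel_pair[OF gm])
      also have "\<dots> = (\<integral>\<^sup>+s. (\<integral>\<^sup>+x. ennreal ((cmod (U n s x - 0))\<^sup>2 * (cmod (V n s x))\<^sup>2) * indicator
          {- real n..real n} x \<partial>lborel)
          * indicator {0..T} s \<partial>lborel)"
        by (intro nn_integral_cong) (auto simp: g_def e_def indicator_def)
      also have "\<dots> \<le> ennreal (C T) * (sqnorm UNIV (\<lambda>x. U n 0 x - 0) + sqnorm UNIV (\<lambda>x. V n 0 x - 0))"
        unfolding C_def
        by (rule stability(2)[OF m T0 M0 sol classical_solution_zero data_charge]) (simp add: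
            sqnorm_def)
      also have "\<dots> \<le> ennreal (C T) * ennreal M" using data_charge[of n] by (intro mult_left_mono) auto
      finally show ?thesis .
    qed
    then show "\<forall>\<^sub>F n in sequentially. (\<integral>\<^sup>+z. g n z \<partial>lborel) \<le> ennreal (C T) * ennreal M" by simp
  qed
  also have "\<dots> < \<infinity>" by (simp add: ennreal_mult_less_top)
  finally show ?thesis
    unfolding F_def[symmetric] L2_iff_sqnorm using borel_measurable_lebesgue_on[OF Fm] by simp
qed

end

theorem theorem1p1:
  fixes m \<alpha> \<beta> :: real
    and u0 v0 :: "real \<Rightarrow> complex"
  assumes "m \<ge> 0"
    and "L2 UNIV u0" and "L2 UNIV v0"
  shows "\<exists>u v :: real \<Rightarrow> real \<Rightarrow> complex.
    global_strong_solution m \<alpha> \<beta> u0 v0 u v \<and>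
    (\<forall>u' v'. global_strong_solution m \<alpha> \<beta> u0 v0 u' v' \<longrightarrow>
       (\<forall>t\<ge>0. AE x in lebesgue. u' t x = u t x \<and> v' t x = v t x)) \<and>
    (\<forall>T>0. L2 ({0..T} \<times> UNIV) (\<lambda>(t, x). cmod (u t x) * cmod (v t x)))"
proof -
  define M where "M = enn2real ((2 * sqnorm UNIV u0 + 2) + (2 * sqnorm UNIV v0 + 2))"
  have M: "(2 * sqnorm UNIV u0 + 2) + (2 * sqnorm UNIV v0 + 2) = ennreal M"
    using assms(2,3) by (simp add: M_def L2_iff_sqnorm ennreal_mult_less_top)
  have "\<forall>n. \<exists>w. (\<forall>T. classical_solution m \<alpha> \<beta> T (fst w) (fst (snd w))) \<and>
     (\<forall>x. snd (snd w) < \<bar>x\<bar> \<longrightarrow> fst w 0 x = 0 \<and> fst (snd w) 0 x = 0) \<and>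
     sqnorm UNIV (\<lambda>x. u0 x - fst w 0 x) \<le> ennreal (1 / 4 ^ n) \<and>
         sqnorm UNIV (\<lambda>x. v0 x - fst (snd w) 0 x) \<le> ennreal (1 / 4 ^ n)"
  proof
    fix n :: nat
    obtain u v R where "(\<forall>T. classical_solution m \<alpha> \<beta> T u v) \<and> (\<forall>x. R < \<bar>x\<bar> \<longrightarrow> u 0 x = 0 \<and> v 0 x = 0) \<and>
     sqnorm UNIV (\<lambda>x. u0 x - u 0 x) \<le> ennreal (1 / 4 ^ n) \<and> sqnorm UNIV (\<lambda>x. v0 x - v 0 x) \<le>
         ennreal (1 / 4 ^ n)"
      using approximate_global_solution[OF assms, of "1 / 4 ^ n" \<alpha> \<beta>] by auto
    then show "\<exists>w. (\<forall>T. classical_solution m \<alpha> \<beta> T (fst w) (fst (snd w))) \<and>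
     (\<forall>x. snd (snd w) < \<bar>x\<bar> \<longrightarrow> fst w 0 x = 0 \<and> fst (snd w) 0 x = 0) \<and>
     sqnorm UNIV (\<lambda>x. u0 x - fst w 0 x) \<le> ennreal (1 / 4 ^ n) \<and>
         sqnorm UNIV (\<lambda>x. v0 x - fst (snd w) 0 x) \<le> ennreal (1 / 4 ^ n)"
      by (intro exI[of _ "(u, v, R)"]) simp
  qed
  from choice[OF this] obtain W where W: "\<And>n. (\<forall>T. classical_solution m \<alpha> \<beta> T (fst (W n))
      (fst (snd (W n)))) \<and>
     (\<forall>x. snd (snd (W n)) < \<bar>x\<bar> \<longrightarrow> fst (W n) 0 x = 0 \<and> fst (snd (W n)) 0 x = 0) \<and>
     sqnorm UNIV (\<lambda>x. u0 x - fst (W n) 0 x) \<le> ennreal (1 / 4 ^ n) \<and>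
     sqnorm UNIV (\<lambda>x. v0 x - fst (snd (W n)) 0 x) \<le> ennreal (1 / 4 ^ n)" by blast
  define U V R where "U n = fst (W n)" and "V n = fst (snd (W n))" and "R n = snd (snd (W n))" for n
  have sol: "\<And>n T. classical_solution m \<alpha> \<beta> T (U n) (V n)"
    and supp: "\<And>n x. R n < \<bar>x\<bar> \<Longrightarrow> U n 0 x = 0 \<and> V n 0 x = 0"
    and close: "\<And>n. sqnorm UNIV (\<lambda>x. u0 x - U n 0 x) \<le> ennreal (1 / 4 ^ n)"
      "\<And>n. sqnorm UNIV (\<lambda>x. v0 x - V n 0 x) \<le> ennreal (1 / 4 ^ n)"
    using W unfolding U_def V_def R_def by blast+
  interpret approximating_solutions m \<alpha> \<beta> M u0 v0 U V R
    by unfold_locales (use assms M sol supp close in \<open>auto simp: M_def\<close>)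
  have "global_strong_solution m \<alpha> \<beta> u0 v0 u v"
    unfolding global_strong_solution_def using limit_strong_solution by blast
  then show ?thesis
    using strong_solution_unique limit_product_L2 by blast
qed

end
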